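(* Let $w_1=s_0$, $w_2=s_1s_0$, $w_3=s_0s_1s_0$, and so on (alternating), where $s_0=\begin{pmatrix} 0 & i z^{-1} \\ i z & 0 \end{pmatrix}$ and $s_1=\begin{pmatrix} 0 & i \\ i & 0 \end{pmatrix}$. For every $n>0$ the following hold. (a) $$N^{-}\cap w_n^{-1}N^{+}w_n=\left\{\begin{pmatrix}1&\sum_{j=1}^nx_jz^{-j}\\ 0&1\end{pmatrix}:x_j\in\mathbb C\right\}.$$ (b) For $\zeta=(\zeta_1,\dots,\zeta_n)\in\mathbb C^n$ let $$g=g(\zeta)=a(\zeta_n)\begin{pmatrix}1&\zeta_nz^{-n}\\ -\bar\zeta_nz^n&1\end{pmatrix}\cdots a(\zeta_1)\begin{pmatrix}1&\zeta_1z^{-1}\\ -\bar\zeta_1z&1\end{pmatrix},\qquad a(t)=(1+|t|^2)^{-1/2}.$$ Then $g$ has a triangular factorization $g=l(\zeta)\,a\,u$ with $l(\zeta)\in N^-\cap w_n^{-1}N^+w_n$, $a$ a constant diagonal matrix with positive entries and determinant $1$, and $u\in N^+$; write $l(\zeta)=\begin{pmatrix}1&x^{(n)}\\ 0&1\end{pmatrix}$, $x^{(n)}=\sum_{j=1}^nx^{(n)}_j(\zeta_1,\dots,\zeta_n)z^{-j}$. The map $\mathbb C^n\to\mathbb C^n$, $\zeta\mapsto(x^{(n)}_1,\dots,x^{(n)}_n)$, is a diffeomorphism; for $n<N$, $$x_j^{(n)}(\zeta_1,\dots,\zeta_n)=x_j^{(N)}(\zeta_1,\dots,\zeta_n,0,\dots,0)$$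 (so the superscript may be suppressed), and $$x_j^{(n)}(\zeta_1,\dots,\zeta_n)=x_1(\zeta_j,\dots,\zeta_n,0,\dots).$$ (c) With $g=g(\zeta)$ and $x_j=x^{(n)}_j(\zeta)$, $$|\sigma_0|^2(g)=\frac1{\det\Big(1+B\big(\sum_{j=1}^nx_jz^j\big)B\big(\sum_{j=1}^nx_jz^j\big)^*\Big)}=\prod_{j=1}^n\frac1{(1+|\zeta_j|^2)^j},$$ $$|\sigma_1|^2(g)=\frac1{\det\Big(1+B\big(\sum_{j=1}^{n-1}x_{j+1}z^j\big)B\big(\sum_{j=1}^{n-1}x_{j+1}z^j\big)^*\Big)}=\prod_{j=1}^{n-1}\frac1{(1+|\zeta_{j+1}|^2)^{j}},$$ and in particular $\dfrac{|\sigma_0|(g)}{|\sigma_1|(g)}=\prod_{j=1}^n\dfrac1{(1+|\zeta_j|^2)^{1/2}}$. (d) More generally, for $0\le l<n$, $$\det\Big(1+B\Big(\sum_{j=1}^{n-l}x_{j+l}z^j\Big)B\Big(\sum_{j=1}^{n-l}x_{j+l}z^j\Big)^*\Big)=\prod_{j=1}^{n-l}(1+|\zeta_{j+l}|^2)^j.$$ (e) $$\prod_{j=1}^nd\lambda(x_j)=(1+|\zeta_2|^2)^2(1+|\zeta_3|^2)^4\cdots(1+|\zeta_n|^2)^{2(n-1)}\prod_{j=1}^nd\lambda(\zeta_j).$$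
   Context: $N^+$ is the group of holomorphic maps $u$ from (a neighbourhood of) the closed unit disk to $SL(2,\mathbb C)$ with $u(0)$ upper triangular unipotent. $N^-$ is the group of holomorphic maps $l$ from (a neighbourhood of) $\{|z|\ge1\}\cup\{\infty\}$ to $SL(2,\mathbb C)$ with $l(\infty)$ lower triangular unipotent. Both are viewed as groups of loops on $S^1$. For $g\in LSU(2)$ (a smooth, e.g. real analytic, loop $S^1\to SU(2)$), let $A(g)$ be the Toeplitz operator $f\mapsto P_+(gf)$ on the Hardy space $\mathcal H_+\subset L^2(S^1,\mathbb C^2)$. Set $|\sigma_0|^2(g)=\det(A(g)^*A(g))$ (Fredholm determinant) and $|\sigma_1|^2(g)=|\sigma_0|^2\Big(\begin{pmatrix}z^{1/2}&0\\ 0&z^{-1/2}\end{pmatrix}g\begin{pmatrix}z^{-1/2}&0\\ 0&z^{1/2}\end{pmatrix}\Big)$ (the conjugated loop is single valued); $|\sigma_0|,|\sigma_1|$ are the nonnegative square roots. For $m\ge1$, $B\big(\sum_{j=1}^my_jz^j\big)$ is the $m\times m$ lower triangular Toeplitz matrix whose $(r,s)$ entry is $y_{m-(r-s)}$ for $r\ge s$ and $0$ for $r<s$ (so $y_m$ on the diagonal and $y_1$ in the lower left corner); for $m=0$ the determinant is $1$. $d\lambda$ is Lebesgue measure on $\mathbb C$. *)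

theory Defs
  imports
    "HOL-Analysis.Analysis"
    "HOL-Combinatorics.Permutations"
    "Jordan_Normal_Form.Schur_Decomposition"
begin

section \<open>Loops and the groups of triangular factors\<close>

text \<open>
  A matrix valued loop is a function on the unit circle, represented by a function on
  \<^typ>\<open>complex\<close> that is extensional on the circle. Hence equality of loops is equality
  on the circle.
\<close>

type_synonym loop = "complex \<Rightarrow> complex^2^2"

abbreviation circle :: "complex set" where
  "circle \<equiv> sphere 0 1"

definition mat2 :: "complex \<Rightarrow> complex \<Rightarrow> complex \<Rightarrow> complex \<Rightarrow> complex^2^2" where
  "mat2 a b c d = vector [vector [a, b], vector [c, d]]"

definition holomorphic_SL2 :: "complex set \<Rightarrow> loop \<Rightarrow> bool" where
  "holomorphic_SL2 U u \<longleftrightarrow>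
     (\<forall>i j. (\<lambda>z. u z $ i $ j) holomorphic_on U) \<and> (\<forall>z\<in>U. Determinants.det (u z) = 1)"

definition upper_unipotent :: "complex^2^2 \<Rightarrow> bool" where
  "upper_unipotent A \<longleftrightarrow> A $ 1 $ 1 = 1 \<and> A $ 2 $ 2 = 1 \<and> A $ 2 $ 1 = 0"

definition lower_unipotent :: "complex^2^2 \<Rightarrow> bool" where
  "lower_unipotent A \<longleftrightarrow> A $ 1 $ 1 = 1 \<and> A $ 2 $ 2 = 1 \<and> A $ 1 $ 2 = 0"

definition N_plus :: "loop set" where
  "N_plus = {(\<lambda>z\<in>circle. u z) | u U.
     open U \<and> cball 0 1 \<subseteq> U \<and> holomorphic_SL2 U u \<and> upper_unipotent (u 0)}"

text \<open>
  Maps holomorphic near the closed exterior disk including infinity are written in the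
  coordinate \<open>w = 1/z\<close>, so that \<open>v 0\<close> is the value at infinity.
\<close>

definition N_minus :: "loop set" where
  "N_minus = {(\<lambda>z\<in>circle. v (inverse z)) | v U.
     open U \<and> cball 0 1 \<subseteq> U \<and> holomorphic_SL2 U v \<and> lower_unipotent (v 0)}"

definition conj_loops :: "loop \<Rightarrow> loop set \<Rightarrow> loop set" where
  "conj_loops w G = (\<lambda>u. \<lambda>z\<in>circle. matrix_inv (w z) ** u z ** w z) ` G"

definition s0 :: loop where
  "s0 z = mat2 0 (\<i> * inverse z) (\<i> * z) 0"

definition s1 :: loop where
  "s1 z = mat2 0 \<i> \<i> 0"

text \<open>\<open>w_loop 1 = s0\<close>, \<open>w_loop 2 = s1 s0\<close>, \<open>w_loop 3 = s0 s1 s0\<close>, and so on.\<close>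

primrec w_loop :: "nat \<Rightarrow> loop" where
  "w_loop 0 z = mat2 1 0 0 1"
| "w_loop (Suc n) z = (if even n then s0 z else s1 z) ** w_loop n z"

definition upper_loop :: "nat \<Rightarrow> (nat \<Rightarrow> complex) \<Rightarrow> loop" where
  "upper_loop n x = (\<lambda>z\<in>circle. mat2 1 (\<Sum>j=1..n. x j * z powi (- int j)) 0 1)"

definition triangular_factorization :: "loop \<Rightarrow> loop \<Rightarrow> complex^2^2 \<Rightarrow> loop \<Rightarrow> bool" where
  "triangular_factorization g l a u \<longleftrightarrow>
     l \<in> N_minus \<and> u \<in> N_plus \<and>
     (\<exists>a1 a2 :: real. a1 > 0 \<and> a2 > 0 \<and> a1 * a2 = 1 \<and>
        a = mat2 (of_real a1) 0 0 (of_real a2)) \<and>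
     g = (\<lambda>z\<in>circle. l z ** a ** u z)"


section \<open>The loops \<open>g(\<zeta>)\<close> and their coordinates\<close>

text \<open>
  Since the dimension varies, a point of \<open>\<complex>\<^sup>n\<close> is a function extensional on \<open>{1..n}\<close>.
  The topology inherited from \<^typ>\<open>nat \<Rightarrow> complex\<close> is the Euclidean one, and this set is
  the space of the measure \<open>\<Pi>\<^sub>M j\<in>{1..n}. lborel\<close>.
\<close>

definition Cn :: "nat \<Rightarrow> (nat \<Rightarrow> complex) set" where
  "Cn n = ({1..n} \<rightarrow>\<^sub>E UNIV)"

definition elem_factor :: "nat \<Rightarrow> complex \<Rightarrow> complex \<Rightarrow> complex^2^2" where
  "elem_factor k t z =
     (let a = of_real (1 / sqrt (1 + (cmod t)\<^sup>2))
      in mat2 a (a * (t * z powi (- int k))) (a * (- cnj t * z ^ k)) a)"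

primrec g_prod :: "nat \<Rightarrow> (nat \<Rightarrow> complex) \<Rightarrow> loop" where
  "g_prod 0 \<zeta> z = mat2 1 0 0 1"
| "g_prod (Suc n) \<zeta> z = elem_factor (Suc n) (\<zeta> (Suc n)) z ** g_prod n \<zeta> z"

definition g_loop :: "nat \<Rightarrow> (nat \<Rightarrow> complex) \<Rightarrow> loop" where
  "g_loop n \<zeta> = (\<lambda>z\<in>circle. g_prod n \<zeta> z)"

definition x_coords :: "nat \<Rightarrow> (nat \<Rightarrow> complex) \<Rightarrow> (nat \<Rightarrow> complex)" where
  "x_coords n \<zeta> = (THE x. x \<in> Cn n \<and>
     (\<exists>a u. triangular_factorization (g_loop n \<zeta>) (upper_loop n x) a u))"

text \<open>
  Smoothness is over the reals: the coordinate directions are \<open>1\<close> and \<open>\<i>\<close> in each of the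
  \<open>n\<close> complex coordinates, and all iterated partial derivatives exist and are continuous.
\<close>

definition line_at :: "((nat \<Rightarrow> complex) \<Rightarrow> complex) \<Rightarrow> nat \<Rightarrow> complex \<Rightarrow> (nat \<Rightarrow> complex)
    \<Rightarrow> real \<Rightarrow> complex" where
  "line_at f k v p t = f (p(k := p k + of_real t * v))"

definition partial_deriv :: "nat \<Rightarrow> complex \<Rightarrow> ((nat \<Rightarrow> complex) \<Rightarrow> complex)
    \<Rightarrow> (nat \<Rightarrow> complex) \<Rightarrow> complex" where
  "partial_deriv k v f p = vector_derivative (line_at f k v p) (at 0)"

primrec Ck_fun :: "nat \<Rightarrow> nat \<Rightarrow> ((nat \<Rightarrow> complex) \<Rightarrow> complex) \<Rightarrow> bool" where
  "Ck_fun n 0 f \<longleftrightarrow> continuous_on (Cn n) f"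
| "Ck_fun n (Suc m) f \<longleftrightarrow> continuous_on (Cn n) f \<and>
     (\<forall>k\<in>{1..n}. \<forall>v\<in>{1, \<i>}.
        (\<forall>p\<in>Cn n. line_at f k v p differentiable (at 0)) \<and> Ck_fun n m (partial_deriv k v f))"

definition smooth_map :: "nat \<Rightarrow> ((nat \<Rightarrow> complex) \<Rightarrow> (nat \<Rightarrow> complex)) \<Rightarrow> bool" where
  "smooth_map n F \<longleftrightarrow> (\<forall>j\<in>{1..n}. \<forall>m. Ck_fun n m (\<lambda>p. F p j))"

definition diffeomorphism :: "nat \<Rightarrow> ((nat \<Rightarrow> complex) \<Rightarrow> (nat \<Rightarrow> complex)) \<Rightarrow> bool" where
  "diffeomorphism n F \<longleftrightarrow>
     bij_betw F (Cn n) (Cn n) \<and> smooth_map n F \<and> smooth_map n (the_inv_into (Cn n) F)"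


section \<open>Toeplitz operators and Fredholm determinants\<close>

text \<open>Normalised arc length on the unit circle.\<close>

definition circle_measure :: "complex measure" where
  "circle_measure =
     distr (uniform_measure lborel {0..2 * pi}) (restrict_space borel circle) cis"

definition L2_circle :: "(complex \<Rightarrow> complex^2) set" where
  "L2_circle = {f \<in> borel_measurable circle_measure.
     integrable circle_measure (\<lambda>z. (norm (f z))\<^sup>2)}"

definition L2_inner :: "(complex \<Rightarrow> complex^2) \<Rightarrow> (complex \<Rightarrow> complex^2) \<Rightarrow> complex" where
  "L2_inner f h = (LINT z|circle_measure. (\<Sum>i\<in>UNIV. f z $ i * cnj (h z $ i)))"

definition fourier_mode :: "int \<Rightarrow> 2 \<Rightarrow> complex \<Rightarrow> complex^2" where
  "fourier_mode k i z = axis i (z powi k)"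

definition hardy :: "(complex \<Rightarrow> complex^2) set" where
  "hardy = {f \<in> L2_circle. \<forall>k<0. \<forall>i. L2_inner f (fourier_mode k i) = 0}"

text \<open>
  Elements of \<open>L\<^sup>2\<close> are represented by functions, so the orthogonal projection and the
  adjoint are determined up to equality almost everywhere; \<open>SOME\<close> picks a representative.
\<close>

definition P_plus :: "(complex \<Rightarrow> complex^2) \<Rightarrow> (complex \<Rightarrow> complex^2)" where
  "P_plus f = (SOME h. h \<in> hardy \<and> (\<forall>k\<in>hardy. L2_inner (\<lambda>z. f z - h z) k = 0))"

definition toeplitz_op :: "loop \<Rightarrow> (complex \<Rightarrow> complex^2) \<Rightarrow> (complex \<Rightarrow> complex^2)" where
  "toeplitz_op g f = P_plus (\<lambda>z. g z *v f z)"

definition hardy_adjoint :: "((complex \<Rightarrow> complex^2) \<Rightarrow> (complex \<Rightarrow> complex^2))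
    \<Rightarrow> ((complex \<Rightarrow> complex^2) \<Rightarrow> (complex \<Rightarrow> complex^2))" where
  "hardy_adjoint A = (SOME B. (\<forall>h\<in>hardy. B h \<in> hardy) \<and>
     (\<forall>f\<in>hardy. \<forall>h\<in>hardy. L2_inner (A f) h = L2_inner f (B h)))"

text \<open>
  For \<open>D = 1 + T\<close> with \<open>T\<close> of trace class on the Hardy space,
  \<open>det D = \<Sum>\<^sub>k tr (\<Lambda>\<^sup>k T)\<close>. In the orthonormal basis \<open>z\<^sup>k \<epsilon>\<^sub>i\<close> (\<open>k \<ge> 0\<close>) this is the sum of
  all finite principal minors of the matrix of \<open>T\<close>, each given by the Leibniz formula.
\<close>

definition hardy_basis :: "nat \<times> 2 \<Rightarrow> complex \<Rightarrow> complex^2" where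
  "hardy_basis s = fourier_mode (int (fst s)) (snd s)"

definition matrix_coeff_minus_id :: "((complex \<Rightarrow> complex^2) \<Rightarrow> (complex \<Rightarrow> complex^2))
    \<Rightarrow> nat \<times> 2 \<Rightarrow> nat \<times> 2 \<Rightarrow> complex" where
  "matrix_coeff_minus_id D r s =
     L2_inner (D (hardy_basis s)) (hardy_basis r) - (if r = s then 1 else 0)"

definition fredholm_det :: "((complex \<Rightarrow> complex^2) \<Rightarrow> (complex \<Rightarrow> complex^2)) \<Rightarrow> complex" where
  "fredholm_det D = (\<Sum>\<^sub>\<infinity>S\<in>{S. finite S}.
     \<Sum>p | p permutes S. of_int (sign p) * (\<Prod>s\<in>S. matrix_coeff_minus_id D s (p s)))"

definition sigma0_sq :: "loop \<Rightarrow> complex" where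
  "sigma0_sq g = fredholm_det (hardy_adjoint (toeplitz_op g) \<circ> toeplitz_op g)"

text \<open>Either choice of \<open>z\<^sup>1\<^sup>/\<^sup>2\<close> gives the same conjugated loop.\<close>

definition half_conj :: "loop \<Rightarrow> loop" where
  "half_conj g = (\<lambda>z\<in>circle.
     mat2 (csqrt z) 0 0 (inverse (csqrt z)) ** g z ** mat2 (inverse (csqrt z)) 0 0 (csqrt z))"

definition sigma1_sq :: "loop \<Rightarrow> complex" where
  "sigma1_sq g = sigma0_sq (half_conj g)"

text \<open>The determinants are nonnegative reals; \<open>Re\<close> only adjusts the type.\<close>

definition abs_sigma0 :: "loop \<Rightarrow> real" where
  "abs_sigma0 g = sqrt (Re (sigma0_sq g))"

definition abs_sigma1 :: "loop \<Rightarrow> real" where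
  "abs_sigma1 g = sqrt (Re (sigma1_sq g))"


section \<open>Finite Toeplitz determinants\<close>

text \<open>
  \<open>B_mat m y\<close> is \<open>B(\<Sum>\<^sub>j\<^sub>=\<^sub>1\<^sup>m y\<^sub>j z\<^sup>j)\<close>. Indices start at 0, which does not matter as the
  entries depend on \<open>r - s\<close> only. For \<open>m = 0\<close> the determinant below is 1.
\<close>

definition B_mat :: "nat \<Rightarrow> (nat \<Rightarrow> complex) \<Rightarrow> complex Matrix.mat" where
  "B_mat m y = Matrix.mat m m (\<lambda>(r, s). if s \<le> r then y (m - (r - s)) else 0)"

definition det_one_plus_BB :: "nat \<Rightarrow> (nat \<Rightarrow> complex) \<Rightarrow> complex" where
  "det_one_plus_BB m y = Determinant.det (1\<^sub>m m + B_mat m y * mat_adjoint (B_mat m y))"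

end

theory Submission
  imports Defs "HOL-Complex_Analysis.Complex_Analysis"
begin

text \<open>
  Write the second row of \<open>g(\<zeta>)\<close> as \<open>(\<gamma>, \<delta>)\<close>, with \<open>\<gamma>\<close>, \<open>\<delta>\<close> polynomials in \<open>z\<close> and \<open>\<gamma>(0) = 0 < \<delta>(0)\<close>; the first
  row is \<open>(\<delta>\<^sup>*, -\<gamma>\<^sup>*)\<close> with \<open>*\<close> the conjugation on the circle. The coordinates \<open>x\<close> are determined by
  \<open>\<delta>\<^sup>* - x \<gamma>\<close> and \<open>-\<gamma>\<^sup>* - x \<delta>\<close> being polynomials in \<open>z\<close>. Removing the rightmost factor of the product shows
  that \<open>x\<^sub>j\<close> is \<open>\<zeta>\<^sub>j \<Prod>\<^sub>i\<^sub>>\<^sub>j (1 + |\<zeta>\<^sub>i|\<^sup>2)\<close> plus a function of \<open>\<zeta>\<^sub>j\<^sub>+\<^sub>1, \<zeta>\<^sub>j\<^sub>+\<^sub>2, \<dots>\<close>. This triangular shape gives the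
  diffeomorphism, its inverse, and the Jacobian.

  The coefficients of \<open>\<delta>\<close> solve a linear system with matrix \<open>1 + B B\<^sup>*\<close> and right hand side a multiple of a
  unit vector, so by Cramer's rule the determinants for \<open>n\<close> and \<open>n - 1\<close> have ratio
  \<open>\<Prod>\<^sub>j (1 + |\<zeta>\<^sub>j|\<^sup>2)\<close>. For the Fredholm determinant, unitarity gives \<open>A(g)\<^sup>* A(g) = 1 - H\<^sup>* H\<close> with \<open>H\<close> a Hankel
  operator of finite rank. Then \<open>det (1 - H\<^sup>* H) = det (1 - H H\<^sup>*)\<close>, and \<open>1 - H H\<^sup>*\<close> is the sum of
  \<open>L L\<^sup>*\<close> over the triangular Toeplitz matrices \<open>L\<close> of \<open>\<gamma>\<close> and \<open>\<delta>\<close>; its Schur complements are the matrices of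
  the shorter products.
\<close>

text \<open>The product grows on the left, but a new left factor can change every x_j. On the right
  the bookkeeping is lighter: a new right factor only shifts the old x_j by one index and adds a
  single coefficient. That coefficient is forced. The upper right entry of u picks up a factor 1/z,
  so the constant term of its numerator must vanish, and this equation is affine in the new
  parameter; hence the triangular shape.

  Scaling the second row by sqrt N removes all square roots: the recursions are polynomial in the
  \<zeta>_j and their conjugates, so smoothness and measurability need no separate analysis.

  The obstacle on the operator side is that \<open>P_plus\<close> and \<open>hardy_adjoint\<close>
  are choices among functions, fixed only up to null sets. What is known of them is membership in
  the Hardy space and pairings with Hardy functions. Matrix coefficients are such pairings, so
  everything is computed through \<open>L2_inner\<close>. The objects to be chosen exist explicitly,
  because a Laurent polynomial loop maps Hardy functions to functions with finitely many negative
  modes.\<close>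

hide_const (open) module.smult Determinants.det
no_notation Matrix.vec_index (infixl "$" 100)
no_notation fps_nth (infixl "$" 75)
no_notation fls_nth (infixl "$$" 75)

section \<open>Recursion for the coefficients\<close>

text \<open>For the product with parameters \<open>\<zeta>\<^sub>k, \<dots>, \<zeta>\<^sub>k\<^sub>+\<^sub>m\<^sub>-\<^sub>1\<close>, the polynomials \<open>C\<close>, \<open>D\<close> are the second row
  multiplied by \<open>\<surd>N\<close>, \<open>Y\<close> has the coefficients \<open>x\<^sub>1, x\<^sub>2, \<dots>\<close>, and \<open>(P, Q) / N\<close> is the first row of the
  factor \<open>u\<close>. The recursions remove the rightmost factor of the product; conjugation by
  \<open>diag(z\<^sup>1\<^sup>/\<^sup>2, z\<^sup>-\<^sup>1\<^sup>/\<^sup>2)\<close> turns the remaining factors into those of a shorter product.\<close>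

fun C_poly D_poly :: "nat \<Rightarrow> nat \<Rightarrow> (nat \<Rightarrow> complex) \<Rightarrow> complex poly" where
  "C_poly 0 k \<zeta> = 0"
| "D_poly 0 k \<zeta> = 1"
| "C_poly (Suc m) k \<zeta> =
     pCons 0 (C_poly m (Suc k) \<zeta> - smult (cnj (\<zeta> k)) (D_poly m (Suc k) \<zeta>))"
| "D_poly (Suc m) k \<zeta> = smult (\<zeta> k) (C_poly m (Suc k) \<zeta>) + D_poly m (Suc k) \<zeta>"

primrec N_prod :: "nat \<Rightarrow> nat \<Rightarrow> (nat \<Rightarrow> complex) \<Rightarrow> real" where
  "N_prod 0 k \<zeta> = 1"
| "N_prod (Suc m) k \<zeta> = N_prod m (Suc k) \<zeta> * (1 + (cmod (\<zeta> k))\<^sup>2)"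

primrec Y_poly :: "nat \<Rightarrow> nat \<Rightarrow> (nat \<Rightarrow> complex) \<Rightarrow> complex poly" where
  "Y_poly 0 k \<zeta> = 0"
| "Y_poly (Suc m) k \<zeta> =
     pCons (of_real (N_prod m (Suc k) \<zeta>) * \<zeta> k
            - (\<Sum>i<m. coeff (Y_poly m (Suc k) \<zeta>) i * coeff (D_poly m (Suc k) \<zeta>) (Suc i)))
           (Y_poly m (Suc k) \<zeta>)"

definition y_low :: "nat \<Rightarrow> nat \<Rightarrow> (nat \<Rightarrow> complex) \<Rightarrow> complex" where
  "y_low m k \<zeta> = coeff (Y_poly m k \<zeta>) 0"

fun P_poly Q_poly :: "nat \<Rightarrow> nat \<Rightarrow> (nat \<Rightarrow> complex) \<Rightarrow> complex poly" where
  "P_poly 0 k \<zeta> = 1"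
| "Q_poly 0 k \<zeta> = 0"
| "P_poly (Suc m) k \<zeta> =
     P_poly m (Suc k) \<zeta> - smult (cnj (\<zeta> k)) (Q_poly m (Suc k) \<zeta>)
     - smult (coeff (Y_poly (Suc m) k \<zeta>) 0)
         (C_poly m (Suc k) \<zeta> - smult (cnj (\<zeta> k)) (D_poly m (Suc k) \<zeta>))"
| "Q_poly (Suc m) k \<zeta> = poly_shift 1
     (smult (\<zeta> k) (P_poly m (Suc k) \<zeta>) + Q_poly m (Suc k) \<zeta>
      - smult (coeff (Y_poly (Suc m) k \<zeta>) 0) (D_poly (Suc m) k \<zeta>))"

lemma coeff_C_poly_0: "coeff (C_poly m k \<zeta>) 0 = 0"
  by (cases m) auto

lemma coeff_D_poly_0: "coeff (D_poly m k \<zeta>) 0 = 1"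
  by (induction m arbitrary: k) (auto simp: coeff_C_poly_0)

text \<open>A joint induction, since each recursion mixes both polynomials. The sharper bound for
  \<open>D_poly\<close> is needed for \<sigma>_1, where the Hankel block has one row less.\<close>

lemma coeff_CD_high:
  "(i > m \<longrightarrow> coeff (C_poly m k \<zeta>) i = 0) \<and> (i \<ge> m \<and> i > 0 \<longrightarrow> coeff (D_poly m k \<zeta>) i = 0)"
proof (induction m arbitrary: k i)
  case (Suc m)
  show ?case using Suc[of "i - 1" "Suc k"] Suc[of i "Suc k"] coeff_C_poly_0[of m]
    by (cases i; cases m) (auto simp: coeff_pCons split: nat.splits)
qed auto

lemma coeff_C_poly_high: "i > m \<Longrightarrow> coeff (C_poly m k \<zeta>) i = 0"
  and coeff_D_poly_high: "i \<ge> m \<Longrightarrow> i > 0 \<Longrightarrow> coeff (D_poly m k \<zeta>) i = 0"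
  using coeff_CD_high by blast+

lemma coeff_Y_poly_high: "i \<ge> m \<Longrightarrow> coeff (Y_poly m k \<zeta>) i = 0"
proof (induction m arbitrary: k i)
  case (Suc m)
  then show ?case by (cases i) auto
qed auto

text \<open>Prepending a coefficient leaves the older ones alone: this is the source of the shift
  property of the x_j in (b).\<close>

lemma coeff_Y_poly: "i < m \<Longrightarrow> coeff (Y_poly m k \<zeta>) i = y_low (m - i) (k + i) \<zeta>"
proof (induction m arbitrary: k i)
  case (Suc m)
  then show ?case by (cases i) (auto simp: y_low_def)
qed auto

lemma N_prod_pos: "N_prod m k \<zeta> > 0"
  by (induction m arbitrary: k) (auto simp: add_pos_nonneg)

lemma N_prod_eq: "N_prod m k \<zeta> = (\<Prod>i<m. 1 + (cmod (\<zeta> (k + i)))\<^sup>2)"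
  by (induction m arbitrary: k) (auto simp: prod.lessThan_Suc_shift mult.commute simp del: prod.lessThan_Suc)

lemma of_real_one_plus_cmod_sq: "complex_of_real (1 + (cmod t)\<^sup>2) = 1 + t * cnj t"
  by (metis complex_norm_square of_real_1 of_real_add)

text \<open>With x = z^(-1) Y(1/z), these are the coefficients of z^(-s-1) in -\<gamma>^* - x
  \<delta> and of z^(-s) in \<delta>^* - x \<gamma>: negative powers cancel, and the constant term
  of the latter is N. The rotation by \<zeta>_k mixes the two families, so they are proved
  together.\<close>

lemma Y_C_D_relations:
  "(\<Sum>i<m. coeff (Y_poly m k \<zeta>) (s + i) * coeff (D_poly m k \<zeta>) i)
     = - cnj (coeff (C_poly m k \<zeta>) (Suc s)) \<and>
   (\<Sum>i<m. coeff (Y_poly m k \<zeta>) (s + i) * coeff (C_poly m k \<zeta>) (Suc i))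
     = cnj (coeff (D_poly m k \<zeta>) s) - (if s = 0 then of_real (N_prod m k \<zeta>) else 0)"
proof (induction m arbitrary: k s)
  case 0
  show ?case by simp
next
  case (Suc m)
  let ?y = "coeff (Y_poly m (Suc k) \<zeta>)" and ?c = "coeff (C_poly m (Suc k) \<zeta>)"
    and ?d = "coeff (D_poly m (Suc k) \<zeta>)" and ?z = "\<zeta> k"
    and ?N = "complex_of_real (N_prod m (Suc k) \<zeta>)"
  have I1: "(\<Sum>i<m. ?y (s + i) * ?d i) = - cnj (?c (Suc s))" for s
    using Suc[of "Suc k" s] by blast
  have I2: "(\<Sum>i<m. ?y (s + i) * ?c (Suc i)) = cnj (?d s) - (if s = 0 then ?N else 0)" for s
    using Suc[of "Suc k" s] by blast
  have c0: "?c 0 = 0" and d0: "?d 0 = 1"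
    by (auto simp: coeff_C_poly_0 coeff_D_poly_0)
  have C_shift: "(\<Sum>i<Suc m. ?y (s + i) * ?c i) = (\<Sum>i<m. ?y (Suc s + i) * ?c (Suc i))" for s
    by (simp add: sum.lessThan_Suc_shift c0 del: sum.lessThan_Suc)
  have D_last: "(\<Sum>i<Suc m. ?y (s + i) * ?d i) = (\<Sum>i<m. ?y (s + i) * ?d i)" for s
    by (simp add: coeff_Y_poly_high)
  define y0 where "y0 = ?N * ?z - (\<Sum>i<m. ?y i * ?d (Suc i))"
  have C_new: "coeff (C_poly (Suc m) k \<zeta>) (Suc i) = ?c i - cnj ?z * ?d i" for i by simp
  have D_new: "coeff (D_poly (Suc m) k \<zeta>) i = ?z * ?c i + ?d i" for i by simp
  have Y_new: "coeff (Y_poly (Suc m) k \<zeta>) (Suc i) = ?y i" "coeff (Y_poly (Suc m) k \<zeta>) 0 = y0" for i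
    by (simp_all add: y0_def)
  have N_new: "complex_of_real (N_prod (Suc m) k \<zeta>) = ?N * (1 + ?z * cnj ?z)"
    by (simp only: N_prod.simps of_real_mult of_real_one_plus_cmod_sq)
  show ?case
  proof (cases s)
    case 0
    have "(\<Sum>i<Suc m. coeff (Y_poly (Suc m) k \<zeta>) (s + i) * coeff (D_poly (Suc m) k \<zeta>) i)
        = y0 + (\<Sum>i<m. ?y i * (?z * ?c (Suc i) + ?d (Suc i)))"
      using 0 by (simp only: sum.lessThan_Suc_shift Y_new D_new c0 d0 add_0 add_0_right mult_zero_right mult_1_right)
    also have "\<dots> = y0 + ?z * (\<Sum>i<m. ?y (0 + i) * ?c (Suc i)) + (\<Sum>i<m. ?y i * ?d (Suc i))"
      by (simp add: sum_distrib_left sum.distrib algebra_simps)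
    \<comment> \<open>The relation for s = 0 contains N, which the leading term of \<open>y0\<close>
      cancels; the correction term of \<open>y0\<close> cancels the remaining sum.\<close>
    also have "\<dots> = ?z" unfolding I2 by (simp add: y0_def d0 algebra_simps)
    finally have 1: "(\<Sum>i<Suc m. coeff (Y_poly (Suc m) k \<zeta>) (s + i) * coeff (D_poly (Suc m) k \<zeta>) i) = ?z" .
    have "(\<Sum>i<Suc m. coeff (Y_poly (Suc m) k \<zeta>) (s + i) * coeff (C_poly (Suc m) k \<zeta>) (Suc i))
        = - y0 * cnj ?z + (\<Sum>i<m. ?y i * (?c (Suc i) - cnj ?z * ?d (Suc i)))"
      using 0 by (simp only: sum.lessThan_Suc_shift Y_new C_new c0 d0 add_0 add_0_right mult_zero_right mult_1_right) simp
    also have "\<dots> = - y0 * cnj ?z + (\<Sum>i<m. ?y (0 + i) * ?c (Suc i)) - cnj ?z * (\<Sum>i<m. ?y i * ?d (Suc i))"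
      by (simp add: sum_distrib_left sum_subtractf algebra_simps)
    also have "\<dots> = 1 - ?N * (1 + ?z * cnj ?z)" unfolding I2 by (simp add: y0_def d0 algebra_simps)
    finally have 2: "(\<Sum>i<Suc m. coeff (Y_poly (Suc m) k \<zeta>) (s + i) * coeff (C_poly (Suc m) k \<zeta>) (Suc i))
       = 1 - ?N * (1 + ?z * cnj ?z)" .
    show ?thesis unfolding 1 2 N_new using 0 by (simp add: c0 d0)
  next
    case (Suc t)
    have "(\<Sum>i<Suc m. coeff (Y_poly (Suc m) k \<zeta>) (s + i) * coeff (D_poly (Suc m) k \<zeta>) i)
        = (\<Sum>i<Suc m. ?y (t + i) * (?z * ?c i + ?d i))"
      using Suc by (simp only: add_Suc Y_new D_new)
    also have "\<dots> = ?z * (\<Sum>i<Suc m. ?y (t + i) * ?c i) + (\<Sum>i<Suc m. ?y (t + i) * ?d i)"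
      by (simp add: sum_distrib_left sum.distrib algebra_simps)
    also have "\<dots> = ?z * cnj (?d s) - cnj (?c s)"
      unfolding C_shift D_last I1 I2 using Suc by simp
    finally have 1: "(\<Sum>i<Suc m. coeff (Y_poly (Suc m) k \<zeta>) (s + i) * coeff (D_poly (Suc m) k \<zeta>) i)
       = ?z * cnj (?d s) - cnj (?c s)" .
    have "(\<Sum>i<Suc m. coeff (Y_poly (Suc m) k \<zeta>) (s + i) * coeff (C_poly (Suc m) k \<zeta>) (Suc i))
        = (\<Sum>i<Suc m. ?y (t + i) * (?c i - cnj ?z * ?d i))"
      using Suc by (simp only: add_Suc Y_new C_new)
    also have "\<dots> = (\<Sum>i<Suc m. ?y (t + i) * ?c i) - cnj ?z * (\<Sum>i<Suc m. ?y (t + i) * ?d i)"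
      by (simp add: sum_distrib_left sum_subtractf algebra_simps)
    also have "\<dots> = cnj (?d s) + cnj ?z * cnj (?c s)"
      unfolding C_shift D_last I1 I2 using Suc by simp
    finally have 2: "(\<Sum>i<Suc m. coeff (Y_poly (Suc m) k \<zeta>) (s + i) * coeff (C_poly (Suc m) k \<zeta>) (Suc i))
       = cnj (?d s) + cnj ?z * cnj (?c s)" .
    show ?thesis unfolding 1 2 unfolding C_new D_new using Suc by simp
  qed
qed

text \<open>The starred polynomials contain no positive powers of z, so for s > 0 only -x \<gamma>
  and -x \<delta> contribute to the coefficient of z^s.\<close>

lemma coeff_PQ_poly:
  "coeff (P_poly m k \<zeta>) s = (if s = 0 then of_real (N_prod m k \<zeta>)
     else - (\<Sum>i<m. coeff (Y_poly m k \<zeta>) i * coeff (C_poly m k \<zeta>) (Suc (i + s)))) \<and>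
   coeff (Q_poly m k \<zeta>) s = - (\<Sum>i<m. coeff (Y_poly m k \<zeta>) i * coeff (D_poly m k \<zeta>) (Suc (i + s)))"
proof (induction m arbitrary: k s)
  case 0
  show ?case by (simp add: coeff_1)
next
  case (Suc m)
  let ?y = "coeff (Y_poly m (Suc k) \<zeta>)" and ?c = "coeff (C_poly m (Suc k) \<zeta>)"
    and ?d = "coeff (D_poly m (Suc k) \<zeta>)" and ?z = "\<zeta> k"
    and ?N = "complex_of_real (N_prod m (Suc k) \<zeta>)"
  have IP: "coeff (P_poly m (Suc k) \<zeta>) s
      = (if s = 0 then ?N else - (\<Sum>i<m. ?y i * ?c (Suc (i + s))))" for s
    using Suc[of "Suc k" s] by blast
  have IQ: "coeff (Q_poly m (Suc k) \<zeta>) s = - (\<Sum>i<m. ?y i * ?d (Suc (i + s)))" for s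
    using Suc[of "Suc k" s] by blast
  define y0 where "y0 = ?N * ?z - (\<Sum>i<m. ?y i * ?d (Suc i))"
  have C_new: "coeff (C_poly (Suc m) k \<zeta>) (Suc i) = ?c i - cnj ?z * ?d i" for i by simp
  have D_new: "coeff (D_poly (Suc m) k \<zeta>) i = ?z * ?c i + ?d i" for i by simp
  have Y_new: "coeff (Y_poly (Suc m) k \<zeta>) (Suc i) = ?y i" "coeff (Y_poly (Suc m) k \<zeta>) 0 = y0" for i
    by (simp_all add: y0_def)
  have N_new: "complex_of_real (N_prod (Suc m) k \<zeta>) = ?N * (1 + ?z * cnj ?z)"
    by (simp only: N_prod.simps of_real_mult of_real_one_plus_cmod_sq)
  have P_new: "coeff (P_poly (Suc m) k \<zeta>) s = coeff (P_poly m (Suc k) \<zeta>) s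
      - cnj ?z * coeff (Q_poly m (Suc k) \<zeta>) s - y0 * (?c s - cnj ?z * ?d s)"
    by (simp only: P_poly.simps coeff_diff coeff_smult Y_new)
  have Q_new: "coeff (Q_poly (Suc m) k \<zeta>) s = ?z * coeff (P_poly m (Suc k) \<zeta>) (Suc s)
      + coeff (Q_poly m (Suc k) \<zeta>) (Suc s) - y0 * (?z * ?c (Suc s) + ?d (Suc s))"
    by (simp only: Q_poly.simps coeff_poly_shift coeff_diff coeff_add coeff_smult Y_new D_new) simp
  have Q: "coeff (Q_poly (Suc m) k \<zeta>) s
      = - (\<Sum>i<Suc m. coeff (Y_poly (Suc m) k \<zeta>) i * coeff (D_poly (Suc m) k \<zeta>) (Suc (i + s)))"
    unfolding Q_new IP IQ sum.lessThan_Suc_shift Y_new D_new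
    by (simp add: sum_distrib_left sum.distrib algebra_simps sum_negf)
  have P: "coeff (P_poly (Suc m) k \<zeta>) s
      = - (\<Sum>i<Suc m. coeff (Y_poly (Suc m) k \<zeta>) i * coeff (C_poly (Suc m) k \<zeta>) (Suc (i + s)))"
    if "s > 0" unfolding P_new IP IQ sum.lessThan_Suc_shift Y_new C_new using that
    by (simp add: sum_distrib_left sum_subtractf algebra_simps)
  have P0: "coeff (P_poly (Suc m) k \<zeta>) s = of_real (N_prod (Suc m) k \<zeta>)" if "s = 0"
    unfolding P_new IP IQ N_new using that
    by (simp add: coeff_C_poly_0 coeff_D_poly_0 y0_def algebra_simps)
  show ?case
    using P0 P by (intro conjI Q) (cases "s = 0"; simp del: P_poly.simps C_poly.simps N_prod.simps Y_poly.simps sum.lessThan_Suc)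
qed

text \<open>Equivalently, the polynomial shifted in the definition of \<open>Q_poly (Suc m)\<close>
  has constant term 0, so that \<open>poly_shift 1\<close> is an exact division by z.\<close>

lemma coeff_Y_poly_Suc_0:
  "coeff (Y_poly (Suc m) k \<zeta>) 0 = of_real (N_prod m (Suc k) \<zeta>) * \<zeta> k + coeff (Q_poly m (Suc k) \<zeta>) 0"
  using coeff_PQ_poly[of m "Suc k" \<zeta> 0] by simp

section \<open>Holomorphic loops on the disc and its exterior\<close>

lemma mat2_nth [simp]:
  "mat2 a b c d $ 1 $ 1 = a" "mat2 a b c d $ 1 $ 2 = b"
  "mat2 a b c d $ 2 $ 1 = c" "mat2 a b c d $ 2 $ 2 = d"
  by (simp_all add: mat2_def)

lemma mat2_eqI:
  "A $ 1 $ 1 = a \<Longrightarrow> A $ 1 $ 2 = b \<Longrightarrow> A $ 2 $ 1 = c \<Longrightarrow> A $ 2 $ 2 = d \<Longrightarrow> A = mat2 a b c d"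
  by (simp add: Finite_Cartesian_Product.vec_eq_iff forall_2)

lemma mat2_eta: "mat2 (A $ 1 $ 1) (A $ 1 $ 2) (A $ 2 $ 1) (A $ 2 $ 2) = A"
  by (rule mat2_eqI[symmetric]) auto

lemma mat2_eq_iff [simp]:
  "mat2 a b c d = mat2 a' b' c' d' \<longleftrightarrow> a = a' \<and> b = b' \<and> c = c' \<and> d = d'"
  by (metis mat2_nth)

lemma mat2_mult [simp]:
  "mat2 a b c d ** mat2 a' b' c' d'
     = mat2 (a * a' + b * c') (a * b' + b * d') (c * a' + d * c') (c * b' + d * d')"
  by (rule mat2_eqI) (simp_all add: matrix_matrix_mult_def sum_2)

lemma det_mat2 [simp]: "Determinants.det (mat2 a b c d) = a * d - b * c"
  by (simp add: Determinants.det_2)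

lemma mat_1_eq_mat2: "Finite_Cartesian_Product.mat 1 = mat2 1 0 0 1"
  by (rule mat2_eqI) (simp_all add: Finite_Cartesian_Product.mat_def)

lemma matrix_inv_mat2:
  assumes "a * d - b * c = 1"
  shows "matrix_inv (mat2 a b c d) = mat2 d (- b) (- c) a"
proof -
  have 1: "mat2 a b c d ** mat2 d (- b) (- c) a = Finite_Cartesian_Product.mat 1"
    "mat2 d (- b) (- c) a ** mat2 a b c d = Finite_Cartesian_Product.mat 1"
    using assms by (auto simp: mat_1_eq_mat2 algebra_simps)
  then have "mat2 a b c d ** matrix_inv (mat2 a b c d) = Finite_Cartesian_Product.mat 1 \<and>
      matrix_inv (mat2 a b c d) ** mat2 a b c d = Finite_Cartesian_Product.mat 1"
    unfolding matrix_inv_def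
    by (intro someI[where P = "\<lambda>A'. mat2 a b c d ** A' = Finite_Cartesian_Product.mat 1 \<and>
        A' ** mat2 a b c d = Finite_Cartesian_Product.mat 1" and x = "mat2 d (- b) (- c) a"] conjI)
  then show ?thesis
    by (metis 1(1) matrix_mul_assoc matrix_mul_lid matrix_mul_rid)
qed

lemma holomorphic_SL2_mat2:
  "holomorphic_SL2 U (\<lambda>z. mat2 (a z) (b z) (c z) (d z)) \<longleftrightarrow>
     a holomorphic_on U \<and> b holomorphic_on U \<and> c holomorphic_on U \<and> d holomorphic_on U \<and>
     (\<forall>z\<in>U. a z * d z - b z * c z = 1)"
  by (auto simp: holomorphic_SL2_def forall_2)

lemma upper_unipotent_mat2 [simp]: "upper_unipotent (mat2 a b c d) \<longleftrightarrow> a = 1 \<and> d = 1 \<and> c = 0"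
  by (simp add: upper_unipotent_def)

lemma lower_unipotent_mat2 [simp]: "lower_unipotent (mat2 a b c d) \<longleftrightarrow> a = 1 \<and> d = 1 \<and> b = 0"
  by (simp add: lower_unipotent_def)

lemma N_plusI:
  assumes "open U" "cball 0 1 \<subseteq> U" "holomorphic_SL2 U u" "upper_unipotent (u 0)"
    and "\<And>z. z \<in> circle \<Longrightarrow> f z = u z"
  shows "restrict f circle \<in> N_plus"
proof -
  have "restrict f circle = restrict u circle"
    using assms(5) by (auto intro: restrict_ext)
  then show ?thesis using assms unfolding N_plus_def by blast
qed

lemma N_minusI:
  assumes "open U" "cball 0 1 \<subseteq> U" "holomorphic_SL2 U v" "lower_unipotent (v 0)"
    and "\<And>z. z \<in> circle \<Longrightarrow> f z = v (inverse z)"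
  shows "restrict f circle \<in> N_minus"
proof -
  have "restrict f circle = (\<lambda>z\<in>circle. v (inverse z))"
    using assms(5) by (auto intro: restrict_ext)
  then show ?thesis using assms unfolding N_minus_def by blast
qed

lemma circle_nonzero: "z \<in> circle \<Longrightarrow> z \<noteq> 0"
  by auto

lemma inverse_circle: "z \<in> circle \<Longrightarrow> inverse z \<in> circle"
  by (simp add: norm_inverse)

lemma inverse_eq_cnj: "z \<in> circle \<Longrightarrow> inverse z = cnj z"
  by (simp add: inverse_complex_def complex_eq_iff cmod_def)

section \<open>Gluing holomorphic functions across the unit circle\<close>

lemma cball_subset_open_radius:
  assumes "open U" "cball (0::complex) 1 \<subseteq> U"
  obtains r where "r > 1" "cball 0 r \<subseteq> U"
proof -
  obtain e where e: "e > 0" "(\<Union>x\<in>cball 0 1. cball x e) \<subseteq> U"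
    using compact_subset_open_imp_cball_epsilon_subset[OF compact_cball assms] by metis
  have "cball 0 (1 + e) \<subseteq> (\<Union>x\<in>cball (0::complex) 1. cball x e)"
  proof
    fix z :: complex assume z: "z \<in> cball 0 (1 + e)"
    show "z \<in> (\<Union>x\<in>cball 0 1. cball x e)"
    proof (cases "norm z \<le> 1")
      case True
      then show ?thesis using e by (intro UN_I[of z]) auto
    next
      case False
      \<comment> \<open>Radial projection of z to the unit circle.\<close>
      let ?x = "z / of_real (norm z)"
      have nz: "complex_of_real (norm z) \<noteq> 0" using False by auto
      have "z - ?x = of_real ((norm z - 1) / norm z) * z"
        using nz by (simp add: divide_simps left_diff_distrib)
      then have "norm (z - ?x) = \<bar>(norm z - 1) / norm z\<bar> * norm z"
        by (simp only: norm_mult norm_of_real)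
      also have "\<dots> = norm z - 1" using False by auto
      finally have "dist ?x z = norm z - 1"
        by (metis dist_commute dist_norm)
      with z False show ?thesis
        by (intro UN_I[of ?x]) (simp_all add: norm_divide)
    qed
  qed
  then have "cball 0 (1 + e) \<subseteq> U" using e(2) by (rule subset_trans)
  then show ?thesis using e(1) that[of "1 + e"] by simp
qed

text \<open>By the identity theorem \<open>f\<close> and \<open>z\<^sup>n h (1/z)\<close> agree on an annulus, so they glue to an
  entire function of polynomial growth.\<close>

lemma holomorphic_disc_exterior_glue:
  assumes U: "open U" "cball 0 1 \<subseteq> U" "f holomorphic_on U"
    and V: "open V" "cball 0 1 \<subseteq> V" "h holomorphic_on V"
    and eq: "\<And>z. z \<in> circle \<Longrightarrow> f z = z ^ n * h (inverse z)"
  shows "\<exists>a. \<forall>z\<in>cball 0 1. f z = (\<Sum>k\<le>n. a k * z ^ k)"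
proof -
  obtain r1 where r1: "r1 > 1" "cball 0 r1 \<subseteq> U" using cball_subset_open_radius[OF U(1,2)] .
  obtain r2 where r2: "r2 > 1" "cball 0 r2 \<subseteq> V" using cball_subset_open_radius[OF V(1,2)] .
  define r where "r = min r1 r2"
  have r: "r > 1" "cball 0 r \<subseteq> U" "cball 0 r \<subseteq> V" using r1 r2 by (auto simp: r_def)
  define g where "g = (\<lambda>z. z ^ n * h (inverse z))"
  define E where "E = - cball (0::complex) (1 / r)"
  define A where "A = ball (0::complex) r - cball 0 (1 / r)"
  have fr: "f holomorphic_on ball 0 r"
    using U(3) r(2) ball_subset_cball holomorphic_on_subset by blast
  have inv: "inverse z \<in> V" if "z \<in> E" for z
  proof -
    have "1 / r < norm z" using that by (simp add: E_def)
    then have *: "1 < norm z * r" using r(1) by (simp add: pos_divide_less_eq)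
    moreover have "norm z > 0"
      using * by (cases "z = 0") auto
    ultimately have "inverse (norm z) \<le> r"
      by (simp add: inverse_eq_divide pos_divide_le_eq mult.commute)
    then show ?thesis using r(3) by (auto simp: norm_inverse)
  qed
  have gE: "g holomorphic_on E"
  proof -
    have "0 \<notin> E" using r by (auto simp: E_def)
    then have "(\<lambda>z. h (inverse z)) holomorphic_on E"
      using holomorphic_on_compose_gen[of inverse E h V, unfolded o_def] V(3) inv
        holomorphic_on_inverse[of "\<lambda>z. z" E] by (metis holomorphic_on_ident image_subsetI)
    then show ?thesis unfolding g_def by (intro holomorphic_intros)
  qed
  have AE: "A \<subseteq> E" "A \<subseteq> ball 0 r" by (auto simp: A_def E_def)
  have conn: "connected A"
  proof -
    have "A = {w. 1 / r < norm (w - 0) \<and> norm (w - 0) < r}"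
      by (auto simp: A_def)
    then show ?thesis using connected_annulus(1)[where a = "0::complex" and ?r1.0 = "1/r" and ?r2.0 = r]
      by (simp only: DIM_complex order_refl)
  qed
  have circA: "circle \<subseteq> A" using r(1) by (auto simp: A_def)
  have fg: "f z = g z" if "z \<in> A" for z
  proof -
    have "f z - g z = 0"
    proof (rule analytic_continuation[of "\<lambda>z. f z - g z" A circle 1])
      show "(\<lambda>z. f z - g z) holomorphic_on A"
        using fr gE AE holomorphic_on_subset by (blast intro: holomorphic_on_diff)
      show "open A" by (simp add: A_def open_Diff)
      \<comment> \<open>A connected set with two points has no isolated point, which supplies the
        accumulation point for the identity theorem.\<close>
      have "connected circle" by (rule connected_sphere) simp
      moreover have "1 \<in> circle" "-1 \<in> circle" "(1::complex) \<noteq> -1" by auto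
      then have "1 \<in> circle" "\<And>x. circle \<noteq> {x}" by (blast, metis singletonD)
      ultimately show "1 islimpt circle"
        by (rule connected_imp_perfect)
    qed (use conn circA that eq in \<open>simp_all add: g_def subset_iff\<close>)
    then show ?thesis by simp
  qed
  define F where "F = (\<lambda>z. if z \<in> ball 0 r then f z else g z)"
  have F1: "F z = f z" if "z \<in> ball 0 r" for z using that by (simp add: F_def)
  have F2: "F z = g z" if "z \<in> E" for z
    using that fg[of z] by (auto simp: F_def A_def E_def)
  have E1: "z \<in> E" if "1 \<le> norm z" for z
  proof -
    have "1 / r < 1" using r(1) by simp
    with that show ?thesis by (simp add: E_def)
  qed
  have cover: "UNIV = ball 0 r \<union> E"
  proof -
    have "z \<in> ball 0 r \<union> E" for z
      using E1[of z] r(1) by (cases "norm z < r") auto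
    then show ?thesis by blast
  qed
  have "F holomorphic_on ball 0 r \<union> E"
  proof (rule holomorphic_on_Un)
    show "F holomorphic_on ball 0 r" using fr F1 by (subst holomorphic_cong[OF refl]) auto
    show "F holomorphic_on E" using gE F2 by (subst holomorphic_cong[OF refl]) auto
  qed (auto simp: E_def)
  then have F: "F holomorphic_on UNIV" using cover by simp
  have "compact (h ` cball 0 1)"
    by (intro compact_continuous_image holomorphic_on_imp_continuous_on
          holomorphic_on_subset[OF V(3)] V(2) compact_cball)
  then have "bounded (h ` cball 0 1)" by (rule compact_imp_bounded)
  then obtain B where B: "\<And>w. w \<in> cball 0 1 \<Longrightarrow> norm (h w) \<le> B"
    unfolding bounded_iff by blast
  have growth: "norm (F z) \<le> B * norm z ^ n" if "1 \<le> norm z" for z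
  proof -
    have "z \<in> E" using that by (rule E1)
    moreover have "inverse z \<in> cball 0 1" using that by (simp add: norm_inverse inverse_le_1_iff)
    ultimately show ?thesis using mult_right_mono[OF B[of "inverse z"], of "norm z ^ n"]
      by (simp add: F2 g_def norm_mult norm_power mult.commute)
  qed
  have "F z = (\<Sum>k\<le>n. ((deriv ^^ k) F 0 / fact k) * z ^ k)" for z
    using Liouville_polynomial[OF F, of 1 B n] growth by simp
  moreover have "F z = f z" if "z \<in> cball 0 1" for z using that r F1 by auto
  ultimately show ?thesis by metis
qed

text \<open>The case of degree 0: only constants extend to both sides of the circle.\<close>

lemma holomorphic_disc_exterior_const:
  assumes U: "open U" "cball 0 1 \<subseteq> U" "f holomorphic_on U"
    and V: "open V" "cball 0 1 \<subseteq> V" "h holomorphic_on V"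
    and eq: "\<And>z. z \<in> circle \<Longrightarrow> f z = h (inverse z)"
    and z: "z \<in> circle"
  shows "f z = h 0" "f z = f 0"
proof -
  obtain a where a: "\<forall>z\<in>cball 0 1. f z = (\<Sum>k\<le>0. a k * z ^ k)"
    using holomorphic_disc_exterior_glue[OF U V, of 0] eq by auto
  \<comment> \<open>The gluing lemma describes \<open>f\<close> on the disc only; for
    \<open>h\<close> it is applied with the two sides exchanged.\<close>
  have "h w = w ^ 0 * f (inverse w)" if "w \<in> circle" for w
    using eq[of "inverse w"] inverse_circle[OF that] by simp
  then obtain b where b: "\<forall>z\<in>cball 0 1. h z = (\<Sum>k\<le>0. b k * z ^ k)"
    using holomorphic_disc_exterior_glue[OF V U, of 0] by blast
  have *: "z \<in> cball 0 1" "inverse z \<in> cball 0 1" "0 \<in> cball (0::complex) 1"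
    using z inverse_circle[OF z] by auto
  have "f z = a 0" "h 0 = b 0" "h (inverse z) = b 0" "f 0 = a 0"
    using a[rule_format, OF *(1)] b[rule_format, OF *(2)] b[rule_format, OF *(3)]
      a[rule_format, OF *(3)] by auto
  then show "f z = h 0" "f z = f 0" using eq[OF z] by auto
qed

section \<open>Conjugation by the loops \<open>w_n\<close> and the intersection in (a)\<close>

lemma w_loop_even: "z \<noteq> 0 \<Longrightarrow>
    w_loop (2 * k) z = mat2 ((-1) ^ k * z ^ k) 0 0 ((-1) ^ k * inverse z ^ k)"
proof (induction k)
  case (Suc k)
  have "w_loop (2 * Suc k) z = s1 z ** (s0 z ** w_loop (2 * k) z)" by simp
  also have "\<dots> = mat2 ((-1) ^ Suc k * z ^ Suc k) 0 0 ((-1) ^ Suc k * inverse z ^ Suc k)"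
  proof -
    have ii: "\<i> * (\<i> * x * y) = - (x * y)" for x y :: complex
      by (simp flip: mult.assoc)
    show ?thesis using Suc by (simp add: s0_def s1_def ii mult.left_commute)
  qed
  finally show ?case .
qed simp

lemma w_loop_odd: "z \<noteq> 0 \<Longrightarrow>
    w_loop (Suc (2 * k)) z
      = mat2 0 ((-1) ^ k * \<i> * inverse z ^ Suc k) ((-1) ^ k * \<i> * z ^ Suc k) 0"
  unfolding w_loop.simps w_loop_even s0_def by (simp add: mult_ac)

text \<open>Even \<open>w_n\<close> are diagonal, odd ones antidiagonal, and all signs and factors
  \<open>\<i>\<close> cancel. The exponent n + 1 in the odd case is harmless: the entry that it
  multiplies in the upper right corner is the lower left entry of an element of
  \<open>N_plus\<close>, which vanishes at 0. So both parities allow exactly n negative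
  powers.\<close>

lemma conj_w_loop:
  assumes "z \<noteq> 0"
  shows "matrix_inv (w_loop n z) ** mat2 a b c d ** w_loop n z
    = (if even n then mat2 a (inverse z ^ n * b) (z ^ n * c) d
       else mat2 d (inverse z ^ Suc n * c) (z ^ Suc n * b) a)"
proof (cases "even n")
  case True
  then obtain k where n: "n = 2 * k" by blast
  have s: "((-1) ^ k * (-1) ^ k :: complex) = 1" by (simp flip: power_mult_distrib)
  have zz: "z ^ k * inverse z ^ k = 1" using assms by (simp flip: power_mult_distrib)
  define e :: complex where "e = (-1) ^ k"
  have e: "e * e = 1" using s by (simp add: e_def)
  define p where "p = z ^ k"
  define q where "q = inverse z ^ k"
  have pq: "p * q = 1" using zz by (simp add: p_def q_def)
  have epq: "e * p * (e * q) = 1"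
    using pq e by (simp add: mult.assoc mult.left_commute[of p e])
  then have det: "e * p * (e * q) - 0 * 0 = 1" by simp
  have W: "w_loop n z = mat2 (e * p) 0 0 (e * q)"
    using assms by (simp add: n w_loop_even e_def p_def q_def)
  have "inverse z ^ n = q * q" "z ^ n = p * p"
    unfolding n mult_2 power_add by (simp_all only: p_def q_def)
  then show ?thesis using True epq e unfolding W matrix_inv_mat2[OF det]
    by (simp add: mult_ac)
next
  case False
  then obtain k where n: "n = Suc (2 * k)" by (metis oddE Suc_eq_plus1)
  have zz: "z ^ Suc k * inverse z ^ Suc k = 1"
    unfolding power_mult_distrib[symmetric] using assms by simp
  define e :: complex where "e = (-1) ^ k * \<i>"
  have "e * e = ((-1) * (-1)) ^ k * (\<i> * \<i>)"
    unfolding e_def power_mult_distrib by (simp only: mult_ac)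
  then have e: "e * e = - 1" by simp
  define p where "p = z ^ Suc k"
  define q where "q = inverse z ^ Suc k"
  have pq: "p * q = 1" using zz by (simp only: p_def q_def)
  have epq: "e * p * (e * q) = - 1"
    using pq e by (simp add: mult.assoc mult.left_commute[of p e])
  then have det: "0 * 0 - e * q * (e * p) = 1" by (simp add: mult.commute)
  have W: "w_loop n z = mat2 0 (e * q) (e * p) 0"
    unfolding n w_loop_odd[OF assms] by (simp only: e_def p_def q_def)
  have n2: "Suc n = Suc k + Suc k" using n by simp
  have "inverse z ^ Suc n = q * q" "z ^ Suc n = p * p"
    unfolding n2 power_add by (simp_all only: p_def q_def)
  moreover have ee: "e * (e * x) = - x" for x using e by (simp flip: mult.assoc)
  ultimately show ?thesis using False epq unfolding W matrix_inv_mat2[OF det]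
    by (simp add: mult_ac) (simp add: ee)
qed

lemma sum_powi_neg:
  "(\<Sum>j=1..n. x j * z powi (- int j)) = (\<Sum>j=1..n. x j * inverse z ^ j)"
  by (intro sum.cong refl) (auto simp: power_int_def)

lemma upper_loop_eq_iff_pointwise:
  "upper_loop n x = restrict f circle \<longleftrightarrow>
     (\<forall>z\<in>circle. f z = mat2 1 (\<Sum>j=1..n. x j * inverse z ^ j) 0 1)"
  unfolding upper_loop_def sum_powi_neg by (auto simp: fun_eq_iff restrict_def)

lemma upper_loop_in_N_minus: "upper_loop n x \<in> N_minus"
  unfolding upper_loop_def sum_powi_neg
  by (rule N_minusI[where U = UNIV and v = "\<lambda>w. mat2 1 (\<Sum>j=1..n. x j * w ^ j) 0 1"])
     (auto simp: holomorphic_SL2_mat2 intro!: holomorphic_intros sum.neutral)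

text \<open>Undoing the conjugation puts z^n x into the upper right corner for even n and z^(n+1) x
  into the lower left corner for odd n. The extra z makes the latter vanish at 0, as
  \<open>N_plus\<close> requires.\<close>

lemma upper_loop_in_conj:
  assumes "n > 0"
  shows "upper_loop n x \<in> conj_loops (w_loop n) N_plus"
proof (cases "even n")
  case True
  let ?u = "\<lambda>z::complex. mat2 1 (\<Sum>j=1..n. x j * z ^ (n - j)) 0 1"
  have "restrict ?u circle \<in> N_plus"
    by (rule N_plusI[where U = UNIV and u = ?u])
       (auto simp: holomorphic_SL2_mat2 intro!: holomorphic_intros)
  moreover have "upper_loop n x = (\<lambda>z\<in>circle. matrix_inv (w_loop n z) ** restrict ?u circle z ** w_loop n z)"
    unfolding upper_loop_eq_iff_pointwise
  proof (intro ballI)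
    fix z :: complex assume z: "z \<in> circle"
    have "inverse z ^ n * (\<Sum>j=1..n. x j * z ^ (n - j)) = (\<Sum>j=1..n. x j * inverse z ^ j)"
      unfolding sum_distrib_left
      by (rule sum.cong[OF refl]) (use circle_nonzero[OF z] in \<open>simp add: power_diff divide_simps\<close>)
    then show "matrix_inv (w_loop n z) ** restrict ?u circle z ** w_loop n z
        = mat2 1 (\<Sum>j=1..n. x j * inverse z ^ j) 0 1"
      using z True by (simp only: restrict_apply' conj_w_loop[OF circle_nonzero[OF z]]) simp
  qed
  ultimately show ?thesis unfolding conj_loops_def by blast
next
  case False
  let ?u = "\<lambda>z::complex. mat2 1 0 (\<Sum>j=1..n. x j * z ^ (Suc n - j)) 1"
  have "restrict ?u circle \<in> N_plus"
    by (rule N_plusI[where U = UNIV and u = ?u])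
       (auto simp: holomorphic_SL2_mat2 intro!: holomorphic_intros sum.neutral)
  moreover have "upper_loop n x = (\<lambda>z\<in>circle. matrix_inv (w_loop n z) ** restrict ?u circle z ** w_loop n z)"
    unfolding upper_loop_eq_iff_pointwise
  proof (intro ballI)
    fix z :: complex assume z: "z \<in> circle"
    have "inverse z ^ Suc n * (\<Sum>j=1..n. x j * z ^ (Suc n - j)) = (\<Sum>j=1..n. x j * inverse z ^ j)"
      unfolding sum_distrib_left
      by (rule sum.cong[OF refl]) (use circle_nonzero[OF z] in \<open>simp add: power_diff divide_simps del: power_Suc\<close>)
    then show "matrix_inv (w_loop n z) ** restrict ?u circle z ** w_loop n z
        = mat2 1 (\<Sum>j=1..n. x j * inverse z ^ j) 0 1"
      using z False by (simp only: restrict_apply' conj_w_loop[OF circle_nonzero[OF z]]) simp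
  qed
  ultimately show ?thesis unfolding conj_loops_def by blast
qed

lemma loop_entry:
  assumes "(\<lambda>z\<in>circle. f z) = (\<lambda>z\<in>circle. g z)" "z \<in> circle"
  shows "f z = g z"
  using fun_cong[OF assms(1), of z] assms(2) by simp

lemma holomorphic_zero_divide:
  fixes f :: "complex \<Rightarrow> complex"
  assumes "f holomorphic_on U" "open U" "f 0 = 0"
  obtains t where "t holomorphic_on U" "\<And>z. f z = z * t z"
proof (rule that[OF pole_lemma_open[OF assms(1,2), of 0]])
  show "f z = z * (if z = 0 then deriv f 0 else (f z - f 0) / (z - 0))" for z
    using assms(3) by simp
qed

text \<open>The diagonal entries are holomorphic on both sides of the circle, hence constant. So is
  the lower left entry, which is 0 because inside it carries a positive power of z. The upper right
  entry is z^(-n) times a function holomorphic inside, hence a polynomial of degree at most n in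
  1/z.\<close>

lemma N_minus_inter_conj_subset:
  assumes n: "n > 0" and l: "l \<in> N_minus" "l \<in> conj_loops (w_loop n) N_plus"
  shows "\<exists>x\<in>Cn n. l = upper_loop n x"
proof -
  obtain v V where V: "open V" "cball 0 1 \<subseteq> V" "holomorphic_SL2 V v" "lower_unipotent (v 0)"
    and lv: "l = (\<lambda>z\<in>circle. v (inverse z))"
    using l(1) unfolding N_minus_def by blast
  obtain u U where U: "open U" "cball 0 1 \<subseteq> U" "holomorphic_SL2 U u" "upper_unipotent (u 0)"
    and lu: "l = (\<lambda>z\<in>circle. matrix_inv (w_loop n z) ** restrict u circle z ** w_loop n z)"
    using l(2) unfolding N_plus_def conj_loops_def by blast
  have hv: "(\<lambda>z. v z $ i $ j) holomorphic_on V" and hu: "(\<lambda>z. u z $ i $ j) holomorphic_on U" for i j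
    using V(3) U(3) by (auto simp: holomorphic_SL2_def)
  have vz: "v 0 $ 1 $ 1 = 1" "v 0 $ 2 $ 2 = 1" "v 0 $ 1 $ 2 = 0"
    using V(4) by (auto simp: lower_unipotent_def)
  have uz: "u 0 $ 1 $ 1 = 1" "u 0 $ 2 $ 2 = 1" "u 0 $ 2 $ 1 = 0"
    using U(4) by (auto simp: upper_unipotent_def)
  define i where "i = (if even n then 1 else 2 :: 2)"
  define i' where "i' = (if even n then 2 else 1 :: 2)"
  \<comment> \<open>With \<open>i\<close>, \<open>i'\<close> and \<open>r\<close> both parities
    share one formula: odd \<open>w_n\<close> exchange the two indices and contribute the power n +
    1.\<close>
  define r where "r = (if even n then n else Suc n)"
  have eq: "v (inverse z) = mat2 (u z $ i $ i) (inverse z ^ r * u z $ i $ i')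
      (z ^ r * u z $ i' $ i) (u z $ i' $ i')" if z: "z \<in> circle" for z
  proof -
    have "v (inverse z) = matrix_inv (w_loop n z) ** restrict u circle z ** w_loop n z"
      using loop_entry[OF lv[symmetric, unfolded lu] z] by simp
    also have "\<dots> = matrix_inv (w_loop n z) **
        mat2 (u z $ 1 $ 1) (u z $ 1 $ 2) (u z $ 2 $ 1) (u z $ 2 $ 2) ** w_loop n z"
      unfolding mat2_eta using z by simp
    finally show ?thesis unfolding conj_w_loop[OF circle_nonzero[OF z]]
      by (auto simp: i_def i'_def r_def)
  qed
  note const = holomorphic_disc_exterior_const(1)[OF U(1,2) _ V(1,2)]
  have v11: "v (inverse z) $ 1 $ 1 = 1" if z: "z \<in> circle" for z
    using const[OF hu[of i i] hv[of 1 1] _ z] eq z vz by (simp add: i_def)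
  have v22: "v (inverse z) $ 2 $ 2 = 1" if z: "z \<in> circle" for z
    using const[OF hu[of i' i'] hv[of 2 2] _ z] eq z vz by (simp add: i'_def)
  have v21: "v (inverse z) $ 2 $ 1 = 0" if z: "z \<in> circle" for z
  proof -
    have h: "(\<lambda>z. z ^ r * u z $ i' $ i) holomorphic_on U"
      by (intro holomorphic_intros hu)
    have "z ^ r * u z $ i' $ i = 0 ^ r * u 0 $ i' $ i"
      by (rule holomorphic_disc_exterior_const(2)[OF U(1,2) h V(1,2) hv[of 2 1] _ z])
         (simp add: eq)
    then show ?thesis using n z by (simp add: eq r_def)
  qed
  have "\<exists>t. t holomorphic_on U \<and> (\<forall>z\<in>circle. z ^ n * v (inverse z) $ 1 $ 2 = t z)"
  proof (cases "even n")
    case True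
    have "z ^ n * v (inverse z) $ 1 $ 2 = u z $ 1 $ 2" if "z \<in> circle" for z
      using that True circle_nonzero[OF that] by (simp add: eq i_def i'_def r_def power_inverse)
    then show ?thesis using hu by blast
  next
    \<comment> \<open>The zero of the lower left entry of \<open>u\<close> at 0 lowers the order
      from n + 1 to n.\<close>
    case False
    obtain t where t: "t holomorphic_on U" "\<And>z. u z $ 2 $ 1 = z * t z"
      using holomorphic_zero_divide[OF hu[of 2 1] U(1) uz(3)] by blast
    have "z ^ n * v (inverse z) $ 1 $ 2 = t z" if "z \<in> circle" for z
      using that False circle_nonzero[OF that]
      by (simp add: eq i_def i'_def r_def power_inverse t(2)) (simp add: field_simps)
    then show ?thesis using t(1) by blast
  qed
  then obtain t where t: "t holomorphic_on U" "\<And>z. z \<in> circle \<Longrightarrow> z ^ n * v (inverse z) $ 1 $ 2 = t z"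
    by blast
  \<comment> \<open>The gluing lemma is used in the coordinate w = 1/z, where the exterior plays the
    part of the disc.\<close>
  have "v w $ 1 $ 2 = w ^ n * t (inverse w)" if w: "w \<in> circle" for w
    using t(2)[OF inverse_circle[OF w]] circle_nonzero[OF w] by (simp add: power_inverse field_simps)
  then obtain a where a: "\<forall>w\<in>cball 0 1. v w $ 1 $ 2 = (\<Sum>k\<le>n. a k * w ^ k)"
    using holomorphic_disc_exterior_glue[OF V(1,2) hv[of 1 2] U(1,2) t(1)] by blast
  have "a 0 = 0"
  proof -
    have "(\<Sum>k\<le>n. a k * 0 ^ k) = a 0 * 0 ^ 0"
      by (subst sum.remove[of _ 0]) (auto intro: sum.neutral)
    then show ?thesis using a[rule_format, of 0] vz by simp
  qed
  then have a': "v w $ 1 $ 2 = (\<Sum>k=1..n. a k * w ^ k)" if "w \<in> cball 0 1" for w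
    using a that by (simp add: sum.atMost_shift sum.atLeast1_atMost_eq lessThan_Suc_atMost)
  have "v (inverse z) = mat2 1 (\<Sum>j=1..n. restrict a {1..n} j * inverse z ^ j) 0 1" if z: "z \<in> circle" for z
    by (rule mat2_eqI) (use v11[OF z] v21[OF z] v22[OF z] a'[of "inverse z"] inverse_circle[OF z] in auto)
  then have "l = upper_loop n (restrict a {1..n})"
    unfolding lv by (subst eq_commute) (simp add: upper_loop_eq_iff_pointwise)
  moreover have "restrict a {1..n} \<in> Cn n" by (simp add: Cn_def)
  ultimately show ?thesis by blast
qed

lemma N_minus_inter_conj_w_loop:
  assumes "n > 0"
  shows "N_minus \<inter> conj_loops (w_loop n) N_plus = {upper_loop n x | x. x \<in> Cn n}"
  using N_minus_inter_conj_subset[OF assms] upper_loop_in_N_minus upper_loop_in_conj[OF assms]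
  by blast

section \<open>The triangular factorization\<close>

text \<open>On the circle this is the conjugate of \<open>poly p\<close>; as a polynomial in 1/z it
  makes the identities algebraic and valid for every nonzero z.\<close>

definition star_poly :: "complex poly \<Rightarrow> complex \<Rightarrow> complex" where
  "star_poly p z = poly (map_poly cnj p) (inverse z)"

lemma map_poly_cnj_simps:
  "map_poly cnj 0 = 0" "map_poly cnj 1 = 1"
  "map_poly cnj (pCons a p) = pCons (cnj a) (map_poly cnj p)"
  "map_poly cnj (p + q) = map_poly cnj p + map_poly cnj q"
  "map_poly cnj (p - q) = map_poly cnj p - map_poly cnj q"
  "map_poly cnj (smult a p) = smult (cnj a) (map_poly cnj p)"
  by (auto intro!: poly_eqI simp: coeff_map_poly coeff_pCons split: nat.splits)

lemma star_poly_simps [simp]: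
  "star_poly 0 z = 0" "star_poly 1 z = 1"
  "star_poly (pCons a p) z = cnj a + inverse z * star_poly p z"
  "star_poly (p + q) z = star_poly p z + star_poly q z"
  "star_poly (p - q) z = star_poly p z - star_poly q z"
  "star_poly (smult a p) z = cnj a * star_poly p z"
  by (simp_all add: star_poly_def map_poly_cnj_simps)

text \<open>The first exponent \<open>j\<close> is independent of the first parameter
  \<open>k\<close>: removing a right factor raises both, while the polynomials of the closed form
  depend on the parameters only.\<close>

primrec tail_prod :: "nat \<Rightarrow> nat \<Rightarrow> nat \<Rightarrow> (nat \<Rightarrow> complex) \<Rightarrow> loop" where
  "tail_prod 0 k j \<zeta> z = mat2 1 0 0 1"
| "tail_prod (Suc m) k j \<zeta> z = tail_prod m (Suc k) (Suc j) \<zeta> z ** elem_factor j (\<zeta> k) z"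

lemma mat2_1_mult [simp]: "mat2 1 0 0 1 ** A = A" "A ** mat2 1 0 0 1 = A"
  by (simp_all flip: mat_1_eq_mat2 add: matrix_mul_lid matrix_mul_rid)

lemma tail_prod_left:
  "tail_prod (Suc m) k j \<zeta> z = elem_factor (j + m) (\<zeta> (k + m)) z ** tail_prod m k j \<zeta> z"
proof (induction m arbitrary: k j)
  case (Suc m)
  have "tail_prod (Suc (Suc m)) k j \<zeta> z
      = tail_prod (Suc m) (Suc k) (Suc j) \<zeta> z ** elem_factor j (\<zeta> k) z" by simp
  also have "\<dots> = elem_factor (Suc j + m) (\<zeta> (Suc k + m)) z **
      (tail_prod m (Suc k) (Suc j) \<zeta> z ** elem_factor j (\<zeta> k) z)"
    unfolding Suc by (simp only: matrix_mul_assoc)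
  also have "\<dots> = elem_factor (j + Suc m) (\<zeta> (k + Suc m)) z ** tail_prod (Suc m) k j \<zeta> z"
    by (simp only: tail_prod.simps add_Suc add_Suc_right)
  finally show ?case .
qed simp

lemma g_prod_eq_tail_prod: "g_prod n \<zeta> z = tail_prod n 1 1 \<zeta> z"
  by (induction n) (simp_all add: tail_prod_left del: tail_prod.simps(2))

text \<open>For \<open>j = 1\<close> this has second row (c, d) / sqrt N; other \<open>j\<close>
  move powers z^(j-1) onto the off-diagonal entries. They are written
  \<open>inverse z * z ^ j\<close> to avoid truncated subtraction.\<close>

definition unit_frame :: "real \<Rightarrow> complex poly \<Rightarrow> complex poly \<Rightarrow> nat \<Rightarrow> loop" where
  "unit_frame N c d j z = (let a = complex_of_real (1 / sqrt N) in
     mat2 (a * star_poly d z) (- a * (z * inverse z ^ j * star_poly c z))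
          (a * (inverse z * z ^ j * poly c z)) (a * poly d z))"

lemma inverse_sqrt_mult:
  "complex_of_real (1 / sqrt (a * b)) = complex_of_real (1 / sqrt a) * complex_of_real (1 / sqrt b)"
  by (simp add: real_sqrt_mult)

lemma tail_prod_eq_unit_frame:
  assumes "z \<noteq> 0"
  shows "tail_prod m k j \<zeta> z = unit_frame (N_prod m k \<zeta>) (C_poly m k \<zeta>) (D_poly m k \<zeta>) j z"
proof (induction m arbitrary: k j)
  case 0
  show ?case by (simp add: unit_frame_def)
next
  case (Suc m)
  have pw: "\<zeta> k * z powi (- int j) = \<zeta> k * inverse z ^ j"
    by (auto simp: power_int_def)
  have zz: "z * (inverse z * x) = x" "inverse z * (z * x) = x"
    "z ^ j * (inverse z ^ j * x) = x" "inverse z ^ j * (z ^ j * x) = x" for x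
    using assms by (simp_all flip: mult.assoc power_mult_distrib)
  define A where "A = complex_of_real (1 / sqrt (N_prod m (Suc k) \<zeta>))"
  define B where "B = complex_of_real (1 / sqrt (1 + (cmod (\<zeta> k))\<^sup>2))"
  have AB: "complex_of_real (1 / sqrt (N_prod (Suc m) k \<zeta>)) = A * B"
    unfolding N_prod.simps A_def B_def by (rule inverse_sqrt_mult)
  show ?case
    unfolding tail_prod.simps Suc unit_frame_def Let_def elem_factor_def pw AB
    unfolding A_def[symmetric] B_def[symmetric]
    by (simp add: algebra_simps zz)
qed

lemma star_poly_circle: "z \<in> circle \<Longrightarrow> star_poly p z = cnj (poly p z)"
  by (simp add: star_poly_def inverse_eq_cnj)

lemma det_elem_factor:
  assumes "z \<noteq> 0"
  shows "Determinants.det (elem_factor j t z) = 1"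
proof -
  have pw: "t * z powi (- int j) = t * inverse z ^ j"
    by (auto simp: power_int_def)
  have zz: "z ^ j * (inverse z ^ j * x) = x" "inverse z ^ j * (z ^ j * x) = x"
    "z ^ j * inverse z ^ j = 1" for x
    using assms by (simp_all flip: mult.assoc power_mult_distrib)
  define a where "a = complex_of_real (1 / sqrt (1 + (cmod t)\<^sup>2))"
  have "a * a * (1 + t * cnj t) = 1"
  proof -
    have p: "1 + (cmod t)\<^sup>2 > 0" by (simp add: add_pos_nonneg)
    have "a * a * (1 + t * cnj t) = complex_of_real ((1 / sqrt (1 + (cmod t)\<^sup>2))\<^sup>2 * (1 + (cmod t)\<^sup>2))"
      unfolding of_real_one_plus_cmod_sq[symmetric] a_def power2_eq_square[of "1 / _"] of_real_mult ..
    also have "\<dots> = 1" using p by (simp add: power_divide)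
    finally show ?thesis .
  qed
  then show ?thesis unfolding elem_factor_def pw Let_def a_def[symmetric]
    by (simp add: algebra_simps zz)
qed

lemma det_tail_prod:
  "z \<noteq> 0 \<Longrightarrow> Determinants.det (tail_prod m k j \<zeta> z) = 1"
  by (induction m arbitrary: k j) (simp_all add: Determinants.det_mul det_elem_factor)

text \<open>The elementary factors have determinant 1; the left side divided by N is the determinant
  of their product.\<close>

lemma CD_norm_identity:
  assumes "z \<noteq> 0"
  shows "star_poly (D_poly m k \<zeta>) z * poly (D_poly m k \<zeta>) z
       + star_poly (C_poly m k \<zeta>) z * poly (C_poly m k \<zeta>) z = of_real (N_prod m k \<zeta>)"
proof -
  let ?N = "N_prod m k \<zeta>" and ?c = "C_poly m k \<zeta>" and ?d = "D_poly m k \<zeta>"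
  define a where "a = complex_of_real (1 / sqrt ?N)"
  have "a * a = of_real (1 / ?N)"
    unfolding a_def by (simp add: N_prod_pos less_imp_le flip: of_real_mult)
  moreover have "of_real ?N \<noteq> (0::complex)" using N_prod_pos[of m k \<zeta>] by simp
  moreover have "a * star_poly ?d z * (a * poly ?d z) + a * star_poly ?c z * (a * poly ?c z) = 1"
    using det_tail_prod[OF assms, of m k 1 \<zeta>]
    unfolding tail_prod_eq_unit_frame[OF assms] unit_frame_def Let_def a_def[symmetric]
    using assms by simp
  then have "a * a * (star_poly ?d z * poly ?d z + star_poly ?c z * poly ?c z) = 1"
    by (simp add: algebra_simps)
  ultimately show ?thesis by (simp add: field_simps)
qed

text \<open>The content is that \<delta>^* - x \<gamma> and -\<gamma>^* - x \<delta> have no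
  negative powers of z, which is what the factorization requires of x.\<close>

lemma PQ_poly_eval:
  assumes "z \<noteq> 0"
  shows "star_poly (D_poly m k \<zeta>) z - inverse z * poly (Y_poly m k \<zeta>) (inverse z) * poly (C_poly m k \<zeta>) z
           = poly (P_poly m k \<zeta>) z \<and>
         - star_poly (C_poly m k \<zeta>) z - inverse z * poly (Y_poly m k \<zeta>) (inverse z) * poly (D_poly m k \<zeta>) z
           = poly (Q_poly m k \<zeta>) z"
proof (induction m arbitrary: k)
  case 0
  show ?case by simp
next
  case (Suc m)
  define w where "w = inverse z"
  have zw: "w * (z * x) = x" for x
    using assms by (simp_all add: w_def)
  define y0 where "y0 = coeff (Y_poly (Suc m) k \<zeta>) 0"
  let ?X = "w * poly (Y_poly m (Suc k) \<zeta>) w"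
  have IP: "star_poly (D_poly m (Suc k) \<zeta>) z - ?X * poly (C_poly m (Suc k) \<zeta>) z = poly (P_poly m (Suc k) \<zeta>) z"
    and IQ: "- star_poly (C_poly m (Suc k) \<zeta>) z - ?X * poly (D_poly m (Suc k) \<zeta>) z = poly (Q_poly m (Suc k) \<zeta>) z"
    using Suc[of "Suc k"] by (simp_all add: w_def)
  have Y: "poly (Y_poly (Suc m) k \<zeta>) w = y0 + ?X"
    by (simp add: y0_def)
  define R where "R = smult (\<zeta> k) (P_poly m (Suc k) \<zeta>) + Q_poly m (Suc k) \<zeta>
      - smult y0 (D_poly (Suc m) k \<zeta>)"
  have "coeff R 0 = 0"
    using coeff_PQ_poly[of m "Suc k" \<zeta> 0] coeff_Y_poly_Suc_0[of m k \<zeta>]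
    by (simp add: R_def y0_def coeff_C_poly_0 coeff_D_poly_0 mult.commute)
  then have "R = pCons 0 (poly_shift 1 R)"
    by (intro poly_eqI) (simp add: coeff_pCons coeff_poly_shift split: nat.splits)
  then have "poly R z = z * poly (poly_shift 1 R) z"
    by (metis add_0 poly_pCons)
  then have Q: "poly (Q_poly (Suc m) k \<zeta>) z = w * poly R z"
    unfolding Q_poly.simps y0_def[symmetric] R_def[symmetric] by (simp add: zw)
  have P: "poly (P_poly (Suc m) k \<zeta>) z = poly (P_poly m (Suc k) \<zeta>) z
      - cnj (\<zeta> k) * poly (Q_poly m (Suc k) \<zeta>) z
      - y0 * (poly (C_poly m (Suc k) \<zeta>) z - cnj (\<zeta> k) * poly (D_poly m (Suc k) \<zeta>) z)"
    unfolding P_poly.simps y0_def by simp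
  have C: "poly (C_poly (Suc m) k \<zeta>) z = z * (poly (C_poly m (Suc k) \<zeta>) z - cnj (\<zeta> k) * poly (D_poly m (Suc k) \<zeta>) z)"
    "star_poly (C_poly (Suc m) k \<zeta>) z = w * (star_poly (C_poly m (Suc k) \<zeta>) z - \<zeta> k * star_poly (D_poly m (Suc k) \<zeta>) z)"
    by (simp_all add: w_def)
  have D: "poly (D_poly (Suc m) k \<zeta>) z = \<zeta> k * poly (C_poly m (Suc k) \<zeta>) z + poly (D_poly m (Suc k) \<zeta>) z"
    "star_poly (D_poly (Suc m) k \<zeta>) z = cnj (\<zeta> k) * star_poly (C_poly m (Suc k) \<zeta>) z + star_poly (D_poly m (Suc k) \<zeta>) z"
    by simp_all
  have R: "poly R z = \<zeta> k * poly (P_poly m (Suc k) \<zeta>) z + poly (Q_poly m (Suc k) \<zeta>) z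
      - y0 * poly (D_poly (Suc m) k \<zeta>) z"
    by (simp only: R_def poly_add poly_diff poly_smult)
  have wz: "w * a * (z * b) = a * b" for a b
    using assms by (simp add: w_def)
  show ?case unfolding w_def[symmetric] Y P Q R C D IP[symmetric] IQ[symmetric] wz
    by (simp add: algebra_simps)
qed

text \<open>In the determinant the multiples of x cancel, which leaves the norm identity; at z = 0
  the constant terms decide.\<close>

lemma PQ_det:
  "poly (P_poly m k \<zeta>) z * poly (D_poly m k \<zeta>) z - poly (Q_poly m k \<zeta>) z * poly (C_poly m k \<zeta>) z
     = of_real (N_prod m k \<zeta>)"
proof (cases "z = 0")
  case True
  then show ?thesis using coeff_PQ_poly[of m k \<zeta> 0]
    by (simp add: poly_0_coeff_0 coeff_C_poly_0 coeff_D_poly_0)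
next
  case False
  show ?thesis using CD_norm_identity[OF False, of m k \<zeta>]
    unfolding PQ_poly_eval[OF False, of m k \<zeta>, THEN conjunct1, symmetric]
      PQ_poly_eval[OF False, of m k \<zeta>, THEN conjunct2, symmetric]
    by (simp add: algebra_simps)
qed

definition x_explicit :: "nat \<Rightarrow> (nat \<Rightarrow> complex) \<Rightarrow> nat \<Rightarrow> complex" where
  "x_explicit n \<zeta> = (\<lambda>j\<in>{1..n}. y_low (Suc n - j) j \<zeta>)"

lemma coeff_Y_x_explicit: "i < n \<Longrightarrow> coeff (Y_poly n 1 \<zeta>) i = x_explicit n \<zeta> (Suc i)"
  by (simp add: coeff_Y_poly x_explicit_def)

lemma sum_x_explicit:
  "(\<Sum>j=1..n. x_explicit n \<zeta> j * w ^ j) = w * poly (Y_poly n 1 \<zeta>) w"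
proof -
  have "poly (Y_poly n 1 \<zeta>) w = (\<Sum>i<n. coeff (Y_poly n 1 \<zeta>) i * w ^ i)"
  proof (cases "degree (Y_poly n 1 \<zeta>) < n")
    case True
    then show ?thesis unfolding poly_altdef
      by (intro sum.mono_neutral_left) (auto simp: coeff_eq_0)
  next
    case False
    then have "n = 0 \<or> Y_poly n 1 \<zeta> = 0"
      by (metis coeff_Y_poly_high leading_coeff_0_iff not_le)
    then show ?thesis by auto
  qed
  then show ?thesis
    by (simp add: sum_distrib_left sum.atLeast1_atMost_eq coeff_Y_x_explicit[symmetric, unfolded One_nat_def] mult_ac)
qed

text \<open>The second diagonal entry of u(0) is to be 1 and \<delta>(0) is 1 / sqrt N, hence a =
  diag(sqrt N, 1 / sqrt N). The rows of u are then (P, Q) / N and (C, D), and the constant terms N,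
  0, 1 of P, C, D make u(0) unipotent.\<close>

lemma triangular_factorization_g_loop:
  "\<exists>a u. triangular_factorization (g_loop n \<zeta>) (upper_loop n (x_explicit n \<zeta>)) a u"
proof -
  let ?N = "N_prod n 1 \<zeta>"
  define s where "s = sqrt ?N"
  have s: "s > 0" "s * s = ?N" using N_prod_pos[of n 1 \<zeta>] by (simp_all add: s_def)
  define S where "S = complex_of_real s"
  have S: "S \<noteq> 0" "S * S = of_real ?N" using s by (simp_all add: S_def flip: of_real_mult)
  let ?u = "\<lambda>z. mat2 (poly (P_poly n 1 \<zeta>) z / of_real ?N) (poly (Q_poly n 1 \<zeta>) z / of_real ?N)
     (poly (C_poly n 1 \<zeta>) z) (poly (D_poly n 1 \<zeta>) z)"
  have N0: "of_real ?N \<noteq> (0::complex)" using N_prod_pos[of n 1 \<zeta>] by simp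
  have u: "restrict ?u circle \<in> N_plus"
  proof (rule N_plusI[where U = UNIV and u = ?u])
    show "holomorphic_SL2 UNIV ?u" unfolding holomorphic_SL2_mat2
      using N0 PQ_det[of n 1 \<zeta>]
      by (intro conjI ballI holomorphic_intros) (simp_all add: diff_divide_distrib[symmetric])
    show "upper_unipotent (?u 0)" using N0 coeff_PQ_poly[of n 1 \<zeta> 0]
      by (simp add: poly_0_coeff_0 coeff_C_poly_0 coeff_D_poly_0)
  qed auto
  have eq: "g_loop n \<zeta> = (\<lambda>z\<in>circle. upper_loop n (x_explicit n \<zeta>) z **
      mat2 (of_real s) 0 0 (of_real (1 / s)) ** restrict ?u circle z)"
    unfolding g_loop_def
  proof (rule restrict_ext)
    fix z :: complex assume z: "z \<in> circle"
    have z0: "z \<noteq> 0" using circle_nonzero[OF z] .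
    define X where "X = inverse z * poly (Y_poly n 1 \<zeta>) (inverse z)"
    have U: "upper_loop n (x_explicit n \<zeta>) z = mat2 1 X 0 1"
      using z by (simp only: upper_loop_def sum_powi_neg sum_x_explicit X_def restrict_apply')
    have P: "poly (P_poly n 1 \<zeta>) z = star_poly (D_poly n 1 \<zeta>) z - X * poly (C_poly n 1 \<zeta>) z"
      and Q: "poly (Q_poly n 1 \<zeta>) z = - star_poly (C_poly n 1 \<zeta>) z - X * poly (D_poly n 1 \<zeta>) z"
      using PQ_poly_eval[OF z0, of n 1 \<zeta>] by (simp_all add: X_def)
    have inv: "complex_of_real (1 / sqrt ?N) = 1 / S" by (simp add: S_def s_def)
    show "g_prod n \<zeta> z = upper_loop n (x_explicit n \<zeta>) z **
      mat2 (of_real s) 0 0 (of_real (1 / s)) ** restrict ?u circle z"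
      unfolding g_prod_eq_tail_prod tail_prod_eq_unit_frame[OF z0] unit_frame_def U P Q inv Let_def
        S(2)[symmetric] restrict_apply'[OF z]
      using S(1) z0 by (simp add: S_def[symmetric]) (simp add: field_simps)
  qed
  show ?thesis unfolding triangular_factorization_def
    using upper_loop_in_N_minus u eq s by (intro exI[of _ "mat2 (of_real s) 0 0 (of_real (1 / s))"]
        exI[of _ "restrict ?u circle"] conjI exI[of _ s] exI[of _ "1 / s"]) auto
qed

text \<open>A polynomial in 1/z that extends over the disc is constant; its value at infinity is 0,
  and infinitely many roots on the circle kill the coefficients.\<close>

lemma upper_loop_holomorphic_imp_zero:
  assumes U: "open U" "cball 0 1 \<subseteq> U" "f holomorphic_on U"
    and eq: "\<And>z. z \<in> circle \<Longrightarrow> (\<Sum>j=1..n. x j * inverse z ^ j) = f z"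
    and j: "j \<in> {1..n}"
  shows "x j = (0::complex)"
proof -
  let ?h = "\<lambda>w. \<Sum>j=1..n. x j * w ^ j"
  have h: "?h holomorphic_on UNIV" by (intro holomorphic_intros)
  have h0: "?h 0 = 0" by (auto intro: sum.neutral)
  have zero: "?h w = 0" if "w \<in> circle" for w
    using holomorphic_disc_exterior_const(1)[OF U open_UNIV _ h, of "inverse w"] eq h0
      inverse_circle[OF that] eq[OF inverse_circle[OF that]] by simp
  define p where "p = (\<Sum>j=1..n. Polynomial.monom (x j) j)"
  have "poly p w = ?h w" for w by (simp add: p_def poly_sum poly_monom)
  then have "circle \<subseteq> {w. poly p w = 0}" using zero by auto
  moreover have "infinite circle"
  proof -
    have "connected circle" by (rule connected_sphere) simp
    moreover have "1 \<in> circle" "-1 \<in> circle" "(1::complex) \<noteq> -1" by auto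
    ultimately show ?thesis using connected_finite_iff_sing[of circle] by (metis empty_iff singletonD)
  qed
  ultimately have "p = 0" using poly_roots_finite finite_subset by blast
  then have "coeff p j = 0" by simp
  then show ?thesis using j by (simp add: p_def coeff_sum)
qed

lemma triangular_factorizationE:
  assumes "triangular_factorization g (upper_loop n x) a u"
  obtains v U a1 a2 where "open U" "cball 0 1 \<subseteq> U" "holomorphic_SL2 U v" "a2 \<noteq> 0"
    "\<And>z. z \<in> circle \<Longrightarrow>
       g z = mat2 1 (\<Sum>j=1..n. x j * inverse z ^ j) 0 1 ** mat2 a1 0 0 a2 ** v z"
proof -
  obtain b1 b2 where b: "b1 > (0::real)" "b2 > 0" "a = mat2 (of_real b1) 0 0 (of_real b2)"
    and u: "u \<in> N_plus" and g: "g = (\<lambda>z\<in>circle. upper_loop n x z ** a ** u z)"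
    using assms unfolding triangular_factorization_def by blast
  obtain v U where v: "u = restrict v circle" "open U" "cball 0 1 \<subseteq> U" "holomorphic_SL2 U v"
    using u unfolding N_plus_def by blast
  show ?thesis
  proof (rule that[OF v(2,3,4)])
    show "complex_of_real b2 \<noteq> 0" using b by simp
    show "g z = mat2 1 (\<Sum>j=1..n. x j * inverse z ^ j) 0 1 ** mat2 (of_real b1) 0 0 (of_real b2) ** v z"
      if "z \<in> circle" for z
      using that unfolding g b(3) upper_loop_def sum_powi_neg v(1) by simp
  qed
qed

lemma upper_factor_unique:
  assumes "triangular_factorization g (upper_loop n x) a u" "triangular_factorization g (upper_loop n x') a' u'"
    and "x \<in> Cn n" "x' \<in> Cn n"
  shows "x = x'"
proof (rule triangular_factorizationE[OF assms(1)], rule triangular_factorizationE[OF assms(2)])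
  fix u U a1 a2 u' U' a1' a2'
  assume U: "open U" "cball 0 1 \<subseteq> U" "holomorphic_SL2 U u" "a2 \<noteq> 0"
    and g: "\<And>z. z \<in> circle \<Longrightarrow> g z = mat2 1 (\<Sum>j=1..n. x j * inverse z ^ j) 0 1 ** mat2 a1 0 0 a2 ** u z"
    and U': "open U'" "cball 0 1 \<subseteq> U'" "holomorphic_SL2 U' u'" "a2' \<noteq> 0"
    and g': "\<And>z. z \<in> circle \<Longrightarrow> g z = mat2 1 (\<Sum>j=1..n. x' j * inverse z ^ j) 0 1 ** mat2 a1' 0 0 a2' ** u' z"
  \<comment> \<open>The two first rows differ by X - X' times the common second row
    \<open>a2 * u z $ 2\<close>. Pairing with the first row of \<open>u\<close> and using det u = 1
    isolates X - X' without dividing by an entry that may vanish, so the difference extends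
    holomorphically over the disc.\<close>
  define f where "f = (\<lambda>z. ((a1' * u' z $ 1 $ 2 - a1 * u z $ 1 $ 2) * u z $ 1 $ 1
      - (a1' * u' z $ 1 $ 1 - a1 * u z $ 1 $ 1) * u z $ 1 $ 2) / a2)"
  have hu: "(\<lambda>z. u z $ i $ j) holomorphic_on U \<inter> U'" for i j
  proof (rule holomorphic_on_subset)
    show "(\<lambda>z. u z $ i $ j) holomorphic_on U" using U(3) by (simp add: holomorphic_SL2_def)
  qed simp
  have hu': "(\<lambda>z. u' z $ i $ j) holomorphic_on U \<inter> U'" for i j
  proof (rule holomorphic_on_subset)
    show "(\<lambda>z. u' z $ i $ j) holomorphic_on U'" using U'(3) by (simp add: holomorphic_SL2_def)
  qed simp
  have f: "f holomorphic_on U \<inter> U'"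
    unfolding f_def using U(4) by (intro holomorphic_intros hu hu') simp_all
  have "x j - x' j = 0" if "j \<in> {1..n}" for j
  proof (rule upper_loop_holomorphic_imp_zero[where x = "\<lambda>j. x j - x' j", OF _ _ f _ that])
    fix z :: complex assume z: "z \<in> circle"
    define X where "X = (\<Sum>j=1..n. x j * inverse z ^ j)"
    define X' where "X' = (\<Sum>j=1..n. x' j * inverse z ^ j)"
    have "z \<in> U" using z U(2) by auto
    then have det: "u z $ 1 $ 1 * u z $ 2 $ 2 - u z $ 1 $ 2 * u z $ 2 $ 1 = 1"
      using U(3) by (simp add: holomorphic_SL2_def Determinants.det_2)
    have "mat2 1 X 0 1 ** mat2 a1 0 0 a2 ** mat2 (u z $ 1 $ 1) (u z $ 1 $ 2) (u z $ 2 $ 1) (u z $ 2 $ 2)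
      = mat2 1 X' 0 1 ** mat2 a1' 0 0 a2' ** mat2 (u' z $ 1 $ 1) (u' z $ 1 $ 2) (u' z $ 2 $ 1) (u' z $ 2 $ 2)"
      using g[OF z] g'[OF z] unfolding mat2_eta X_def X'_def by simp
    then have e: "a1 * u z $ 1 $ 1 + X * a2 * u z $ 2 $ 1 = a1' * u' z $ 1 $ 1 + X' * a2' * u' z $ 2 $ 1"
      "a1 * u z $ 1 $ 2 + X * a2 * u z $ 2 $ 2 = a1' * u' z $ 1 $ 2 + X' * a2' * u' z $ 2 $ 2"
      "a2 * u z $ 2 $ 1 = a2' * u' z $ 2 $ 1" "a2 * u z $ 2 $ 2 = a2' * u' z $ 2 $ 2"
      by (auto simp: mult.assoc)
    have e1: "a1' * u' z $ 1 $ 1 - a1 * u z $ 1 $ 1 = (X - X') * (a2 * u z $ 2 $ 1)"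
      using e(1,3) by (simp add: algebra_simps)
    have e2: "a1' * u' z $ 1 $ 2 - a1 * u z $ 1 $ 2 = (X - X') * (a2 * u z $ 2 $ 2)"
      using e(2,4) by (simp add: algebra_simps)
    have "f z = (X - X') * (u z $ 1 $ 1 * u z $ 2 $ 2 - u z $ 1 $ 2 * u z $ 2 $ 1)"
      unfolding f_def e1 e2 using U(4) by (simp add: field_simps)
    then show "(\<Sum>j=1..n. (x j - x' j) * inverse z ^ j) = f z"
      unfolding det by (simp add: X_def X'_def left_diff_distrib sum_subtractf)
  qed (simp_all add: U(1,2) U'(1,2) open_Int)
  then show ?thesis using assms(3,4) unfolding Cn_def by (intro PiE_ext) auto
qed

lemma x_coords_eq: "x_coords n \<zeta> = x_explicit n \<zeta>"
proof -
  have "x_explicit n \<zeta> \<in> Cn n" by (simp add: Cn_def x_explicit_def)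
  then show ?thesis unfolding x_coords_def
    using triangular_factorization_g_loop[of n \<zeta>] upper_factor_unique by (intro the_equality) blast+
qed

section \<open>Finite Toeplitz determinants\<close>

definition W_prod :: "nat \<Rightarrow> nat \<Rightarrow> (nat \<Rightarrow> complex) \<Rightarrow> real" where
  "W_prod m k \<zeta> = (\<Prod>i<m. (1 + (cmod (\<zeta> (k + i)))\<^sup>2) ^ Suc i)"

text \<open>One factor is split off each power. The ratio N is the one that Cramer's rule yields for
  consecutive finite determinants.\<close>

lemma W_prod_Suc: "W_prod (Suc m) k \<zeta> = N_prod (Suc m) k \<zeta> * W_prod m (Suc k) \<zeta>"
proof -
  have "W_prod (Suc m) k \<zeta> = (1 + (cmod (\<zeta> k))\<^sup>2) *
      (\<Prod>i<m. (1 + (cmod (\<zeta> (Suc k + i)))\<^sup>2) ^ Suc (Suc i))"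
    by (simp add: W_prod_def prod.lessThan_Suc_shift del: prod.lessThan_Suc)
  also have "(\<Prod>i<m. (1 + (cmod (\<zeta> (Suc k + i)))\<^sup>2) ^ Suc (Suc i))
      = N_prod m (Suc k) \<zeta> * W_prod m (Suc k) \<zeta>"
    unfolding N_prod_eq W_prod_def prod.distrib[symmetric] by (simp only: power_Suc)
  finally show ?thesis by (simp only: N_prod.simps mult_ac)
qed

lemma W_prod_pos: "W_prod m k \<zeta> > 0"
  unfolding W_prod_def by (intro prod_pos) (simp add: add_pos_nonneg del: power_Suc)

text \<open>Replacing the last column of \<open>A\<close> by \<open>A w\<close> multiplies the
  determinant by the last entry of \<open>w\<close>, here 1; the new column is a multiple of a unit
  vector, and expansion along it gives the minor.\<close>

lemma det_last_from_solution:
  fixes A :: "complex Matrix.mat"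
  assumes A: "A \<in> carrier_mat (Suc m) (Suc m)" and w: "w \<in> carrier_vec (Suc m)"
    and Aw: "A *\<^sub>v w = c \<cdot>\<^sub>v unit_vec (Suc m) m" and wm: "vec_index w m = 1"
  shows "det A = c * det (mat_delete A m m)"
proof -
  define R where "R = replace_col A (A *\<^sub>v w) m"
  have R: "R \<in> carrier_mat (Suc m) (Suc m)" using A by (simp add: R_def replace_col_def)
  have "det R = vec_index w m * det A"
    unfolding R_def by (rule cramer_lemma_mat[OF A w]) simp
  then have "det A = det R" using wm by simp
  also have "\<dots> = (\<Sum>i<Suc m. R $$ (i, m) * cofactor R i m)"
    by (rule laplace_expansion_column[OF R]) simp
  also have "\<dots> = (\<Sum>i<Suc m. if i = m then c * cofactor R m m else 0)"
    by (rule sum.cong[OF refl]) (use A in \<open>auto simp: R_def replace_col_def Aw\<close>)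
  also have "\<dots> = c * cofactor R m m" by (simp add: sum.delta)
  also have "mat_delete R m m = mat_delete A m m"
    using A by (auto simp: R_def replace_col_def mat_delete_def intro!: eq_matI)
  then have "cofactor R m m = det (mat_delete A m m)"
    by (simp add: cofactor_def)
  finally show ?thesis .
qed

section \<open>The matrix \<open>1 + B B^*\<close> and its principal minor\<close>

definition one_plus_BB :: "nat \<Rightarrow> (nat \<Rightarrow> complex) \<Rightarrow> complex Matrix.mat" where
  "one_plus_BB m y = 1\<^sub>m m + B_mat m y * mat_adjoint (B_mat m y)"

lemma mat_adjoint_carrier:
  "(A :: complex Matrix.mat) \<in> carrier_mat m n \<Longrightarrow> mat_adjoint A \<in> carrier_mat n m"
  unfolding mat_adjoint_def by (intro carrier_matI) auto

lemma mat_adjoint_index: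
  fixes A :: "complex Matrix.mat"
  assumes "A \<in> carrier_mat m n" "i < n" "j < m"
  shows "mat_adjoint A $$ (i, j) = cnj (A $$ (j, i))"
  using assms unfolding mat_adjoint_def by (auto simp: mat_of_rows_def)

lemma B_mat_carrier: "B_mat m y \<in> carrier_mat m m"
  by (simp add: B_mat_def)

lemma B_mat_index:
  "r < m \<Longrightarrow> s < m \<Longrightarrow> B_mat m y $$ (r, s) = (if s \<le> r then y (m - (r - s)) else 0)"
  by (simp add: B_mat_def)

lemma one_plus_BB_carrier: "one_plus_BB m y \<in> carrier_mat m m"
  unfolding one_plus_BB_def
  by (intro add_carrier_mat mult_carrier_mat[OF B_mat_carrier mat_adjoint_carrier] B_mat_carrier)

lemma one_plus_BB_index:
  assumes rs: "r < m" "s < m"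
  shows "one_plus_BB m y $$ (r, s) = (if r = s then 1 else 0) +
    (\<Sum>t<m. (if t \<le> r then y (m - (r - t)) else 0) * cnj (if t \<le> s then y (m - (s - t)) else 0))"
proof -
  note Ad = mat_adjoint_carrier[OF B_mat_carrier[of m y]]
  have "(B_mat m y * mat_adjoint (B_mat m y)) $$ (r, s)
      = (\<Sum>t<m. B_mat m y $$ (r, t) * mat_adjoint (B_mat m y) $$ (t, s))"
    using rs carrier_matD[OF B_mat_carrier[of m y]] carrier_matD[OF Ad]
    by (simp add: scalar_prod_def lessThan_atLeast0)
  also have "\<dots> = (\<Sum>t<m. (if t \<le> r then y (m - (r - t)) else 0) * cnj (if t \<le> s then y (m - (s - t)) else 0))"
    by (rule sum.cong[OF refl]) (use rs in \<open>simp add: mat_adjoint_index[OF B_mat_carrier] B_mat_index\<close>)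
  finally show ?thesis
    using rs carrier_matD[OF B_mat_carrier[of m y]] carrier_matD[OF Ad]
    unfolding one_plus_BB_def by simp
qed

text \<open>y_1 occurs only in the lower left corner of B, hence only in its last row; deleting that
  row lowers the remaining indices by one.\<close>

lemma one_plus_BB_restrict:
  "mat_delete (one_plus_BB (Suc m) y) m m = one_plus_BB m (\<lambda>j. y (Suc j))"
proof (rule eq_matI)
  fix r s assume "r < dim_row (one_plus_BB m (\<lambda>j. y (Suc j)))" "s < dim_col (one_plus_BB m (\<lambda>j. y (Suc j)))"
  then have rs: "r < m" "s < m" by (simp_all add: carrier_matD[OF one_plus_BB_carrier])
  have "mat_delete (one_plus_BB (Suc m) y) m m $$ (r, s) = one_plus_BB (Suc m) y $$ (r, s)"
    using rs one_plus_BB_carrier[of "Suc m" y] by (simp add: mat_delete_def)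
  also have "\<dots> = one_plus_BB m (\<lambda>j. y (Suc j)) $$ (r, s)"
    using rs by (subst (1 2) one_plus_BB_index) (auto simp: Suc_diff_le intro!: sum.cong)
  finally show "mat_delete (one_plus_BB (Suc m) y) m m $$ (r, s) = one_plus_BB m (\<lambda>j. y (Suc j)) $$ (r, s)" .
qed (simp_all add: mat_delete_def carrier_matD[OF one_plus_BB_carrier])

text \<open>The coefficients of \<open>\<delta>\<close>, conjugated and reversed, solve \<open>(1 + B B\<^sup>*) w = N e\<close> with \<open>e\<close> the
  last unit vector, by the two relations between \<open>x\<close>, \<open>\<gamma>\<close> and \<open>\<delta>\<close>.\<close>

lemma one_plus_BB_solution:
  fixes k m :: nat and \<zeta> :: "nat \<Rightarrow> complex"
  defines "y \<equiv> \<lambda>j. coeff (Y_poly (Suc m) k \<zeta>) (j - 1)"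
  defines "w \<equiv> Matrix.vec (Suc m) (\<lambda>r. cnj (coeff (D_poly (Suc m) k \<zeta>) (m - r)))"
  shows "one_plus_BB (Suc m) y *\<^sub>v w = of_real (N_prod (Suc m) k \<zeta>) \<cdot>\<^sub>v unit_vec (Suc m) m"
proof -
  define a where "a = coeff (Y_poly (Suc m) k \<zeta>)"
  define c where "c = coeff (C_poly (Suc m) k \<zeta>)"
  define d where "d = coeff (D_poly (Suc m) k \<zeta>)"
  define N where "N = complex_of_real (N_prod (Suc m) k \<zeta>)"
  have I1: "(\<Sum>i<Suc m. a (s + i) * d i) = - cnj (c (Suc s))"
    and I2: "(\<Sum>i<Suc m. a (s + i) * c (Suc i)) = cnj (d s) - (if s = 0 then N else 0)" for s
    using Y_C_D_relations[where m = "Suc m" and k = k and s = s and \<zeta> = \<zeta>]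
    by (simp_all add: a_def c_def d_def N_def del: C_poly.simps D_poly.simps Y_poly.simps N_prod.simps sum.lessThan_Suc)
  have a_high: "a i = 0" if "i > m" for i using that coeff_Y_poly_high[of "Suc m" i k \<zeta>] by (simp add: a_def del: Y_poly.simps)
  define B where "B = (\<lambda>r t. if t \<le> r then a (m - (r - t)) else 0)"
  have y: "(if t \<le> r then y (Suc m - (r - t)) else 0) = B r t" if "r < Suc m" for r t
    using that by (simp add: y_def a_def B_def Suc_diff_le del: Y_poly.simps)
  \<comment> \<open>The first relation says that \<open>B^* w\<close> is minus the coefficient
    vector of \<gamma>. The second, used in \<open>Bc\<close>, says that \<open>B\<close> maps that
    coefficient vector to w - N e. Together they give w + \<open>B B^*\<close> w = N e.\<close>
  have Bw: "(\<Sum>s<Suc m. cnj (B s t) * cnj (d (m - s))) = - c (Suc t)" if t: "t < Suc m" for t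
  proof -
    have "(\<Sum>s<Suc m. B s t * d (m - s)) = (\<Sum>i<Suc m. B (m - i) t * d i)"
      by (rule sum.reindex_bij_witness[of _ "\<lambda>i. m - i" "\<lambda>i. m - i"]) auto
    also have "\<dots> = (\<Sum>i<Suc m. a (t + i) * d i)"
    proof (rule sum.cong[OF refl])
      fix i assume "i \<in> {..<Suc m}"
      then have i: "i \<le> m" by simp
      show "B (m - i) t * d i = a (t + i) * d i"
      proof (cases "t \<le> m - i")
        case True
        then have "m - (m - i - t) = t + i" using i t by simp
        then show ?thesis using True by (simp add: B_def)
      next
        case False
        then have "a (t + i) = 0" using i by (intro a_high) simp
        then show ?thesis using False by (simp add: B_def)
      qed
    qed
    finally have "(\<Sum>s<Suc m. B s t * d (m - s)) = - cnj (c (Suc t))" unfolding I1 .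
    from arg_cong[OF this, of cnj] show ?thesis by (simp del: sum.lessThan_Suc)
  qed
  have Bc: "(\<Sum>t<Suc m. B r t * c (Suc t)) = cnj (d (m - r)) - (if r = m then N else 0)" if r: "r < Suc m" for r
  proof -
    have "(\<Sum>t<Suc m. B r t * c (Suc t)) = (\<Sum>t<Suc m. a (m - r + t) * c (Suc t))"
    proof (rule sum.cong[OF refl])
      fix t assume "t \<in> {..<Suc m}"
      show "B r t * c (Suc t) = a (m - r + t) * c (Suc t)"
      proof (cases "t \<le> r")
        case True
        then have "m - (r - t) = m - r + t" using r by simp
        then show ?thesis using True by (simp add: B_def)
      next
        case False
        then have "a (m - r + t) = 0" using r by (intro a_high) simp
        then show ?thesis using False by (simp add: B_def)
      qed
    qed
    also have "\<dots> = cnj (d (m - r)) - (if r = m then N else 0)"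
      unfolding I2 using r by auto
    finally show ?thesis .
  qed
  have "(\<Sum>s<Suc m. one_plus_BB (Suc m) y $$ (r, s) * cnj (d (m - s))) = (if r = m then N else 0)"
    if r: "r < Suc m" for r
  proof -
    have "(\<Sum>s<Suc m. one_plus_BB (Suc m) y $$ (r, s) * cnj (d (m - s)))
        = (\<Sum>s<Suc m. ((if r = s then 1 else 0) + (\<Sum>t<Suc m. B r t * cnj (B s t))) * cnj (d (m - s)))"
      by (rule sum.cong[OF refl]) (use r in \<open>simp only: one_plus_BB_index y lessThan_iff\<close>)
    also have "\<dots> = (\<Sum>s<Suc m. (if r = s then cnj (d (m - s)) else 0)) +
        (\<Sum>s<Suc m. \<Sum>t<Suc m. B r t * (cnj (B s t) * cnj (d (m - s))))"
      unfolding sum.distrib[symmetric]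
      by (rule sum.cong[OF refl]) (simp add: distrib_right sum_distrib_right mult.assoc del: sum.lessThan_Suc)
    also have "(\<Sum>s<Suc m. (if r = s then cnj (d (m - s)) else 0)) = cnj (d (m - r))"
      using r by (simp add: sum.delta' del: sum.lessThan_Suc)
    also have "(\<Sum>s<Suc m. \<Sum>t<Suc m. B r t * (cnj (B s t) * cnj (d (m - s))))
        = (\<Sum>t<Suc m. B r t * (- c (Suc t)))"
      by (subst sum.swap) (intro sum.cong refl, simp add: sum_distrib_left[symmetric] Bw del: sum.lessThan_Suc)
    also have "\<dots> = - (\<Sum>t<Suc m. B r t * c (Suc t))"
      by (simp add: sum_negf del: sum.lessThan_Suc)
    finally show ?thesis unfolding Bc[OF r] by simp
  qed
  note row = this
  show ?thesis
  proof (rule eq_vecI)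
    fix r assume "r < dim_vec (of_real (N_prod (Suc m) k \<zeta>) \<cdot>\<^sub>v unit_vec (Suc m) m :: complex Matrix.vec)"
    then have r: "r < Suc m" by simp
    have dims: "dim_row (one_plus_BB (Suc m) y) = Suc m" "dim_col (one_plus_BB (Suc m) y) = Suc m"
      using one_plus_BB_carrier[of "Suc m" y] by auto
    have "vec_index (one_plus_BB (Suc m) y *\<^sub>v w) r
        = (\<Sum>s<Suc m. one_plus_BB (Suc m) y $$ (r, s) * cnj (d (m - s)))"
      using r dims by (simp add: w_def d_def scalar_prod_def lessThan_atLeast0 del: D_poly.simps sum.lessThan_Suc)
    then show "vec_index (one_plus_BB (Suc m) y *\<^sub>v w) r
        = vec_index (of_real (N_prod (Suc m) k \<zeta>) \<cdot>\<^sub>v unit_vec (Suc m) m) r"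
      unfolding row[OF r] using r by (simp add: N_def del: N_prod.simps)
  qed (use one_plus_BB_carrier[of "Suc m" y] in simp)
qed

lemma det_one_plus_BB_eq_W:
  "det_one_plus_BB m (\<lambda>j. coeff (Y_poly m k \<zeta>) (j - 1)) = of_real (W_prod m k \<zeta>)"
proof (induction m arbitrary: k)
  case 0
  have "one_plus_BB 0 y = 1\<^sub>m 0" for y
    using one_plus_BB_carrier[of 0 y] by (intro eq_matI) auto
  then show ?case by (simp add: det_one_plus_BB_def flip: one_plus_BB_def) (simp add: W_prod_def)
next
  case (Suc m)
  define w where "w = Matrix.vec (Suc m) (\<lambda>r. cnj (coeff (D_poly (Suc m) k \<zeta>) (m - r)))"
  let ?M = "one_plus_BB (Suc m) (\<lambda>j. coeff (Y_poly (Suc m) k \<zeta>) (j - 1))"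
  have "det ?M = of_real (N_prod (Suc m) k \<zeta>) * det (mat_delete ?M m m)"
  proof (rule det_last_from_solution[OF one_plus_BB_carrier])
    show "w \<in> carrier_vec (Suc m)" by (simp add: w_def)
    show "?M *\<^sub>v w = of_real (N_prod (Suc m) k \<zeta>) \<cdot>\<^sub>v unit_vec (Suc m) m"
      unfolding w_def by (rule one_plus_BB_solution)
    show "vec_index w m = 1" using coeff_D_poly_0[of "Suc m" k \<zeta>] by (simp add: w_def del: D_poly.simps)
  qed
  \<comment> \<open>Forgetting the first coordinate amounts to forgetting \<zeta>_k, as
    \<open>Y_poly m (Suc k)\<close> is the tail of \<open>Y_poly (Suc m) k\<close>.\<close>
  also have "mat_delete ?M m m = one_plus_BB m (\<lambda>j. coeff (Y_poly m (Suc k) \<zeta>) (j - 1))"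
    unfolding one_plus_BB_restrict
  proof (rule eq_matI)
    fix r s assume "r < dim_row (one_plus_BB m (\<lambda>j. coeff (Y_poly m (Suc k) \<zeta>) (j - 1)))"
      "s < dim_col (one_plus_BB m (\<lambda>j. coeff (Y_poly m (Suc k) \<zeta>) (j - 1)))"
    then have rs: "r < m" "s < m" by (simp_all add: carrier_matD[OF one_plus_BB_carrier])
    have Y: "coeff (Y_poly (Suc m) k \<zeta>) (Suc (m - (r - t)) - 1) = coeff (Y_poly m (Suc k) \<zeta>) (m - (r - t) - 1)"
      if "r < m" for r t
    proof -
      have "m - (r - t) = Suc (m - (r - t) - 1)" using that by simp
      then show ?thesis by (metis Y_poly.simps(2) coeff_pCons_Suc diff_Suc_1)
    qed
    show "one_plus_BB m (\<lambda>j. coeff (Y_poly (Suc m) k \<zeta>) (Suc j - 1)) $$ (r, s)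
        = one_plus_BB m (\<lambda>j. coeff (Y_poly m (Suc k) \<zeta>) (j - 1)) $$ (r, s)"
      unfolding one_plus_BB_index[OF rs] Y[OF rs(1)] Y[OF rs(2)] ..
  qed (simp_all add: carrier_matD[OF one_plus_BB_carrier])
  also have "det \<dots> = of_real (W_prod m (Suc k) \<zeta>)"
    using Suc[of "Suc k"] by (simp add: det_one_plus_BB_def one_plus_BB_def)
  finally show ?case
    unfolding W_prod_Suc of_real_mult by (simp add: det_one_plus_BB_def one_plus_BB_def del: N_prod.simps Y_poly.simps)
qed

text \<open>For \<open>|\<gamma>|\<^sup>2 + |\<delta>|\<^sup>2 = 1\<close> on the circle, \<open>gram_mat \<gamma> \<delta> m\<close> is \<open>1 - H H\<^sup>*\<close> for the Hankel block \<open>H\<close> of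
  the loop with second row \<open>(\<gamma>, \<delta>)\<close>. It is unchanged under unitary rotations of \<open>(\<gamma>, \<delta>)\<close>, and
  multiplying \<open>\<gamma>\<close> by \<open>z\<close> only borders it by a row and a column whose Schur complement is the old
  matrix.\<close>

definition gram_mat :: "complex poly \<Rightarrow> complex poly \<Rightarrow> nat \<Rightarrow> complex Matrix.mat" where
  "gram_mat c d m = Matrix.mat m m (\<lambda>(i, j). \<Sum>l\<le>min i j.
     cnj (coeff d (i - l)) * coeff d (j - l) + cnj (coeff c (i - l)) * coeff c (j - l))"

lemma gram_mat_carrier [simp]: "gram_mat c d m \<in> carrier_mat m m"
  by (simp add: gram_mat_def)

lemma gram_mat_rotate:
  "gram_mat (c - smult (cnj t) d) (smult t c + d) m
     = (1 + t * cnj t) \<cdot>\<^sub>m gram_mat c d m"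
  by (rule eq_matI) (auto simp: gram_mat_def sum_distrib_left algebra_simps intro!: sum.cong)

text \<open>\<open>A\<close> is a rank one matrix plus a lower right block. Putting \<open>u\<close>
  into the first column of one factor and \<open>v\<close> into the first row of the other avoids
  dividing by the pivot.\<close>

lemma det_schur_first:
  fixes A G :: "complex Matrix.mat" and u v :: "nat \<Rightarrow> complex"
  assumes A: "A \<in> carrier_mat (Suc m) (Suc m)" and G: "G \<in> carrier_mat m m"
    and ent: "\<And>i j. i < Suc m \<Longrightarrow> j < Suc m \<Longrightarrow>
      A $$ (i, j) = u i * v j + (if i = 0 \<or> j = 0 then 0 else G $$ (i - 1, j - 1))"
  shows "det A = u 0 * v 0 * det G"
proof -
  define K where "K = Matrix.mat (Suc m) (Suc m) (\<lambda>(i, j). if j = 0 then u i else if i = j then 1 else 0)"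
  define L where "L = Matrix.mat (Suc m) (Suc m)
    (\<lambda>(i, j). if i = 0 then v j else if j = 0 then 0 else G $$ (i - 1, j - 1))"
  have K: "K \<in> carrier_mat (Suc m) (Suc m)" and L: "L \<in> carrier_mat (Suc m) (Suc m)"
    by (simp_all add: K_def L_def)
  have "A = K * L"
  proof (rule eq_matI)
    fix i j assume "i < dim_row (K * L)" "j < dim_col (K * L)"
    then have ij: "i < Suc m" "j < Suc m" by (simp_all add: K_def L_def)
    have "(K * L) $$ (i, j) = (\<Sum>t<Suc m. K $$ (i, t) * L $$ (t, j))"
      using ij K L by (simp add: scalar_prod_def lessThan_atLeast0 del: sum.lessThan_Suc)
    also have "\<dots> = u i * v j + (\<Sum>t<m. K $$ (i, Suc t) * L $$ (Suc t, j))"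
      unfolding sum.lessThan_Suc_shift using ij by (simp add: K_def L_def)
    also have "(\<Sum>t<m. K $$ (i, Suc t) * L $$ (Suc t, j))
        = (\<Sum>t<m. if t = i - 1 then (if i = 0 \<or> j = 0 then 0 else G $$ (i - 1, j - 1)) else 0)"
      by (rule sum.cong[OF refl]) (use ij in \<open>auto simp: K_def L_def\<close>)
    also have "\<dots> = (if i = 0 \<or> j = 0 then 0 else G $$ (i - 1, j - 1))"
      using ij by (auto simp: sum.delta)
    finally show "A $$ (i, j) = (K * L) $$ (i, j)" using ent[OF ij] by simp
  qed (use A K L in auto)
  then have "det A = det K * det L"
    using det_mult[OF K L] by simp
  moreover have "det K = u 0"
  proof -
    have "det K = prod_list (diag_mat K)"
      by (rule det_lower_triangular[OF _ K]) (auto simp: K_def)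
    also have "\<dots> = (\<Prod>i\<in>{0..<Suc m}. K $$ (i, i))"
      using K by (simp add: prod_list_diag_prod)
    also have "\<dots> = u 0 * (\<Prod>i\<in>{0..<m}. K $$ (Suc i, Suc i))"
      unfolding prod.atLeast0_lessThan_Suc_shift by (simp add: K_def)
    also have "\<dots> = u 0" by (simp add: K_def)
    finally show ?thesis .
  qed
  moreover have "det L = v 0 * det G"
  proof -
    have "det L = (\<Sum>i<Suc m. L $$ (i, 0) * cofactor L i 0)"
      by (rule laplace_expansion_column[OF L]) simp
    also have "\<dots> = v 0 * cofactor L 0 0"
      unfolding sum.lessThan_Suc_shift by (simp add: L_def)
    also have "mat_delete L 0 0 = G"
      using G by (intro eq_matI) (auto simp: L_def mat_delete_def)
    then have "cofactor L 0 0 = det G" by (simp add: cofactor_def)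
    finally show ?thesis .
  qed
  ultimately show ?thesis by simp
qed

lemma det_gram_mat_step:
  assumes "coeff d 0 = 1"
  shows "det (gram_mat (pCons 0 c) d (Suc m)) = det (gram_mat c d m)"
proof -
  have "det (gram_mat (pCons 0 c) d (Suc m))
      = cnj (coeff d 0) * coeff d 0 * det (gram_mat c d m)"
  proof (rule det_schur_first)
    fix i j assume ij: "i < Suc m" "j < Suc m"
    let ?c = "coeff (pCons 0 c)" and ?d = "coeff d"
    show "gram_mat (pCons 0 c) d (Suc m) $$ (i, j) = cnj (coeff d i) * coeff d j +
        (if i = 0 \<or> j = 0 then 0 else gram_mat c d m $$ (i - 1, j - 1))"
    proof (cases "i = 0 \<or> j = 0")
      case True
      then show ?thesis using ij by (auto simp: gram_mat_def)
    next
      case False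
      then obtain i' j' where e: "i = Suc i'" "j = Suc j'" by (metis not0_implies_Suc)
      have "gram_mat (pCons 0 c) d (Suc m) $$ (i, j)
          = (\<Sum>l\<le>Suc (min i' j'). cnj (?d (i - l)) * ?d (j - l)) +
            (\<Sum>l\<le>Suc (min i' j'). cnj (?c (i - l)) * ?c (j - l))"
        using ij e by (simp add: gram_mat_def sum.distrib)
      also have "(\<Sum>l\<le>Suc (min i' j'). cnj (?d (i - l)) * ?d (j - l))
          = cnj (?d i) * ?d j + (\<Sum>l\<le>min i' j'. cnj (?d (i' - l)) * ?d (j' - l))"
        unfolding sum.atMost_Suc_shift e by simp
      also have "(\<Sum>l\<le>Suc (min i' j'). cnj (?c (i - l)) * ?c (j - l))
          = (\<Sum>l\<le>min i' j'. cnj (coeff c (i' - l)) * coeff c (j' - l))"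
      proof -
        \<comment> \<open>The constant coefficient of \<open>pCons 0 c\<close> is 0, so
          \<open>c\<close> contributes no additional term; \<open>d\<close> does, and its additional
          term is the rank one part.\<close>
        have "i - Suc (min i' j') = 0 \<or> j - Suc (min i' j') = 0" using e by auto
        then have "cnj (?c (i - Suc (min i' j'))) * ?c (j - Suc (min i' j')) = 0" by auto
        then have "(\<Sum>l\<le>Suc (min i' j'). cnj (?c (i - l)) * ?c (j - l))
            = (\<Sum>l\<le>min i' j'. cnj (?c (i - l)) * ?c (j - l))"
          unfolding sum.atMost_Suc by simp
        also have "\<dots> = (\<Sum>l\<le>min i' j'. cnj (coeff c (i' - l)) * coeff c (j' - l))"
          by (rule sum.cong[OF refl]) (simp add: e Suc_diff_le)
        finally show ?thesis .
      qed
      finally show ?thesis using e ij by (simp add: gram_mat_def sum.distrib)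
    qed
  qed simp_all
  then show ?thesis using assms by simp
qed

lemma det_gram_shift:
  "det (gram_mat (C_poly m (Suc k) \<zeta> - smult (cnj (\<zeta> k)) (D_poly m (Suc k) \<zeta>))
      (D_poly (Suc m) k \<zeta>) m)
   = of_real ((1 + (cmod (\<zeta> k))\<^sup>2) ^ m) * det (gram_mat (C_poly m (Suc k) \<zeta>) (D_poly m (Suc k) \<zeta>) m)"
  unfolding D_poly.simps gram_mat_rotate det_smult of_real_power of_real_one_plus_cmod_sq
  by (simp add: carrier_matD[OF gram_mat_carrier])

text \<open>The power of N is there because the two polynomials lack the normalisation 1 / sqrt
  N.\<close>

lemma det_gram_mat_eq_W:
  "det (gram_mat (C_poly m k \<zeta>) (D_poly m k \<zeta>) m)
     = of_real (N_prod m k \<zeta> ^ m / W_prod m k \<zeta>)"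
proof (induction m arbitrary: k)
  case 0
  show ?case using gram_mat_carrier[of 0 1 0] by (simp add: W_prod_def)
next
  case (Suc m)
  have "det (gram_mat (C_poly (Suc m) k \<zeta>) (D_poly (Suc m) k \<zeta>) (Suc m))
      = of_real ((1 + (cmod (\<zeta> k))\<^sup>2) ^ m) * of_real (N_prod m (Suc k) \<zeta> ^ m / W_prod m (Suc k) \<zeta>)"
    unfolding C_poly.simps det_gram_mat_step[OF coeff_D_poly_0] det_gram_shift Suc ..
  also have "\<dots> = of_real (N_prod (Suc m) k \<zeta> ^ Suc m / W_prod (Suc m) k \<zeta>)"
  proof -
    define a b W where "a = N_prod m (Suc k) \<zeta>" and "b = 1 + (cmod (\<zeta> k))\<^sup>2" and "W = W_prod m (Suc k) \<zeta>"
    have "a * b \<noteq> 0" "W \<noteq> 0"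
      using N_prod_pos[of "Suc m" k \<zeta>] W_prod_pos[of m "Suc k" \<zeta>] by (auto simp: a_def b_def W_def)
    then have "b ^ m * (a ^ m / W) = (a * b) ^ Suc m / (a * b * W)"
      by (simp add: power_mult_distrib)
    then have "(1 + (cmod (\<zeta> k))\<^sup>2) ^ m * (N_prod m (Suc k) \<zeta> ^ m / W_prod m (Suc k) \<zeta>)
        = N_prod (Suc m) k \<zeta> ^ Suc m / W_prod (Suc m) k \<zeta>"
      unfolding W_prod_Suc N_prod.simps a_def b_def W_def .
    then show ?thesis by (simp only: of_real_mult[symmetric])
  qed
  finally show ?case .
qed

section \<open>Fredholm determinants of finite rank perturbations\<close>

text \<open>An enumeration of \<open>F\<close> turns the Leibniz sum over an unordered index set
  into a matrix determinant; carrying a permutation along a bijection preserves its sign.\<close>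

lemma sum_permutes_eq_det:
  fixes f :: "'a \<Rightarrow> 'a \<Rightarrow> complex"
  assumes q: "bij_betw q {0..<n} F"
  shows "(\<Sum>p | p permutes F. of_int (sign p) * (\<Prod>s\<in>F. f s (p s)))
    = det (Matrix.mat n n (\<lambda>(i, j). f (q i) (q j)))"
proof -
  let ?A = "{0..<n}"
  have inj: "inj_on q ?A" and qA: "q ` ?A = F" using q by (auto simp: bij_betw_def)
  have q': "bij_betw (inv_into ?A q) F ?A" by (rule bij_betw_inv_into[OF q])
  have "det (Matrix.mat n n (\<lambda>(i, j). f (q i) (q j)))
      = (\<Sum>p | p permutes ?A. of_int (sign p) * (\<Prod>i\<in>?A. f (q i) (q (p i))))"
  proof -
    have "(\<Prod>i\<in>?A. Matrix.mat n n (\<lambda>(i, j). f (q i) (q j)) $$ (i, p i)) = (\<Prod>i\<in>?A. f (q i) (q (p i)))"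
      if "p permutes ?A" for p
      by (rule prod.cong[OF refl]) (use permutes_in_image[OF that] in auto)
    then show ?thesis by (subst det_def'[of _ n]) (auto intro!: sum.cong)
  qed
  also have "\<dots> = (\<Sum>p | p permutes F. of_int (sign p) * (\<Prod>s\<in>F. f s (p s)))"
  proof (rule sum.reindex_bij_witness[where j = "map_permutation ?A q"
        and i = "map_permutation F (inv_into ?A q)"])
    fix p assume "p \<in> {p. p permutes ?A}"
    then have p: "p permutes ?A" by simp
    show "map_permutation ?A q p \<in> {p. p permutes F}"
      using map_permutation_permutes[OF q p] by simp
    show "map_permutation F (inv_into ?A q) (map_permutation ?A q p) = p"
      using map_permutation_compose_inv[OF q p] inj by (simp add: qA)
    have "(\<Prod>s\<in>F. f s (map_permutation ?A q p s)) = (\<Prod>i\<in>?A. f (q i) (map_permutation ?A q p (q i)))"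
      using prod.reindex[OF inj] qA by (metis (no_types, lifting) comp_apply prod.cong)
    also have "\<dots> = (\<Prod>i\<in>?A. f (q i) (q (p i)))"
      by (rule prod.cong[OF refl]) (simp add: map_permutation_apply[OF inj])
    finally show "of_int (sign (map_permutation ?A q p)) * (\<Prod>s\<in>F. f s (map_permutation ?A q p s))
        = of_int (sign p) * (\<Prod>i\<in>?A. f (q i) (q (p i)))"
      by (simp add: sign_map_permutation[OF inj p])
  next
    fix p assume "p \<in> {p. p permutes F}"
    then have p: "p permutes F" by simp
    show "map_permutation F (inv_into ?A q) p \<in> {p. p permutes ?A}"
      using map_permutation_permutes[OF q' p] by simp
    show "map_permutation ?A q (map_permutation F (inv_into ?A q) p) = p"
      by (rule map_permutation_compose_inv[OF q' p], rule f_inv_into_f) (simp add: qA)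
  qed
  finally show ?thesis by simp
qed

text \<open>The expansion of det (1 + T) into principal minors: when the product is multiplied out,
  a permutation contributes to the subset \<open>S\<close> only if it fixes every point of
  \<open>F - S\<close>.\<close>

lemma sum_principal_minors:
  fixes T :: "'a \<Rightarrow> 'a \<Rightarrow> complex"
  assumes F: "finite F"
  shows "(\<Sum>S\<in>Pow F. \<Sum>p | p permutes S. of_int (sign p) * (\<Prod>s\<in>S. T s (p s)))
    = (\<Sum>p | p permutes F. of_int (sign p) * (\<Prod>s\<in>F. (if s = p s then 1 else 0) + T s (p s)))"
proof -
  define I where "I = (\<lambda>S p. \<Prod>s\<in>F - S. if s = p s then 1 else 0 :: complex)"
  define G where "G = (\<lambda>S p. of_int (sign p) * ((\<Prod>s\<in>S. T s (p s)) * I S p))"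
  have "(\<Sum>p | p permutes F. of_int (sign p) * (\<Prod>s\<in>F. (if s = p s then 1 else 0) + T s (p s)))
      = (\<Sum>p | p permutes F. \<Sum>S\<in>Pow F. G S p)"
  proof (rule sum.cong[OF refl])
    fix p
    show "of_int (sign p) * (\<Prod>s\<in>F. (if s = p s then 1 else 0) + T s (p s)) = (\<Sum>S\<in>Pow F. G S p)"
      using prod_add[OF F, of "\<lambda>s. T s (p s)" "\<lambda>s. if s = p s then 1 else 0"]
      by (simp add: G_def I_def add.commute sum_distrib_left[symmetric])
  qed
  also have "\<dots> = (\<Sum>S\<in>Pow F. \<Sum>p | p permutes F. G S p)" by (rule sum.swap)
  also have "\<dots> = (\<Sum>S\<in>Pow F. \<Sum>p | p permutes S. of_int (sign p) * (\<Prod>s\<in>S. T s (p s)))"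
  proof (rule sum.cong[OF refl])
    fix S assume "S \<in> Pow F"
    then have S: "S \<subseteq> F" by simp
    have "(\<Sum>p | p permutes F. G S p) = (\<Sum>p | p permutes S. G S p)"
    proof (rule sum.mono_neutral_right)
      show "{p. p permutes S} \<subseteq> {p. p permutes F}" using permutes_subset S by blast
      show "\<forall>p\<in>{p. p permutes F} - {p. p permutes S}. G S p = 0"
      proof
        fix p assume "p \<in> {p. p permutes F} - {p. p permutes S}"
        then have p: "p permutes F" "\<not> p permutes S" by auto
        then obtain s where "s \<in> F - S" "p s \<noteq> s" using permutes_superset by blast
        then have "\<exists>s\<in>F - S. (if s = p s then 1 else 0 :: complex) = 0"
          by (intro bexI[of _ s]) auto
        then have "I S p = 0" unfolding I_def using F by (intro prod_zero) simp_all
        then show "G S p = 0" by (simp add: G_def)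
      qed
    qed (use F finite_permutations in auto)
    also have "\<dots> = (\<Sum>p | p permutes S. of_int (sign p) * (\<Prod>s\<in>S. T s (p s)))"
    proof (rule sum.cong[OF refl])
      fix p assume "p \<in> {p. p permutes S}"
      then have "I S p = 1" unfolding I_def by (intro prod.neutral) (auto simp: permutes_not_in)
      then show "G S p = of_int (sign p) * (\<Prod>s\<in>S. T s (p s))" by (simp add: G_def)
    qed
    finally show "(\<Sum>p | p permutes F. G S p) = (\<Sum>p | p permutes S. of_int (sign p) * (\<Prod>s\<in>S. T s (p s)))" .
  qed
  finally show ?thesis by simp
qed

text \<open>A finite set not contained in \<open>F\<close> meets a zero row of \<open>T\<close>, so
  the series of the Fredholm determinant is a finite sum.\<close>

lemma infsum_principal_minors:
  fixes T :: "'a \<Rightarrow> 'a \<Rightarrow> complex"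
  assumes F: "finite F" and zero: "\<And>r s. r \<notin> F \<Longrightarrow> T r s = 0"
  shows "(\<Sum>\<^sub>\<infinity>S\<in>{S. finite S}. \<Sum>p | p permutes S. of_int (sign p) * (\<Prod>s\<in>S. T s (p s)))
    = (\<Sum>p | p permutes F. of_int (sign p) * (\<Prod>s\<in>F. (if s = p s then 1 else 0) + T s (p s)))"
proof -
  have "(\<Sum>\<^sub>\<infinity>S\<in>{S. finite S}. \<Sum>p | p permutes S. of_int (sign p) * (\<Prod>s\<in>S. T s (p s)))
      = (\<Sum>\<^sub>\<infinity>S\<in>Pow F. \<Sum>p | p permutes S. of_int (sign p) * (\<Prod>s\<in>S. T s (p s)))"
  proof (rule infsum_cong_neutral)
    fix S assume "S \<in> {S. finite S} - Pow F"
    then obtain s where s: "finite S" "s \<in> S" "s \<notin> F" by auto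
    then have "(\<Prod>s\<in>S. T s (p s)) = 0" for p using zero by (intro prod_zero) auto
    then show "(\<Sum>p | p permutes S. of_int (sign p) * (\<Prod>s\<in>S. T s (p s))) = 0" by simp
  qed (use F finite_subset in auto)
  also have "\<dots> = (\<Sum>S\<in>Pow F. \<Sum>p | p permutes S. of_int (sign p) * (\<Prod>s\<in>S. T s (p s)))"
    using F by (intro infsum_finite) simp
  finally show ?thesis unfolding sum_principal_minors[OF F] .
qed

text \<open>Multiplying the block matrix \<open>?M\<close> by the unipotent \<open>?L\<close> on the
  right or on the left clears a different block, and both products have the same
  determinant.\<close>

lemma det_one_minus_mult_commute:
  fixes X Y :: "complex Matrix.mat"
  assumes X: "X \<in> carrier_mat n m" and Y: "Y \<in> carrier_mat m n"
  shows "det (1\<^sub>m n - X * Y) = det (1\<^sub>m m - Y * X)"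
proof -
  let ?M = "four_block_mat (1\<^sub>m n) X Y (1\<^sub>m m)"
  let ?L = "four_block_mat (1\<^sub>m n) (0\<^sub>m n m) (- Y) (1\<^sub>m m)"
  have XY: "X * Y \<in> carrier_mat n n" and YX: "Y * X \<in> carrier_mat m m" using X Y by auto
  have M: "?M \<in> carrier_mat (n + m) (n + m)" and L: "?L \<in> carrier_mat (n + m) (n + m)"
    using X Y by auto
  have nX: "- Y * X = - (Y * X)" and nY: "X * (- Y) = - (X * Y)"
    by (rule eq_matI; use X Y in \<open>simp add: scalar_prod_def sum_negf\<close>)+
  have e1: "1\<^sub>m n * 1\<^sub>m n + X * (- Y) = 1\<^sub>m n - X * Y" "1\<^sub>m n * 0\<^sub>m n m + X * 1\<^sub>m m = X"
    "Y * 1\<^sub>m n + 1\<^sub>m m * (- Y) = 0\<^sub>m m n" "Y * 0\<^sub>m n m + 1\<^sub>m m * 1\<^sub>m m = 1\<^sub>m m"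
    subgoal unfolding nY using XY by (intro eq_matI) simp_all
    subgoal using X by (intro eq_matI) simp_all
    subgoal using Y by (intro eq_matI) simp_all
    subgoal using Y by (intro eq_matI) simp_all
    done
  have e2: "1\<^sub>m n * 1\<^sub>m n + 0\<^sub>m n m * Y = 1\<^sub>m n" "1\<^sub>m n * X + 0\<^sub>m n m * 1\<^sub>m m = X"
    "- Y * 1\<^sub>m n + 1\<^sub>m m * Y = 0\<^sub>m m n" "- Y * X + 1\<^sub>m m * 1\<^sub>m m = 1\<^sub>m m - Y * X"
    subgoal using Y by (intro eq_matI) simp_all
    subgoal using X by (intro eq_matI) simp_all
    subgoal using Y by (intro eq_matI) simp_all
    subgoal
    proof -
      have "- Z + 1\<^sub>m m * 1\<^sub>m m = 1\<^sub>m m - Z" if "Z \<in> carrier_mat m m" for Z :: "complex Matrix.mat"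
        by (rule eq_matI) (use that in auto)
      then show ?thesis unfolding nX using YX by blast
    qed
    done
  have "?M * ?L = four_block_mat (1\<^sub>m n * 1\<^sub>m n + X * (- Y)) (1\<^sub>m n * 0\<^sub>m n m + X * 1\<^sub>m m)
      (Y * 1\<^sub>m n + 1\<^sub>m m * (- Y)) (Y * 0\<^sub>m n m + 1\<^sub>m m * 1\<^sub>m m)"
    by (rule mult_four_block_mat[where ?nr1.0 = n and ?n1.0 = n and ?n2.0 = m and ?nr2.0 = m
          and ?nc1.0 = n and ?nc2.0 = m]) (simp_all add: X Y)
  then have 1: "?M * ?L = four_block_mat (1\<^sub>m n - X * Y) X (0\<^sub>m m n) (1\<^sub>m m)"
    by (simp only: e1)
  have "?L * ?M = four_block_mat (1\<^sub>m n * 1\<^sub>m n + 0\<^sub>m n m * Y) (1\<^sub>m n * X + 0\<^sub>m n m * 1\<^sub>m m)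
      (- Y * 1\<^sub>m n + 1\<^sub>m m * Y) (- Y * X + 1\<^sub>m m * 1\<^sub>m m)"
    by (rule mult_four_block_mat[where ?nr1.0 = n and ?n1.0 = n and ?n2.0 = m and ?nr2.0 = m
          and ?nc1.0 = n and ?nc2.0 = m]) (simp_all add: X Y)
  then have 2: "?L * ?M = four_block_mat (1\<^sub>m n) X (0\<^sub>m m n) (1\<^sub>m m - Y * X)"
    by (simp only: e2)
  have "det (?M * ?L) = det (1\<^sub>m n - X * Y)"
    unfolding 1 using det_four_block_mat_lower_left_zero[OF minus_carrier_mat[OF XY] X refl one_carrier_mat]
    by simp
  moreover have "det (?L * ?M) = det (1\<^sub>m m - Y * X)"
    unfolding 2 using det_four_block_mat_lower_left_zero[OF one_carrier_mat X refl minus_carrier_mat[OF YX]]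
    by simp
  moreover have "det (?M * ?L) = det (?L * ?M)"
    unfolding det_mult[OF M L] det_mult[OF L M] by (rule mult.commute)
  ultimately show ?thesis by simp
qed

section \<open>Toeplitz operators on the Hardy space\<close>

lemma space_circle_measure: "space circle_measure = circle"
  by (simp add: circle_measure_def space_restrict_space)

lemma sets_circle_measure: "sets circle_measure = sets (restrict_space borel circle)"
  by (simp add: circle_measure_def)

lemma borel_measurable_circle_measure_continuous:
  "continuous_on circle f \<Longrightarrow> f \<in> borel_measurable circle_measure"
  unfolding measurable_cong_sets[OF sets_circle_measure refl]
  by (rule borel_measurable_continuous_on_restrict)

lemma cis_measurable_circle:
  "cis \<in> uniform_measure lborel {0..2 * pi} \<rightarrow>\<^sub>M restrict_space borel circle"
proof (rule measurable_restrict_space2)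
  have "continuous_on UNIV cis" by (intro continuous_intros)
  then have "cis \<in> borel_measurable borel" by (rule borel_measurable_continuous_onI)
  then show "cis \<in> borel_measurable (uniform_measure lborel {0..2 * pi})"
    by (simp cong: measurable_cong_sets)
qed auto

lemma finite_measure_circle_measure: "finite_measure circle_measure"
proof (rule finite_measureI)
  have "emeasure circle_measure (space circle_measure)
      = emeasure (uniform_measure lborel {0..2 * pi}) UNIV"
    unfolding circle_measure_def
    using sets.top[of "restrict_space borel circle"]
    by (subst emeasure_distr[OF cis_measurable_circle])
       (auto simp: space_restrict_space vimage_def)
  also have "\<dots> = ennreal (2 * pi) / ennreal (2 * pi)"
    by (subst emeasure_uniform_measure) auto
  also have "\<dots> \<noteq> \<infinity>"
    by (simp add: ennreal_divide_eq_top_iff)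
  finally show "emeasure circle_measure (space circle_measure) \<noteq> \<infinity>" .
qed

lemma uniform_measure_interval_density:
  "uniform_measure lborel {0..2 * pi} = density lborel (\<lambda>x. ennreal (indicator {0..2 * pi} x / (2 * pi)))"
  unfolding uniform_measure_def
  by (rule arg_cong[where f = "density lborel"])
     (auto simp: fun_eq_iff indicator_def divide_ennreal[symmetric] ennreal_1[symmetric] simp del: ennreal_1)

lemma integral_circle_powi:
  "(LINT z|circle_measure. z powi k) = (if k = 0 then 1 else 0)"
proof -
  have cont: "continuous_on circle (\<lambda>z::complex. z powi k)"
    by (intro continuous_intros) auto
  have "(LINT z|circle_measure. z powi k) = (LINT t|uniform_measure lborel {0..2 * pi}. cis t powi k)"
    unfolding circle_measure_def
    by (rule integral_distr[OF cis_measurable_circle])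
       (rule borel_measurable_continuous_on_restrict[OF cont])
  also have "\<dots> = (LINT t|lborel. (indicator {0..2 * pi} t / (2 * pi)) *\<^sub>R exp (\<i> * of_int k * of_real t))"
  proof -
    have e: "cis t powi k = exp (\<i> * of_int k * of_real t)" for t
    proof -
      have "cis t powi k = cis (of_int k * t)" by (rule cis_power_int)
      then show ?thesis by (simp add: cis_conv_exp mult_ac)
    qed
    have "continuous_on UNIV (\<lambda>t. exp (\<i> * of_int k * complex_of_real t))"
      by (intro continuous_intros)
    then have "(\<lambda>t. exp (\<i> * of_int k * complex_of_real t)) \<in> borel_measurable lborel"
      by (simp add: borel_measurable_continuous_onI)
    then show ?thesis unfolding e uniform_measure_interval_density
      by (subst integral_density) auto
  qed
  also have "\<dots> = (LINT t|lborel. indicator {0..2 * pi} t *\<^sub>R exp (\<i> * of_int k * of_real t)) / of_real (2 * pi)"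
  proof -
    have "(indicator {0..2 * pi} t / (2 * pi)) *\<^sub>R exp (\<i> * of_int k * of_real t)
        = (indicator {0..2 * pi} t *\<^sub>R exp (\<i> * of_int k * of_real t)) / of_real (2 * pi)" for t
      by (simp add: scaleR_conv_of_real)
    then show ?thesis by (simp only: integral_divide_zero)
  qed
  also have "(LINT t|lborel. indicator {0..2 * pi} t *\<^sub>R exp (\<i> * of_int k * of_real t))
      = (if k = 0 then of_real (2 * pi) else 0)"
  proof (cases "k = 0")
    case True
    have "(LINT t|lborel. indicator {0..2 * pi} t *\<^sub>R (1::complex)) = of_real (2 * pi) - of_real 0"
      by (rule integral_FTC_Icc) (auto intro!: derivative_eq_intros has_vector_derivative_of_real continuous_intros)
    then show ?thesis using True by simp
  next
    case False
    let ?F = "\<lambda>t::real. exp (\<i> * of_int k * of_real t) / (\<i> * of_int k)"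
    have "(LINT t|lborel. indicator {0..2 * pi} t *\<^sub>R exp (\<i> * of_int k * of_real t)) = ?F (2 * pi) - ?F 0"
    proof (rule integral_FTC_Icc)
      fix t :: real
      have "((\<lambda>w. exp (\<i> * of_int k * w) / (\<i> * of_int k)) has_field_derivative
          exp (\<i> * of_int k * of_real t)) (at (of_real t))"
        using False by (auto intro!: derivative_eq_intros)
      then show "(?F has_vector_derivative exp (\<i> * of_int k * of_real t)) (at t within {0..2 * pi})"
        by (rule has_vector_derivative_real_field)
    qed (auto intro!: continuous_intros)
    also have "exp (\<i> * of_int k * of_real (2 * pi)) = 1"
    proof -
      have "exp (\<i> * of_int k * of_real (2 * pi)) = cis (2 * pi * of_int k)"
        by (simp add: cis_conv_exp mult_ac)
      then show ?thesis by (simp add: cis_multiple_2pi)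
    qed
    finally show ?thesis using False by simp
  qed
  finally show ?thesis by simp
qed

lemma borel_measurable_vec_nth:
  "f \<in> borel_measurable M \<Longrightarrow> (\<lambda>x. (f x :: complex^2) $ i) \<in> borel_measurable M"
proof -
  assume f: "f \<in> borel_measurable M"
  have "continuous_on UNIV (\<lambda>v :: complex^2. v $ i)" by (intro continuous_intros)
  then have "(\<lambda>v :: complex^2. v $ i) \<in> borel_measurable borel" by (rule borel_measurable_continuous_onI)
  from measurable_compose[OF f this] show ?thesis .
qed

lemma borel_measurable_vecI:
  fixes f :: "'a \<Rightarrow> complex^2"
  assumes "\<And>i. (\<lambda>x. f x $ i) \<in> borel_measurable M"
  shows "f \<in> borel_measurable M"
  unfolding borel_measurable_euclidean_space[where f = f]
  using assms by (auto simp: Basis_vec_def inner_axis intro!: borel_measurable_inner)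

lemma norm_vec2_sq: "(norm (v :: complex^2))\<^sup>2 = (\<Sum>i\<in>UNIV. (cmod (v $ i))\<^sup>2)"
  by (simp add: norm_vec_def L2_set_def sum_nonneg)

lemma cmod_nth_sq_le: "(cmod ((v :: complex^2) $ i))\<^sup>2 \<le> (norm v)\<^sup>2"
  by (simp add: Finite_Cartesian_Product.norm_nth_le power_mono)

text \<open>A scalar notion, by which membership in \<open>L2_circle\<close> is checked one
  component at a time.\<close>

definition sq_integrable :: "(complex \<Rightarrow> complex) \<Rightarrow> bool" where
  "sq_integrable f \<longleftrightarrow> f \<in> borel_measurable circle_measure \<and>
     integrable circle_measure (\<lambda>z. (cmod (f z))\<^sup>2)"

lemma sq_integrable_bound:
  assumes f: "f \<in> borel_measurable circle_measure" and g: "integrable circle_measure g"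
    and le: "\<And>z. z \<in> circle \<Longrightarrow> (cmod (f z))\<^sup>2 \<le> g z"
  shows "sq_integrable f"
proof -
  have "integrable circle_measure (\<lambda>z. (cmod (f z))\<^sup>2)"
  proof (rule Bochner_Integration.integrable_bound[OF g])
    show "(\<lambda>z. (cmod (f z))\<^sup>2) \<in> borel_measurable circle_measure"
      using f by measurable
    show "AE z in circle_measure. norm ((cmod (f z))\<^sup>2) \<le> norm (g z)"
      using le by (intro AE_I2) (fastforce simp: space_circle_measure)
  qed
  then show ?thesis using f by (simp add: sq_integrable_def)
qed

lemma sq_integrable_add:
  assumes "sq_integrable f" "sq_integrable g"
  shows "sq_integrable (\<lambda>z. f z + g z)"
proof (rule sq_integrable_bound)
  show "(\<lambda>z. f z + g z) \<in> borel_measurable circle_measure"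
    "integrable circle_measure (\<lambda>z. 2 * (cmod (f z))\<^sup>2 + 2 * (cmod (g z))\<^sup>2)"
    using assms by (auto simp: sq_integrable_def)
  fix z
  have "(cmod (f z + g z))\<^sup>2 \<le> (cmod (f z) + cmod (g z))\<^sup>2"
    by (intro power_mono norm_triangle_ineq) simp
  also have "\<dots> \<le> 2 * (cmod (f z))\<^sup>2 + 2 * (cmod (g z))\<^sup>2"
    using zero_le_power2[of "cmod (f z) - cmod (g z)"] by (simp add: power2_eq_square algebra_simps)
  finally show "(cmod (f z + g z))\<^sup>2 \<le> 2 * (cmod (f z))\<^sup>2 + 2 * (cmod (g z))\<^sup>2" .
qed

lemma sq_integrable_mult:
  assumes g: "continuous_on circle g" and f: "sq_integrable f"
  shows "sq_integrable (\<lambda>z. g z * f z)"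
proof -
  have "compact (g ` circle)" by (rule compact_continuous_image[OF g compact_sphere])
  then have "bounded (g ` circle)" by (rule compact_imp_bounded)
  then obtain B where B: "\<And>z. z \<in> circle \<Longrightarrow> cmod (g z) \<le> B"
    unfolding bounded_iff by blast
  show ?thesis
  proof (rule sq_integrable_bound)
    show "(\<lambda>z. g z * f z) \<in> borel_measurable circle_measure"
      "integrable circle_measure (\<lambda>z. B\<^sup>2 * (cmod (f z))\<^sup>2)"
      using f borel_measurable_circle_measure_continuous[OF g] by (auto simp: sq_integrable_def)
    show "(cmod (g z * f z))\<^sup>2 \<le> B\<^sup>2 * (cmod (f z))\<^sup>2" if "z \<in> circle" for z
      unfolding norm_mult power_mult_distrib by (intro mult_right_mono power_mono B[OF that]) auto
  qed
qed

lemma sq_integrable_continuous: "continuous_on circle g \<Longrightarrow> sq_integrable g"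
proof -
  have "sq_integrable (\<lambda>_. 1)"
    using finite_measure.integrable_const[OF finite_measure_circle_measure, of "1::real"]
    by (simp add: sq_integrable_def)
  then show "continuous_on circle g \<Longrightarrow> sq_integrable g"
    using sq_integrable_mult[of g "\<lambda>_. 1"] by simp
qed

lemma L2_circle_iff: "f \<in> L2_circle \<longleftrightarrow> (\<forall>i. sq_integrable (\<lambda>z. f z $ i))"
proof
  assume "f \<in> L2_circle"
  then show "\<forall>i. sq_integrable (\<lambda>z. f z $ i)" unfolding L2_circle_def
    by (auto intro: sq_integrable_bound[OF borel_measurable_vec_nth _ cmod_nth_sq_le])
next
  assume "\<forall>i. sq_integrable (\<lambda>z. f z $ i)"
  then show "f \<in> L2_circle" unfolding L2_circle_def sq_integrable_def norm_vec2_sq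
    by (auto intro!: borel_measurable_vecI)
qed

lemma L2_circle_nth:
  assumes "f \<in> L2_circle"
  shows "(\<lambda>z. f z $ i) \<in> borel_measurable circle_measure"
    "integrable circle_measure (\<lambda>z. (cmod (f z $ i))\<^sup>2)"
  using assms by (auto simp: L2_circle_iff sq_integrable_def)

lemma integrable_L2_mult:
  assumes "f \<in> L2_circle" "h \<in> L2_circle"
  shows "integrable circle_measure (\<lambda>z. f z $ i * cnj (h z $ j))"
proof (rule Bochner_Integration.integrable_bound)
  show "integrable circle_measure (\<lambda>z. (cmod (f z $ i))\<^sup>2 + (cmod (h z $ j))\<^sup>2)"
    by (intro Bochner_Integration.integrable_add L2_circle_nth assms)
  show "(\<lambda>z. f z $ i * cnj (h z $ j)) \<in> borel_measurable circle_measure"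
    by (intro borel_measurable_times L2_circle_nth(1) assms
        measurable_compose[OF L2_circle_nth(1)[OF assms(2)] borel_measurable_continuous_onI])
       (intro continuous_intros)
  have "x * y \<le> x\<^sup>2 + y\<^sup>2" for x y :: real
  proof -
    have "0 \<le> x\<^sup>2 + y\<^sup>2" by simp
    then show ?thesis using sum_squares_bound[of x y] by linarith
  qed
  then show "AE z in circle_measure. norm (f z $ i * cnj (h z $ j)) \<le> norm ((cmod (f z $ i))\<^sup>2 + (cmod (h z $ j))\<^sup>2)"
    by (intro AE_I2) (simp add: norm_mult)
qed

lemma L2_inner_eq:
  assumes "f \<in> L2_circle" "h \<in> L2_circle"
  shows "L2_inner f h = (\<Sum>i\<in>UNIV. LINT z|circle_measure. f z $ i * cnj (h z $ i))"
  unfolding L2_inner_def by (rule Bochner_Integration.integral_sum) (rule integrable_L2_mult[OF assms])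

lemma L2_inner_commute: "L2_inner h f = cnj (L2_inner f h)"
  unfolding L2_inner_def Bochner_Integration.integral_cnj[symmetric] by (simp add: mult.commute)

lemma L2_inner_cong:
  assumes "\<And>z. z \<in> circle \<Longrightarrow> f z = f' z" "\<And>z. z \<in> circle \<Longrightarrow> h z = h' z"
  shows "L2_inner f h = L2_inner f' h'"
  unfolding L2_inner_def
  by (rule Bochner_Integration.integral_cong) (simp_all add: space_circle_measure assms)

lemma L2_circle_mult_continuous:
  assumes "\<And>i j. continuous_on circle (\<lambda>z. g z $ i $ j)" "f \<in> L2_circle"
  shows "(\<lambda>z. g z *v f z) \<in> L2_circle"
  using assms unfolding L2_circle_iff matrix_vector_mult_def
  by (auto simp: sum_2 intro!: sq_integrable_add sq_integrable_mult)

lemma L2_inner_matrix_adjoint: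
  assumes "\<And>z i j. z \<in> circle \<Longrightarrow> gs z $ i $ j = cnj (g z $ j $ i)"
  shows "L2_inner (\<lambda>z. g z *v f z) h = L2_inner f (\<lambda>z. gs z *v h z)"
  unfolding L2_inner_def
proof (rule Bochner_Integration.integral_cong[OF refl])
  fix z assume "z \<in> space circle_measure"
  then have z: "z \<in> circle" by (simp add: space_circle_measure)
  show "(\<Sum>i\<in>UNIV. (g z *v f z) $ i * cnj (h z $ i)) = (\<Sum>i\<in>UNIV. f z $ i * cnj ((gs z *v h z) $ i))"
    by (simp add: matrix_vector_mult_def sum_2 assms[OF z] algebra_simps)
qed

lemma fourier_mode_nth: "fourier_mode k i z $ j = (if i = j then z powi k else 0)"
  by (simp add: fourier_mode_def axis_def)

lemma fourier_mode_L2 [simp]: "fourier_mode k i \<in> L2_circle"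
proof -
  have "continuous_on circle (\<lambda>z. fourier_mode k i z $ j)" for j
    unfolding fourier_mode_nth by (cases "i = j") (auto intro!: continuous_intros)
  then show ?thesis unfolding L2_circle_iff by (blast intro: sq_integrable_continuous)
qed

lemma powi_mult_cnj_powi:
  assumes "z \<in> circle"
  shows "z powi k * cnj (z powi l) = z powi (k - l)"
proof -
  have "cnj (z powi l) = inverse z powi l"
    by (simp add: inverse_eq_cnj[OF assms] complex_cnj_power_int)
  then show ?thesis using circle_nonzero[OF assms]
    by (simp add: power_int_diff power_int_inverse field_simps)
qed

lemma L2_inner_fourier_modes:
  "L2_inner (fourier_mode k i) (fourier_mode l j) = (if k = l \<and> i = j then 1 else 0)"
proof -
  have "L2_inner (fourier_mode k i) (fourier_mode l j)
      = (LINT z|circle_measure. (if i = j then z powi (k - l) else 0))"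
    unfolding L2_inner_def
  proof (rule Bochner_Integration.integral_cong[OF refl])
    fix z assume "z \<in> space circle_measure"
    then have z: "z \<in> circle" by (simp add: space_circle_measure)
    show "(\<Sum>a\<in>UNIV. fourier_mode k i z $ a * cnj (fourier_mode l j z $ a))
        = (if i = j then z powi (k - l) else 0)"
      unfolding fourier_mode_nth powi_mult_cnj_powi[OF z, symmetric]
      by (simp add: if_distrib[of cnj] if_distrib[of "\<lambda>x. _ * x"] if_distrib[of "\<lambda>x. x * _"] sum.delta cong: if_cong)
  qed
  also have "\<dots> = (if k = l \<and> i = j then 1 else 0)"
    by (cases "i = j") (simp_all add: integral_circle_powi)
  finally show ?thesis .
qed

text \<open>Both claims go through one induction, because splitting the inner product requires the
  partial sums to lie in \<open>L2_circle\<close>.\<close>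

lemma L2_circle_diff_sum:
  assumes "finite A" "f \<in> L2_circle" "\<And>a. a \<in> A \<Longrightarrow> F a \<in> L2_circle"
  shows "(\<lambda>z. f z - (\<Sum>a\<in>A. c a *s F a z)) \<in> L2_circle"
    and "h \<in> L2_circle \<Longrightarrow> L2_inner (\<lambda>z. f z - (\<Sum>a\<in>A. c a *s F a z)) h
      = L2_inner f h - (\<Sum>a\<in>A. c a * L2_inner (F a) h)"
proof -
  have "(\<lambda>z. f z - (\<Sum>a\<in>A. c a *s F a z)) \<in> L2_circle \<and> (\<forall>h\<in>L2_circle.
      L2_inner (\<lambda>z. f z - (\<Sum>a\<in>A. c a *s F a z)) h
      = L2_inner f h - (\<Sum>a\<in>A. c a * L2_inner (F a) h))"
    using assms(1,3)
  proof (induction A rule: finite_induct)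
    case empty
    then show ?case using assms(2) by simp
  next
    case (insert b A)
    define u where "u = (\<lambda>z. f z - (\<Sum>a\<in>A. c a *s F a z))"
    have u: "u \<in> L2_circle" and ui: "\<And>h. h \<in> L2_circle \<Longrightarrow>
        L2_inner u h = L2_inner f h - (\<Sum>a\<in>A. c a * L2_inner (F a) h)"
      using insert.IH insert.prems by (auto simp: u_def)
    have b: "F b \<in> L2_circle" using insert.prems by simp
    define w where "w = (\<lambda>z. f z - (\<Sum>a\<in>insert b A. c a *s F a z))"
    have w: "w z $ i = u z $ i - c b * F b z $ i" for z i
      using insert.hyps by (simp add: w_def u_def)
    have wL: "w \<in> L2_circle" unfolding L2_circle_iff
    proof
      fix i
      have "sq_integrable (\<lambda>z. u z $ i + (- c b) * F b z $ i)"
        using u b by (intro sq_integrable_add sq_integrable_mult) (auto simp: L2_circle_iff)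
      then show "sq_integrable (\<lambda>z. w z $ i)" by (simp add: w)
    qed
    have "L2_inner w h = L2_inner f h - (\<Sum>a\<in>insert b A. c a * L2_inner (F a) h)"
      if h: "h \<in> L2_circle" for h
    proof -
      have "L2_inner w h = (\<Sum>i\<in>UNIV. LINT z|circle_measure. u z $ i * cnj (h z $ i) - c b * (F b z $ i * cnj (h z $ i)))"
        unfolding L2_inner_eq[OF wL h] w by (simp add: algebra_simps)
      also have "\<dots> = (\<Sum>i\<in>UNIV. (LINT z|circle_measure. u z $ i * cnj (h z $ i))
          - c b * (LINT z|circle_measure. F b z $ i * cnj (h z $ i)))"
        by (subst Bochner_Integration.integral_diff)
           (auto intro!: integrable_L2_mult u b h integrable_mult_right)
      also have "\<dots> = L2_inner u h - c b * L2_inner (F b) h"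
        unfolding L2_inner_eq[OF u h] L2_inner_eq[OF b h] by (simp add: sum_subtractf sum_distrib_left)
      finally show ?thesis unfolding ui[OF h] using insert.hyps by simp
    qed
    then show ?case using wL unfolding w_def by blast
  qed
  then show "(\<lambda>z. f z - (\<Sum>a\<in>A. c a *s F a z)) \<in> L2_circle"
    "h \<in> L2_circle \<Longrightarrow> L2_inner (\<lambda>z. f z - (\<Sum>a\<in>A. c a *s F a z)) h
      = L2_inner f h - (\<Sum>a\<in>A. c a * L2_inner (F a) h)" by auto
qed

section \<open>The Hardy space and the projection onto it\<close>

lemma hardyD: "f \<in> hardy \<Longrightarrow> f \<in> L2_circle" "f \<in> hardy \<Longrightarrow> k < 0 \<Longrightarrow> L2_inner f (fourier_mode k i) = 0"
  by (simp_all add: hardy_def)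

lemma hardy_basis_in_hardy: "hardy_basis s \<in> hardy"
  by (auto simp: hardy_def hardy_basis_def L2_inner_fourier_modes)

definition neg_modes :: "nat \<Rightarrow> (int \<times> 2) set" where
  "neg_modes K = {- int K..- 1} \<times> UNIV"

text \<open>If all modes below -K vanish, removing finitely many modes already projects onto the
  Hardy space, and no series has to converge.\<close>

definition hardy_proj :: "nat \<Rightarrow> (complex \<Rightarrow> complex^2) \<Rightarrow> complex \<Rightarrow> complex^2" where
  "hardy_proj K h z = h z - (\<Sum>a\<in>neg_modes K.
     L2_inner h (fourier_mode (fst a) (snd a)) *s fourier_mode (fst a) (snd a) z)"

lemma finite_neg_modes [simp]: "finite (neg_modes K)"
  by (simp add: neg_modes_def)

lemma hardy_proj_L2: "h \<in> L2_circle \<Longrightarrow> hardy_proj K h \<in> L2_circle"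
  unfolding hardy_proj_def by (rule L2_circle_diff_sum(1)) auto

lemma L2_inner_hardy_proj:
  assumes "h \<in> L2_circle" "w \<in> L2_circle"
  shows "L2_inner (hardy_proj K h) w = L2_inner h w - (\<Sum>a\<in>neg_modes K.
     L2_inner h (fourier_mode (fst a) (snd a)) * L2_inner (fourier_mode (fst a) (snd a)) w)"
  unfolding hardy_proj_def by (rule L2_circle_diff_sum(2)) (use assms in auto)

lemma hardy_proj_in_hardy:
  assumes h: "h \<in> L2_circle" and low: "\<And>k i. k < - int K \<Longrightarrow> L2_inner h (fourier_mode k i) = 0"
  shows "hardy_proj K h \<in> hardy"
proof -
  have "L2_inner (hardy_proj K h) (fourier_mode k i) = 0" if k: "k < 0" for k i
  proof -
    have "(\<Sum>a\<in>neg_modes K. L2_inner h (fourier_mode (fst a) (snd a)) *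
        L2_inner (fourier_mode (fst a) (snd a)) (fourier_mode k i))
      = (\<Sum>a\<in>neg_modes K. if a = (k, i) then L2_inner h (fourier_mode k i) else 0)"
      by (rule sum.cong[OF refl]) (auto simp: L2_inner_fourier_modes)
    also have "\<dots> = L2_inner h (fourier_mode k i)"
      using low[of k i] k by (cases "k < - int K") (auto simp: neg_modes_def sum.delta)
    finally show ?thesis by (simp add: L2_inner_hardy_proj[OF h])
  qed
  then show ?thesis using hardy_proj_L2[OF h] by (simp add: hardy_def)
qed

lemma L2_inner_hardy_proj_hardy:
  assumes h: "h \<in> L2_circle" and w: "w \<in> hardy"
  shows "L2_inner (hardy_proj K h) w = L2_inner h w"
proof -
  have "L2_inner (fourier_mode (fst a) (snd a)) w = 0" if "a \<in> neg_modes K" for a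
    using hardyD(2)[OF w, of "fst a" "snd a"] that L2_inner_commute[of "fourier_mode (fst a) (snd a)" w]
    by (auto simp: neg_modes_def)
  then show ?thesis by (simp add: L2_inner_hardy_proj[OF h hardyD(1)[OF w]])
qed

lemma L2_inner_diff_left:
  assumes "f \<in> L2_circle" "g \<in> L2_circle" "h \<in> L2_circle"
  shows "L2_inner (\<lambda>z. f z - g z) h = L2_inner f h - L2_inner g h"
  using L2_circle_diff_sum(2)[of "{()}" f "\<lambda>_. g" h "\<lambda>_. 1"] assms by simp

text \<open>\<open>hardy_proj\<close> shows that the choice is not vacuous. The pairing rule is all
  that is kept about the chosen representative.\<close>

lemma P_plus_spec:
  assumes h: "h \<in> L2_circle" and low: "\<And>k i. k < - int K \<Longrightarrow> L2_inner h (fourier_mode k i) = 0"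
  shows "P_plus h \<in> hardy" "w \<in> hardy \<Longrightarrow> L2_inner (P_plus h) w = L2_inner h w"
proof -
  have "\<exists>f. f \<in> hardy \<and> (\<forall>w\<in>hardy. L2_inner (\<lambda>z. h z - f z) w = 0)"
    using hardy_proj_in_hardy[OF assms] L2_inner_hardy_proj_hardy[OF h] hardyD(1)
      L2_inner_diff_left[OF h hardy_proj_L2[OF h]]
    by (intro exI[of _ "hardy_proj K h"]) auto
  then have *: "P_plus h \<in> hardy \<and> (\<forall>w\<in>hardy. L2_inner (\<lambda>z. h z - P_plus h z) w = 0)"
    unfolding P_plus_def by (rule someI_ex)
  then show P: "P_plus h \<in> hardy" by blast
  show "L2_inner (P_plus h) w = L2_inner h w" if "w \<in> hardy"
    using * that L2_inner_diff_left[OF h hardyD(1)[OF P] hardyD(1)[OF that]] by simp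
qed

section \<open>Toeplitz operators, their adjoints and matrix coefficients\<close>

definition banded_on_hardy :: "nat \<Rightarrow> loop \<Rightarrow> bool" where
  "banded_on_hardy K g \<longleftrightarrow> (\<forall>f\<in>hardy. (\<lambda>z. g z *v f z) \<in> L2_circle \<and>
     (\<forall>k i. k < - int K \<longrightarrow> L2_inner (\<lambda>z. g z *v f z) (fourier_mode k i) = 0))"

lemma toeplitz_op_spec:
  assumes g: "banded_on_hardy K g" and f: "f \<in> hardy"
  shows "toeplitz_op g f \<in> hardy"
    "w \<in> hardy \<Longrightarrow> L2_inner (toeplitz_op g f) w = L2_inner (\<lambda>z. g z *v f z) w"
proof -
  have gf: "(\<lambda>z. g z *v f z) \<in> L2_circle"
    and low: "\<And>k i. k < - int K \<Longrightarrow> L2_inner (\<lambda>z. g z *v f z) (fourier_mode k i) = 0"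
    using g f by (auto simp: banded_on_hardy_def)
  show "toeplitz_op g f \<in> hardy"
    "w \<in> hardy \<Longrightarrow> L2_inner (toeplitz_op g f) w = L2_inner (\<lambda>z. g z *v f z) w"
    unfolding toeplitz_op_def using P_plus_spec[OF gf low] by blast+
qed

text \<open>The witness for the choice is the Toeplitz operator of the pointwise adjoint loop, which
  has to be banded for this reason.\<close>

lemma hardy_adjoint_spec:
  assumes g: "banded_on_hardy K g" and gs: "banded_on_hardy K gs"
    and adj: "\<And>z i j. z \<in> circle \<Longrightarrow> gs z $ i $ j = cnj (g z $ j $ i)"
  shows "\<forall>h\<in>hardy. hardy_adjoint (toeplitz_op g) h \<in> hardy"
    "\<forall>f\<in>hardy. \<forall>h\<in>hardy. L2_inner (toeplitz_op g f) h = L2_inner f (hardy_adjoint (toeplitz_op g) h)"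
proof -
  have "L2_inner (toeplitz_op g f) h = L2_inner f (toeplitz_op gs h)" if f: "f \<in> hardy" and h: "h \<in> hardy" for f h
  proof -
    have "L2_inner (toeplitz_op g f) h = L2_inner (\<lambda>z. g z *v f z) h"
      by (rule toeplitz_op_spec(2)[OF g f h])
    also have "\<dots> = L2_inner f (\<lambda>z. gs z *v h z)" by (rule L2_inner_matrix_adjoint[OF adj])
    also have "\<dots> = cnj (L2_inner (\<lambda>z. gs z *v h z) f)" by (rule L2_inner_commute)
    also have "\<dots> = L2_inner f (toeplitz_op gs h)"
      by (simp only: toeplitz_op_spec(2)[OF gs h f, symmetric] L2_inner_commute[of f])
    finally show ?thesis .
  qed
  then have "\<exists>B. (\<forall>h\<in>hardy. B h \<in> hardy) \<and> (\<forall>f\<in>hardy. \<forall>h\<in>hardy. L2_inner (toeplitz_op g f) h = L2_inner f (B h))"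
    using toeplitz_op_spec(1)[OF gs] by blast
  then have "(\<forall>h\<in>hardy. hardy_adjoint (toeplitz_op g) h \<in> hardy) \<and>
     (\<forall>f\<in>hardy. \<forall>h\<in>hardy. L2_inner (toeplitz_op g f) h = L2_inner f (hardy_adjoint (toeplitz_op g) h))"
    unfolding hardy_adjoint_def by (rule someI_ex)
  then show "\<forall>h\<in>hardy. hardy_adjoint (toeplitz_op g) h \<in> hardy"
    "\<forall>f\<in>hardy. \<forall>h\<in>hardy. L2_inner (toeplitz_op g f) h = L2_inner f (hardy_adjoint (toeplitz_op g) h)"
    by blast+
qed

text \<open>Both sides are the inner product of the projections of g e_s and g e_r: the Gram matrix
  of the images minus the part in the negative modes.\<close>

lemma toeplitz_gram_coeff:
  assumes g: "banded_on_hardy K g" and gs: "banded_on_hardy K gs"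
    and adj: "\<And>z i j. z \<in> circle \<Longrightarrow> gs z $ i $ j = cnj (g z $ j $ i)"
  shows "L2_inner ((hardy_adjoint (toeplitz_op g) \<circ> toeplitz_op g) (hardy_basis s)) (hardy_basis r)
    = L2_inner (\<lambda>z. g z *v hardy_basis s z) (\<lambda>z. g z *v hardy_basis r z)
      - (\<Sum>a\<in>neg_modes K. L2_inner (\<lambda>z. g z *v hardy_basis s z) (fourier_mode (fst a) (snd a)) *
          cnj (L2_inner (\<lambda>z. g z *v hardy_basis r z) (fourier_mode (fst a) (snd a))))"
proof -
  let ?A = "toeplitz_op g" and ?e = "hardy_basis"
  let ?u = "\<lambda>s z. g z *v ?e s z"
  note e = hardy_basis_in_hardy
  have u: "?u s \<in> L2_circle"
    and low: "\<And>k i. k < - int K \<Longrightarrow> L2_inner (?u s) (fourier_mode k i) = 0" for s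
    using g e by (auto simp: banded_on_hardy_def)
  note p = hardy_proj_in_hardy[OF u low]
  have "L2_inner ((hardy_adjoint ?A \<circ> ?A) (?e s)) (?e r)
      = cnj (L2_inner (?e r) (hardy_adjoint ?A (?A (?e s))))"
    by (simp add: L2_inner_commute[of _ "?e r"])
  also have "\<dots> = cnj (L2_inner (?A (?e r)) (?A (?e s)))"
    using hardy_adjoint_spec(2)[OF assms] e toeplitz_op_spec(1)[OF g e] by simp
  also have "\<dots> = cnj (L2_inner (?u r) (?A (?e s)))"
    using toeplitz_op_spec[OF g] e by simp
  \<comment> \<open>The chosen representatives are replaced by explicit projections one argument at
    a time, each time against a Hardy function in the other argument.\<close>
  also have "\<dots> = cnj (L2_inner (hardy_proj K (?u r)) (?A (?e s)))"
    using L2_inner_hardy_proj_hardy[OF u] toeplitz_op_spec(1)[OF g e] by simp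
  also have "\<dots> = L2_inner (?A (?e s)) (hardy_proj K (?u r))"
    by (rule L2_inner_commute[symmetric])
  also have "\<dots> = L2_inner (?u s) (hardy_proj K (?u r))"
    by (rule toeplitz_op_spec(2)[OF g e p])
  also have "\<dots> = L2_inner (hardy_proj K (?u s)) (hardy_proj K (?u r))"
    by (rule L2_inner_hardy_proj_hardy[OF u p, symmetric])
  also have "\<dots> = cnj (L2_inner (hardy_proj K (?u r)) (hardy_proj K (?u s)))"
    by (rule L2_inner_commute)
  also have "\<dots> = cnj (L2_inner (?u r) (hardy_proj K (?u s)))"
    by (simp add: L2_inner_hardy_proj_hardy[OF u p])
  also have "\<dots> = L2_inner (hardy_proj K (?u s)) (?u r)"
    by (rule L2_inner_commute[symmetric])
  also have "\<dots> = L2_inner (?u s) (?u r) - (\<Sum>a\<in>neg_modes K.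
      L2_inner (?u s) (fourier_mode (fst a) (snd a)) * L2_inner (fourier_mode (fst a) (snd a)) (?u r))"
    by (rule L2_inner_hardy_proj[OF u u])
  finally show ?thesis
    by (simp only: L2_inner_commute[of "fourier_mode k i" for k i])
qed

section \<open>Laurent polynomial loops\<close>

definition laurent_loop :: "nat \<Rightarrow> (2 \<Rightarrow> 2 \<Rightarrow> int \<Rightarrow> complex) \<Rightarrow> loop \<Rightarrow> bool" where
  "laurent_loop K gh g \<longleftrightarrow> (\<forall>z\<in>circle. \<forall>i j. g z $ i $ j = (\<Sum>l\<in>{- int K..int K}. gh i j l * z powi l))"

lemma laurent_loop_continuous:
  assumes "laurent_loop K gh g"
  shows "continuous_on circle (\<lambda>z. g z $ i $ j)"
proof -
  have "continuous_on circle (\<lambda>z. \<Sum>l\<in>{- int K..int K}. gh i j l * z powi l)"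
    by (intro continuous_intros) auto
  then show ?thesis
    by (rule continuous_on_eq) (use assms in \<open>simp add: laurent_loop_def\<close>)
qed

lemma laurent_loop_adjoint:
  assumes "laurent_loop K gh g" "\<And>z i j. z \<in> circle \<Longrightarrow> gs z $ i $ j = cnj (g z $ j $ i)"
  shows "laurent_loop K (\<lambda>i j l. cnj (gh j i (- l))) gs"
  unfolding laurent_loop_def
proof (intro ballI allI)
  fix z i j assume z: "z \<in> circle"
  have c: "cnj (z powi l) = z powi (- l)" for l
    using powi_mult_cnj_powi[OF z, of 0 l] by simp
  have "gs z $ i $ j = (\<Sum>l\<in>{- int K..int K}. cnj (gh j i l) * z powi (- l))"
    using assms z by (simp add: laurent_loop_def c[unfolded complex_cnj_power_int])
  also have "\<dots> = (\<Sum>l\<in>{- int K..int K}. cnj (gh j i (- l)) * z powi l)"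
    by (rule sum.reindex_bij_witness[of _ uminus uminus]) auto
  finally show "gs z $ i $ j = (\<Sum>l\<in>{- int K..int K}. cnj (gh j i (- l)) * z powi l)" .
qed

text \<open>The Fourier coefficients of a product are a convolution, here a finite one, so sum and
  integral may be exchanged.\<close>

lemma laurent_loop_mode:
  assumes g: "laurent_loop K gh g" and f: "f \<in> L2_circle"
  shows "L2_inner (\<lambda>z. g z *v f z) (fourier_mode k i)
    = (\<Sum>j\<in>UNIV. \<Sum>l\<in>{- int K..int K}. gh i j l * L2_inner f (fourier_mode (k - l) j))"
proof -
  have mode: "L2_inner h (fourier_mode k j) = (LINT z|circle_measure. h z $ j * cnj (z powi k))" for h k j
    unfolding L2_inner_def fourier_mode_nth
    by (rule Bochner_Integration.integral_cong[OF refl])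
       (simp add: if_distrib[of cnj] if_distrib[of "\<lambda>x. _ * x"] sum.delta cong: if_cong)
  have int: "integrable circle_measure (\<lambda>z. f z $ j * cnj (z powi k))" for j k
    using integrable_L2_mult[OF f fourier_mode_L2[of k j], of j j] by (simp add: fourier_mode_nth)
  have "L2_inner (\<lambda>z. g z *v f z) (fourier_mode k i)
      = (LINT z|circle_measure. (\<Sum>j\<in>UNIV. \<Sum>l\<in>{- int K..int K}. gh i j l * (f z $ j * cnj (z powi (k - l)))))"
    unfolding mode
  proof (rule Bochner_Integration.integral_cong[OF refl])
    fix z assume "z \<in> space circle_measure"
    then have z: "z \<in> circle" by (simp add: space_circle_measure)
    have c: "z powi l * cnj (z powi k) = cnj (z powi (k - l))" for l
    proof -
      have "cnj (z powi (k - l)) = cnj (z powi k * cnj (z powi l))"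
        by (simp only: powi_mult_cnj_powi[OF z])
      then show ?thesis by simp
    qed
    have "(g z *v f z) $ i * cnj (z powi k) = (\<Sum>j\<in>UNIV. g z $ i $ j * f z $ j * cnj (z powi k))"
      by (simp add: matrix_vector_mult_def sum_distrib_right)
    also have "\<dots> = (\<Sum>j\<in>UNIV. \<Sum>l\<in>{- int K..int K}. gh i j l * (f z $ j * (z powi l * cnj (z powi k))))"
      using g z by (simp add: laurent_loop_def sum_distrib_left sum_distrib_right mult_ac)
    finally show "(g z *v f z) $ i * cnj (z powi k)
        = (\<Sum>j\<in>UNIV. \<Sum>l\<in>{- int K..int K}. gh i j l * (f z $ j * cnj (z powi (k - l))))"
      unfolding c .
  qed
  also have "\<dots> = (\<Sum>j\<in>UNIV. \<Sum>l\<in>{- int K..int K}. gh i j l * L2_inner f (fourier_mode (k - l) j))"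
    unfolding mode
    by (subst Bochner_Integration.integral_sum, intro Bochner_Integration.integrable_sum integrable_mult_right int,
        rule sum.cong[OF refl], subst Bochner_Integration.integral_sum, intro integrable_mult_right int,
        rule sum.cong[OF refl], rule integral_mult_right_zero)
  finally show ?thesis .
qed

lemma laurent_loop_banded:
  assumes "laurent_loop K gh g"
  shows "banded_on_hardy K g"
  unfolding banded_on_hardy_def
proof (intro ballI conjI allI impI)
  fix f assume f: "f \<in> hardy"
  show "(\<lambda>z. g z *v f z) \<in> L2_circle"
    by (rule L2_circle_mult_continuous[OF laurent_loop_continuous[OF assms] hardyD(1)[OF f]])
  fix k i assume "k < - int K"
  then show "L2_inner (\<lambda>z. g z *v f z) (fourier_mode k i) = 0"
    unfolding laurent_loop_mode[OF assms hardyD(1)[OF f]]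
    by (intro sum.neutral ballI) (simp add: hardyD(2)[OF f])
qed

text \<open>For \<open>k < 0\<close> the index k - \<open>fst s\<close> cannot exceed K, and below
  -K the coefficients are 0 by assumption, so the formula holds without a case distinction.\<close>

lemma laurent_loop_basis_mode:
  assumes g: "laurent_loop K gh g" and zero: "\<And>i j l. l < - int K \<Longrightarrow> gh i j l = 0"
    and k: "k < 0"
  shows "L2_inner (\<lambda>z. g z *v hardy_basis s z) (fourier_mode k i) = gh i (snd s) (k - int (fst s))"
proof -
  have "L2_inner (\<lambda>z. g z *v hardy_basis s z) (fourier_mode k i)
      = (\<Sum>j\<in>UNIV. \<Sum>l\<in>{- int K..int K}. gh i j l * (if int (fst s) = k - l \<and> snd s = j then 1 else 0))"
    unfolding laurent_loop_mode[OF g hardyD(1)[OF hardy_basis_in_hardy]]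
    by (simp add: hardy_basis_def L2_inner_fourier_modes)
  also have "\<dots> = (\<Sum>j\<in>UNIV. if snd s = j then gh i j (k - int (fst s)) else 0)"
  proof (rule sum.cong[OF refl])
    fix j
    have "(\<Sum>l\<in>{- int K..int K}. gh i j l * (if int (fst s) = k - l \<and> snd s = j then 1 else 0))
        = (\<Sum>l\<in>{- int K..int K}. if l = k - int (fst s) then (if snd s = j then gh i j (k - int (fst s)) else 0) else 0)"
      by (rule sum.cong[OF refl]) auto
    also have "\<dots> = (if snd s = j then gh i j (k - int (fst s)) else 0)"
      using zero[of "k - int (fst s)" i j] k by (auto simp: sum.delta)
    finally show "(\<Sum>l\<in>{- int K..int K}. gh i j l * (if int (fst s) = k - l \<and> snd s = j then 1 else 0))
        = (if snd s = j then gh i j (k - int (fst s)) else 0)" .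
  qed
  also have "\<dots> = gh i (snd s) (k - int (fst s))" by (simp add: sum.delta)
  finally show ?thesis .
qed

section \<open>Toeplitz determinants of the loops\<close>

lemma poly_eq_sum_laurent:
  fixes p :: "complex poly"
  assumes "\<And>i. i > K \<Longrightarrow> coeff p i = 0"
  shows "poly p z = (\<Sum>l\<in>{- int K..int K}. (if 0 \<le> l then coeff p (nat l) else 0) * z powi l)"
proof -
  have "poly p z = (\<Sum>i\<le>degree p. coeff p i * z ^ i)" by (rule poly_altdef)
  also have "\<dots> = (\<Sum>i\<le>K. coeff p i * z ^ i)"
    using degree_le[of K p] assms by (intro sum.mono_neutral_left) (auto simp: coeff_eq_0)
  also have "\<dots> = (\<Sum>l\<in>{0..int K}. (if 0 \<le> l then coeff p (nat l) else 0) * z powi l)"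
    by (rule sum.reindex_bij_witness[of _ nat int]) auto
  also have "\<dots> = (\<Sum>l\<in>{- int K..int K}. (if 0 \<le> l then coeff p (nat l) else 0) * z powi l)"
    by (rule sum.mono_neutral_left) auto
  finally show ?thesis .
qed

lemma cnj_poly_eq_sum_laurent:
  assumes "\<And>i. i > K \<Longrightarrow> coeff p i = 0" and z: "z \<in> circle"
  shows "cnj (poly p z) = (\<Sum>l\<in>{- int K..int K}. (if l \<le> 0 then cnj (coeff p (nat (- l))) else 0) * z powi l)"
proof -
  have c: "cnj (z powi l) = z powi (- l)" for l
    using powi_mult_cnj_powi[OF z, of 0 l] by simp
  have p: "poly p z = (\<Sum>l\<in>{- int K..int K}. (if 0 \<le> l then coeff p (nat l) else 0) * z powi l)"
    by (rule poly_eq_sum_laurent) (rule assms(1))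
  have "cnj (poly p z) = (\<Sum>l\<in>{- int K..int K}. cnj (if 0 \<le> l then coeff p (nat l) else 0) * z powi (- l))"
    unfolding p cnj_sum complex_cnj_mult c by (rule refl)
  also have "\<dots> = (\<Sum>l\<in>{- int K..int K}. (if l \<le> 0 then cnj (coeff p (nat (- l))) else 0) * z powi l)"
    by (rule sum.reindex_bij_witness[of _ uminus uminus]) auto
  finally show ?thesis .
qed

text \<open>General \<open>c\<close> and \<open>d\<close> are allowed because g and the conjugated
  loop in \<sigma>_1 both have this form.\<close>

definition poly_frame :: "complex \<Rightarrow> complex poly \<Rightarrow> complex poly \<Rightarrow> loop" where
  "poly_frame a c d = (\<lambda>z\<in>circle. mat2 (a * cnj (poly d z)) (- (a * cnj (poly c z))) (a * poly c z) (a * poly d z))"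

definition frame_coeff :: "complex \<Rightarrow> complex poly \<Rightarrow> complex poly \<Rightarrow> 2 \<Rightarrow> 2 \<Rightarrow> int \<Rightarrow> complex" where
  "frame_coeff a c d i j l =
     (if i = 1 then (if l \<le> 0 then (if j = 1 then a * cnj (coeff d (nat (- l))) else - (a * cnj (coeff c (nat (- l))))) else 0)
      else (if 0 \<le> l then (if j = 1 then a * coeff c (nat l) else a * coeff d (nat l)) else 0))"

lemma laurent_loop_poly_frame:
  assumes "\<And>i. i > m \<Longrightarrow> coeff c i = 0" "\<And>i. i > m \<Longrightarrow> coeff d i = 0"
  shows "laurent_loop m (frame_coeff a c d) (poly_frame a c d)"
  unfolding laurent_loop_def
proof (intro ballI allI)
  fix z i j assume z: "z \<in> circle"
  have cnj_eq: "cnj (poly p z) = (\<Sum>l\<in>{- int m..int m}. (if l \<le> 0 then cnj (coeff p (nat (- l))) else 0) * z powi l)"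
    and eq: "poly p z = (\<Sum>l\<in>{- int m..int m}. (if 0 \<le> l then coeff p (nat l) else 0) * z powi l)"
    if "p = c \<or> p = d" for p
    using that assms z by (auto intro!: poly_eq_sum_laurent cnj_poly_eq_sum_laurent)
  have "\<forall>i j. poly_frame a c d z $ i $ j = (\<Sum>l\<in>{- int m..int m}. frame_coeff a c d i j l * z powi l)"
    unfolding forall_2 poly_frame_def restrict_apply'[OF z] mat2_nth
    unfolding cnj_eq[OF disjI1[OF refl]] cnj_eq[OF disjI2[OF refl]]
    unfolding eq[OF disjI1[OF refl]] eq[OF disjI2[OF refl]]
    unfolding sum_distrib_left sum_negf[symmetric]
    by (intro conjI sum.cong refl) (simp_all add: frame_coeff_def)
  then show "poly_frame a c d z $ i $ j = (\<Sum>l\<in>{- int m..int m}. frame_coeff a c d i j l * z powi l)" by blast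
qed

text \<open>Row \<open>q\<close> of the Hankel operator H: the mode -(q+1) of the first component of
  g times a basis vector. The second row of g is polynomial and has no negative modes.\<close>

definition neg_row :: "complex \<Rightarrow> complex poly \<Rightarrow> complex poly \<Rightarrow> nat \<Rightarrow> nat \<times> 2 \<Rightarrow> complex" where
  "neg_row a c d q s = (if snd s = 1 then a * cnj (coeff d (Suc (q + fst s))) else - (a * cnj (coeff c (Suc (q + fst s)))))"

text \<open>g is unitary on the circle, so the images of the basis are orthonormal; removing their
  negative modes subtracts \<open>H^* H\<close>.\<close>

lemma matrix_coeff_poly_frame:
  assumes hi: "\<And>i. i > m \<Longrightarrow> coeff c i = 0" "\<And>i. i > m \<Longrightarrow> coeff d i = 0"
    and a: "cnj a = a"
    and unit: "\<And>z. z \<in> circle \<Longrightarrow> a * a * (poly d z * cnj (poly d z) + poly c z * cnj (poly c z)) = 1"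
  shows "matrix_coeff_minus_id (hardy_adjoint (toeplitz_op (poly_frame a c d)) \<circ> toeplitz_op (poly_frame a c d)) r s
    = - (\<Sum>q<m. neg_row a c d q s * cnj (neg_row a c d q r))"
proof -
  define g where "g = poly_frame a c d"
  define gs :: loop where "gs = (\<lambda>z. \<chi> i j. cnj (g z $ j $ i))"
  have L: "laurent_loop m (frame_coeff a c d) g" unfolding g_def by (rule laurent_loop_poly_frame[OF hi])
  have adj: "gs z $ i $ j = cnj (g z $ j $ i)" for z i j by (simp add: gs_def)
  note g_band = laurent_loop_banded[OF L]
  note gs_band = laurent_loop_banded[OF laurent_loop_adjoint[OF L adj]]
  have zero: "frame_coeff a c d i j l = 0" if "l < - int m" for i j l
    using that hi by (simp add: frame_coeff_def)
  note mode = laurent_loop_basis_mode[OF L zero]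
  have orth: "L2_inner (\<lambda>z. g z *v hardy_basis s z) (\<lambda>z. g z *v hardy_basis r z) = (if s = r then 1 else 0)"
  proof -
    have "L2_inner (\<lambda>z. g z *v hardy_basis s z) (\<lambda>z. g z *v hardy_basis r z)
        = L2_inner (hardy_basis s) (\<lambda>z. gs z *v (g z *v hardy_basis r z))"
      by (rule L2_inner_matrix_adjoint) (rule adj)
    also have "\<dots> = L2_inner (hardy_basis s) (hardy_basis r)"
    proof (rule L2_inner_cong)
      fix z :: complex assume z: "z \<in> circle"
      have gz: "g z = mat2 (a * cnj (poly d z)) (- (a * cnj (poly c z))) (a * poly c z) (a * poly d z)"
        using z by (simp add: g_def poly_frame_def)
      have "gs z = mat2 (a * poly d z) (a * cnj (poly c z)) (- (a * poly c z)) (a * cnj (poly d z))"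
        by (rule mat2_eqI) (simp_all add: adj gz a)
      then have "gs z ** g z = mat2 1 0 0 1"
        using unit[OF z] by (simp add: gz algebra_simps)
      then show "gs z *v (g z *v hardy_basis r z) = hardy_basis r z"
        by (simp add: matrix_vector_mul_assoc flip: mat_1_eq_mat2)
    qed simp
    also have "\<dots> = (if s = r then 1 else 0)"
      by (auto simp: hardy_basis_def L2_inner_fourier_modes prod_eq_iff)
    finally show ?thesis .
  qed
  let ?F = "\<lambda>k i s. frame_coeff a c d i (snd s) (k - int (fst s))"
  have "(\<Sum>b\<in>neg_modes m. L2_inner (\<lambda>z. g z *v hardy_basis s z) (fourier_mode (fst b) (snd b)) *
          cnj (L2_inner (\<lambda>z. g z *v hardy_basis r z) (fourier_mode (fst b) (snd b))))
      = (\<Sum>b\<in>neg_modes m. ?F (fst b) (snd b) s * cnj (?F (fst b) (snd b) r))"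
    by (rule sum.cong[OF refl]) (auto simp: mode neg_modes_def)
  also have "\<dots> = (\<Sum>k\<in>{- int m..- 1}. \<Sum>i\<in>UNIV. ?F k i s * cnj (?F k i r))"
    unfolding neg_modes_def by (simp add: sum.cartesian_product split_def)
  also have "\<dots> = (\<Sum>k\<in>{- int m..- 1}. ?F k 1 s * cnj (?F k 1 r))"
    by (rule sum.cong[OF refl]) (auto simp: sum_2 frame_coeff_def)
  also have "\<dots> = (\<Sum>q<m. neg_row a c d q s * cnj (neg_row a c d q r))"
  proof (rule sum.reindex_bij_witness[of _ "\<lambda>q. - int q - 1" "\<lambda>k. nat (- k - 1)"])
    fix k assume k: "k \<in> {- int m..- 1}"
    have e: "Suc (nat (- k - 1) + fst s) = nat (- (k - int (fst s)))" for s :: "nat \<times> 2"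
      using k by auto
    have "neg_row a c d (nat (- k - 1)) s = ?F k 1 s" for s
      unfolding neg_row_def e frame_coeff_def using k by simp
    then show "neg_row a c d (nat (- k - 1)) s * cnj (neg_row a c d (nat (- k - 1)) r) = ?F k 1 s * cnj (?F k 1 r)"
      by simp
  qed auto
  finally show ?thesis
    using toeplitz_gram_coeff[OF g_band gs_band adj, of s r] orth
    by (auto simp: matrix_coeff_minus_id_def g_def)
qed

text \<open>The autocorrelation at lag q' - q is cut at position q: the indices up to q form the
  Toeplitz part, the later ones the Hankel part.\<close>

lemma gram_mat_complement:
  assumes hi: "\<And>i. i > m \<Longrightarrow> coeff c i = 0" "\<And>i. i > m \<Longrightarrow> coeff d i = 0"
    and corr: "\<And>t. (\<Sum>u\<le>m. cnj (coeff d u) * coeff d (u + t) + cnj (coeff c u) * coeff c (u + t)) = (if t = 0 then N else 0)"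
    and N: "cnj N = N" and q: "q < m" "q' < m"
  shows "gram_mat c d m $$ (q, q') = (if q = q' then N else 0) -
    (\<Sum>k<m. cnj (coeff d (Suc (q + k))) * coeff d (Suc (q' + k)) + cnj (coeff c (Suc (q + k))) * coeff c (Suc (q' + k)))"
proof -
  define H where "H = (\<lambda>i j. cnj (coeff d i) * coeff d j + cnj (coeff c i) * coeff c j)"
  have sym: "H j i = cnj (H i j)" for i j by (simp add: H_def mult.commute)
  have main: "(\<Sum>l\<le>p. H (p - l) (p + t - l)) + (\<Sum>k<m. H (Suc (p + k)) (Suc (p + t + k))) = (if t = 0 then N else 0)"
    for p t
  proof -
    have "(\<Sum>l\<le>p. H (p - l) (p + t - l)) = (\<Sum>u\<le>p. H u (u + t))"
      by (rule sum.reindex_bij_witness[of _ "\<lambda>u. p - u" "\<lambda>u. p - u"]) auto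
    moreover have "(\<Sum>k<m. H (Suc (p + k)) (Suc (p + t + k))) = (\<Sum>u\<in>{p<..p + m}. H u (u + t))"
      by (rule sum.reindex_bij_witness[of _ "\<lambda>u. u - Suc p" "\<lambda>k. Suc (p + k)"]) (auto simp: add_ac)
    moreover have "(\<Sum>u\<le>p. H u (u + t)) + (\<Sum>u\<in>{p<..p + m}. H u (u + t)) = (\<Sum>u\<le>p + m. H u (u + t))"
      by (subst sum.union_disjoint[symmetric]) (auto intro!: sum.cong)
    moreover have "(\<Sum>u\<le>p + m. H u (u + t)) = (\<Sum>u\<le>m. H u (u + t))"
      by (rule sum.mono_neutral_right) (auto simp: H_def hi)
    ultimately show ?thesis using corr[of t] by (simp add: H_def)
  qed
  have "(\<Sum>l\<le>min q q'. H (q - l) (q' - l)) + (\<Sum>k<m. H (Suc (q + k)) (Suc (q' + k))) = (if q = q' then N else 0)"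
  proof (cases "q \<le> q'")
    case True
    then show ?thesis using main[of q "q' - q"] by (simp add: min_def)
  next
    case False
    \<comment> \<open>Entries below the diagonal follow by Hermitian symmetry.\<close>
    have "cnj ((\<Sum>l\<le>q'. H (q' - l) (q - l)) + (\<Sum>k<m. H (Suc (q' + k)) (Suc (q + k)))) = 0"
      using main[of q' "q - q'"] False by simp
    then show ?thesis using False unfolding complex_cnj_add cnj_sum sym[symmetric] by (simp add: min_def)
  qed
  then show ?thesis using q by (simp add: gram_mat_def H_def algebra_simps)
qed

text \<open>Exchanging the order of the factors replaces a determinant of size 2m, over basis
  vectors, by one of size m, over negative modes. Only the latter is a \<open>gram_mat\<close> and
  admits the recursion.\<close>

lemma sigma0_sq_poly_frame:
  assumes hi: "\<And>i. i > m \<Longrightarrow> coeff c i = 0" "\<And>i. i > m \<Longrightarrow> coeff d i = 0"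
    and a: "cnj a = a" and aN: "a * a * N = 1" and N: "cnj N = N"
    and unit: "\<And>z. z \<in> circle \<Longrightarrow> poly d z * cnj (poly d z) + poly c z * cnj (poly c z) = N"
    and corr: "\<And>t. (\<Sum>u\<le>m. cnj (coeff d u) * coeff d (u + t) + cnj (coeff c u) * coeff c (u + t)) = (if t = 0 then N else 0)"
  shows "sigma0_sq (poly_frame a c d) = (a * a) ^ m * det (gram_mat c d m)"
proof -
  let ?v = "neg_row a c d"
  define T where "T = (\<lambda>r s. - (\<Sum>q<m. ?v q s * cnj (?v q r)))"
  have coeff: "matrix_coeff_minus_id (hardy_adjoint (toeplitz_op (poly_frame a c d)) \<circ> toeplitz_op (poly_frame a c d)) r s
      = T r s" for r s
    unfolding T_def by (rule matrix_coeff_poly_frame[OF hi a]) (use unit aN in auto)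
  define F :: "(nat \<times> 2) set" where "F = {..<m} \<times> UNIV"
  have F: "finite F" by (simp add: F_def)
  have zero: "T r s = 0" if "r \<notin> F" for r s
  proof -
    have "?v q r = 0" for q using that hi by (cases r) (simp add: neg_row_def F_def)
    then show ?thesis by (simp add: T_def)
  qed
  obtain b where b: "bij_betw b {0..<card F} F" using ex_bij_betw_nat_finite[OF F] by blast
  let ?n = "card F"
  define X where "X = Matrix.mat ?n m (\<lambda>(i, q). cnj (?v q (b i)))"
  define Y where "Y = Matrix.mat m ?n (\<lambda>(q, j). ?v q (b j))"
  have X: "X \<in> carrier_mat ?n m" and Y: "Y \<in> carrier_mat m ?n" by (simp_all add: X_def Y_def)
  have "sigma0_sq (poly_frame a c d)
      = (\<Sum>p | p permutes F. of_int (sign p) * (\<Prod>s\<in>F. (if s = p s then 1 else 0) + T s (p s)))"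
    unfolding sigma0_sq_def fredholm_det_def coeff by (rule infsum_principal_minors[OF F zero])
  also have "\<dots> = det (Matrix.mat ?n ?n (\<lambda>(i, j). (if b i = b j then 1 else 0) + T (b i) (b j)))"
    by (rule sum_permutes_eq_det[OF b])
  also have "Matrix.mat ?n ?n (\<lambda>(i, j). (if b i = b j then 1 else 0) + T (b i) (b j)) = 1\<^sub>m ?n - X * Y"
  proof (rule eq_matI)
    fix i j assume "i < dim_row (1\<^sub>m ?n - X * Y)" "j < dim_col (1\<^sub>m ?n - X * Y)"
    then have ij: "i < ?n" "j < ?n" by (simp_all add: X_def Y_def)
    have "b i = b j \<longleftrightarrow> i = j"
      using b ij by (auto simp: bij_betw_def inj_on_eq_iff)
    moreover have "(X * Y) $$ (i, j) = (\<Sum>q<m. ?v q (b j) * cnj (?v q (b i)))"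
      using ij by (simp add: X_def Y_def scalar_prod_def lessThan_atLeast0 mult.commute)
    ultimately show "Matrix.mat ?n ?n (\<lambda>(i, j). (if b i = b j then 1 else 0) + T (b i) (b j)) $$ (i, j)
        = (1\<^sub>m ?n - X * Y) $$ (i, j)"
      using ij X Y by (simp add: T_def)
  qed (simp_all add: X_def Y_def)
  also have "det (1\<^sub>m ?n - X * Y) = det (1\<^sub>m m - Y * X)"
    by (rule det_one_minus_mult_commute[OF X Y])
  also have "1\<^sub>m m - Y * X = (a * a) \<cdot>\<^sub>m gram_mat c d m"
  proof (rule eq_matI)
    fix q q' assume "q < dim_row ((a * a) \<cdot>\<^sub>m gram_mat c d m)" "q' < dim_col ((a * a) \<cdot>\<^sub>m gram_mat c d m)"
    then have q: "q < m" "q' < m" by (simp_all add: carrier_matD[OF gram_mat_carrier])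
    have "(Y * X) $$ (q, q') = (\<Sum>i\<in>{0..<?n}. ?v q (b i) * cnj (?v q' (b i)))"
      using q by (simp add: X_def Y_def scalar_prod_def)
    also have "\<dots> = (\<Sum>s\<in>F. ?v q s * cnj (?v q' s))"
      by (rule sum.reindex_bij_betw[OF b])
    also have "\<dots> = (\<Sum>k<m. \<Sum>i\<in>UNIV. ?v q (k, i) * cnj (?v q' (k, i)))"
      unfolding F_def by (simp add: sum.cartesian_product)
    also have "\<dots> = a * a * (\<Sum>k<m. cnj (coeff d (Suc (q + k))) * coeff d (Suc (q' + k)) + cnj (coeff c (Suc (q + k))) * coeff c (Suc (q' + k)))"
      by (simp add: sum_2 neg_row_def a sum_distrib_left algebra_simps)
    finally have YX: "(Y * X) $$ (q, q') = \<dots>" .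
    have G: "gram_mat c d m $$ (q, q') = (if q = q' then N else 0) -
      (\<Sum>k<m. cnj (coeff d (Suc (q + k))) * coeff d (Suc (q' + k)) + cnj (coeff c (Suc (q + k))) * coeff c (Suc (q' + k)))"
      by (rule gram_mat_complement[OF hi corr N q])
    have "((a * a) \<cdot>\<^sub>m gram_mat c d m) $$ (q, q') = a * a * (gram_mat c d m $$ (q, q'))"
      using q by (simp add: carrier_matD[OF gram_mat_carrier])
    also have "\<dots> = a * a * (if q = q' then N else 0) - (Y * X) $$ (q, q')"
      by (simp only: G YX right_diff_distrib)
    also have "\<dots> = (if q = q' then 1 else 0) - (Y * X) $$ (q, q')"
      using aN by simp
    also have "\<dots> = (1\<^sub>m m - Y * X) $$ (q, q')"
      using q X Y by simp
    finally show "(1\<^sub>m m - Y * X) $$ (q, q') = ((a * a) \<cdot>\<^sub>m gram_mat c d m) $$ (q, q')" by simp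
  qed (use X Y in \<open>simp_all add: carrier_matD[OF gram_mat_carrier]\<close>)
  finally show ?thesis by (simp add: carrier_matD[OF gram_mat_carrier])
qed

text \<open>For large \<open>M\<close> these are the Fourier coefficients of |c|^2 + |d|^2 on the
  circle. A fixed bound \<open>M\<close> lets the degrees grow during the induction.\<close>

definition corr_sum :: "nat \<Rightarrow> complex poly \<Rightarrow> complex poly \<Rightarrow> nat \<Rightarrow> complex" where
  "corr_sum M c d t = (\<Sum>u\<le>M. cnj (coeff d u) * coeff d (u + t) + cnj (coeff c u) * coeff c (u + t))"

lemma corr_sum_pCons:
  assumes "coeff c M = 0"
  shows "corr_sum M (pCons 0 c) d t = corr_sum M c d t"
proof -
  have "(\<Sum>u\<le>M. cnj (coeff (pCons 0 c) u) * coeff (pCons 0 c) (u + t)) = (\<Sum>u\<le>M. cnj (coeff c u) * coeff c (u + t))"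
  proof (cases M)
    case (Suc k)
    show ?thesis unfolding Suc by (subst sum.atMost_Suc_shift) (use assms Suc in simp)
  qed (use assms in simp)
  then show ?thesis by (simp add: corr_sum_def sum.distrib)
qed

lemma corr_sum_rotate:
  "corr_sum M (c - smult (cnj s) d) (smult s c + d) t = (1 + s * cnj s) * corr_sum M c d t"
  unfolding corr_sum_def sum_distrib_left
  by (rule sum.cong[OF refl]) (simp add: algebra_simps)

lemma corr_sum_CD:
  "M \<ge> m \<Longrightarrow> corr_sum M (C_poly m k \<zeta>) (D_poly m k \<zeta>) t = (if t = 0 then of_real (N_prod m k \<zeta>) else 0)"
proof (induction m arbitrary: k)
  case 0
  have "(\<Sum>u\<le>M. cnj (coeff (1::complex poly) u) * coeff 1 (u + t)) = (\<Sum>u\<le>M. if u = 0 then (if t = 0 then 1 else 0) else 0)"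
    by (rule sum.cong[OF refl]) (auto simp: coeff_1)
  then show ?case by (simp add: corr_sum_def)
next
  case (Suc m)
  have "corr_sum M (C_poly (Suc m) k \<zeta>) (D_poly (Suc m) k \<zeta>) t
      = (1 + \<zeta> k * cnj (\<zeta> k)) * corr_sum M (C_poly m (Suc k) \<zeta>) (D_poly m (Suc k) \<zeta>) t"
    unfolding C_poly.simps D_poly.simps
    by (subst corr_sum_pCons)
       (use Suc.prems in \<open>simp_all add: coeff_C_poly_high coeff_D_poly_high corr_sum_rotate\<close>)
  then show ?case using Suc.IH[of "Suc k"] Suc.prems
    unfolding N_prod.simps of_real_mult of_real_one_plus_cmod_sq by simp
qed

section \<open>The Toeplitz determinants of g and of the conjugated loop\<close>

lemma inverse_sqrt_sq:
  assumes "N > 0"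
  shows "complex_of_real (1 / sqrt N) * complex_of_real (1 / sqrt N) = 1 / of_real N"
proof -
  have "1 / sqrt N * (1 / sqrt N) = 1 / N" using assms by simp
  then show ?thesis by (metis of_real_1 of_real_divide of_real_mult)
qed

lemma CD_norm_circle:
  assumes "z \<in> circle"
  shows "poly (D_poly m k \<zeta>) z * cnj (poly (D_poly m k \<zeta>) z) + poly (C_poly m k \<zeta>) z * cnj (poly (C_poly m k \<zeta>) z)
     = of_real (N_prod m k \<zeta>)"
  using CD_norm_identity[OF circle_nonzero[OF assms], of m k \<zeta>]
  unfolding star_poly_circle[OF assms] by (simp add: mult.commute)

lemma g_loop_eq_poly_frame:
  "g_loop n \<zeta> = poly_frame (of_real (1 / sqrt (N_prod n 1 \<zeta>))) (C_poly n 1 \<zeta>) (D_poly n 1 \<zeta>)"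
  unfolding g_loop_def poly_frame_def
proof (rule restrict_ext)
  fix z :: complex assume z: "z \<in> circle"
  show "g_prod n \<zeta> z = mat2 (of_real (1 / sqrt (N_prod n 1 \<zeta>)) * cnj (poly (D_poly n 1 \<zeta>) z))
      (- (of_real (1 / sqrt (N_prod n 1 \<zeta>)) * cnj (poly (C_poly n 1 \<zeta>) z)))
      (of_real (1 / sqrt (N_prod n 1 \<zeta>)) * poly (C_poly n 1 \<zeta>) z)
      (of_real (1 / sqrt (N_prod n 1 \<zeta>)) * poly (D_poly n 1 \<zeta>) z)"
    unfolding g_prod_eq_tail_prod tail_prod_eq_unit_frame[OF circle_nonzero[OF z]] unit_frame_def Let_def
      star_poly_circle[OF z]
    using circle_nonzero[OF z] by simp
qed

lemma sigma0_sq_g_loop: "sigma0_sq (g_loop n \<zeta>) = of_real (1 / W_prod n 1 \<zeta>)"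
proof -
  let ?N = "N_prod n 1 \<zeta>" and ?a = "complex_of_real (1 / sqrt (N_prod n 1 \<zeta>))"
  note N = N_prod_pos[of n 1 \<zeta>]
  have "sigma0_sq (g_loop n \<zeta>) = (?a * ?a) ^ n * det (gram_mat (C_poly n 1 \<zeta>) (D_poly n 1 \<zeta>) n)"
    unfolding g_loop_eq_poly_frame
  proof (rule sigma0_sq_poly_frame[where N = "of_real ?N"])
    show "?a * ?a * of_real ?N = 1" unfolding inverse_sqrt_sq[OF N] using N by simp
    show "(\<Sum>u\<le>n. cnj (coeff (D_poly n 1 \<zeta>) u) * coeff (D_poly n 1 \<zeta>) (u + t) +
        cnj (coeff (C_poly n 1 \<zeta>) u) * coeff (C_poly n 1 \<zeta>) (u + t)) = (if t = 0 then of_real ?N else 0)" for t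
      using corr_sum_CD[of n n 1 \<zeta> t] by (simp only: corr_sum_def)
  qed (simp_all only: coeff_C_poly_high coeff_D_poly_high CD_norm_circle complex_cnj_complex_of_real)
  also have "\<dots> = of_real (1 / W_prod n 1 \<zeta>)"
    unfolding inverse_sqrt_sq[OF N] det_gram_mat_eq_W using N by (simp add: power_divide)
  finally show ?thesis .
qed

text \<open>The conjugation divides \<gamma> by z and keeps \<delta>; since \<gamma>(0) = 0, the
  result is again a frame of polynomials.\<close>

lemma half_conj_g_loop:
  "half_conj (g_loop (Suc m) \<zeta>) = poly_frame (of_real (1 / sqrt (N_prod (Suc m) 1 \<zeta>)))
     (C_poly m 2 \<zeta> - smult (cnj (\<zeta> 1)) (D_poly m 2 \<zeta>)) (D_poly (Suc m) 1 \<zeta>)"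
  unfolding half_conj_def
proof -
  let ?a = "complex_of_real (1 / sqrt (N_prod (Suc m) 1 \<zeta>))"
  let ?c = "C_poly m 2 \<zeta> - smult (cnj (\<zeta> 1)) (D_poly m 2 \<zeta>)"
  have C: "C_poly (Suc m) 1 \<zeta> = pCons 0 ?c" by (simp add: numeral_2_eq_2)
  show "(\<lambda>z\<in>circle. mat2 (csqrt z) 0 0 (inverse (csqrt z)) ** g_loop (Suc m) \<zeta> z **
      mat2 (inverse (csqrt z)) 0 0 (csqrt z)) = poly_frame ?a ?c (D_poly (Suc m) 1 \<zeta>)"
    unfolding poly_frame_def
  proof (rule restrict_ext)
    fix z :: complex assume z: "z \<in> circle"
    define e where "e = csqrt z"
    define f where "f = inverse e"
    have ee: "e * e = z" using power2_csqrt[of z] by (simp add: e_def power2_eq_square)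
    have ef: "e * f = 1" "f * e = 1" using circle_nonzero[OF z] ee by (auto simp: f_def)
    have zz: "z * cnj z = 1" using inverse_eq_cnj[OF z] circle_nonzero[OF z] by (metis right_inverse)
    have 12: "e * (a * cnj (z * x)) * e = a * cnj x" for a x
    proof -
      have "e * (a * cnj (z * x)) * e = (e * e) * cnj z * (a * cnj x)" by (simp add: mult_ac)
      then show ?thesis unfolding ee zz by simp
    qed
    have 21: "f * (a * (z * x)) * f = a * x" for a x
    proof -
      have "f * (a * (z * x)) * f = (f * e) * (f * e) * (a * x)" by (simp add: ee[symmetric] mult_ac)
      then show ?thesis unfolding ef by simp
    qed
    have 11: "e * x * f = x" "f * x * e = x" for x
      using ef by (simp_all add: mult.commute mult.left_commute)
    show "mat2 (csqrt z) 0 0 (inverse (csqrt z)) ** g_loop (Suc m) \<zeta> z ** mat2 (inverse (csqrt z)) 0 0 (csqrt z)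
      = mat2 (?a * cnj (poly (D_poly (Suc m) 1 \<zeta>) z)) (- (?a * cnj (poly ?c z)))
          (?a * poly ?c z) (?a * poly (D_poly (Suc m) 1 \<zeta>) z)"
      unfolding g_loop_eq_poly_frame poly_frame_def restrict_apply'[OF z] C
        e_def[symmetric] f_def[symmetric] poly_pCons add_0 mat2_mult
      by (simp only: mat2_eq_iff mult_zero_left mult_zero_right add_0_left add_0_right minus_zero 11 12 21
          mult_minus_left mult_minus_right simp_thms)
  qed
qed

text \<open>The pair of the conjugated loop is a scaled rotation of the pair for \<zeta>_2,
  \<zeta>_3, and so on. The scale cancels against the normalisation, so \<zeta>_1 drops out.\<close>

lemma sigma1_sq_g_loop: "sigma1_sq (g_loop (Suc m) \<zeta>) = of_real (1 / W_prod m 2 \<zeta>)"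
proof -
  let ?N = "N_prod (Suc m) 1 \<zeta>" and ?a = "complex_of_real (1 / sqrt (N_prod (Suc m) 1 \<zeta>))"
  let ?c = "C_poly m 2 \<zeta> - smult (cnj (\<zeta> 1)) (D_poly m 2 \<zeta>)"
  let ?d = "D_poly (Suc m) 1 \<zeta>"
  note N = N_prod_pos[of "Suc m" 1 \<zeta>]
  have C: "C_poly (Suc m) 1 \<zeta> = pCons 0 ?c" by (simp add: numeral_2_eq_2)
  have c_hi: "coeff ?c i = 0" if "i > m" for i
    using coeff_C_poly_high[of "Suc m" "Suc i" 1 \<zeta>] that unfolding C by simp
  have Nv: "complex_of_real ?N = of_real (N_prod m 2 \<zeta>) * (1 + \<zeta> 1 * cnj (\<zeta> 1))"
    unfolding N_prod.simps of_real_mult of_real_one_plus_cmod_sq by (simp add: numeral_2_eq_2)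
  have "sigma0_sq (poly_frame ?a ?c ?d) = (?a * ?a) ^ m * det (gram_mat ?c ?d m)"
  proof (rule sigma0_sq_poly_frame[where N = "of_real ?N", OF c_hi])
    show "?a * ?a * of_real ?N = 1" unfolding inverse_sqrt_sq[OF N] using N by (simp del: N_prod.simps)
    show "coeff ?d i = 0" if "i > m" for i using that by (intro coeff_D_poly_high) auto
    show "(\<Sum>u\<le>m. cnj (coeff ?d u) * coeff ?d (u + t) + cnj (coeff ?c u) * coeff ?c (u + t))
        = (if t = 0 then of_real ?N else 0)" for t
    proof -
      have d: "?d = smult (\<zeta> 1) (C_poly m 2 \<zeta>) + D_poly m 2 \<zeta>"
        by (simp add: numeral_2_eq_2)
      have "corr_sum m ?c ?d t = (if t = 0 then of_real ?N else 0)"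
        unfolding d corr_sum_rotate corr_sum_CD[OF order_refl] Nv by simp
      then show ?thesis by (simp only: corr_sum_def)
    qed
    show "poly ?d z * cnj (poly ?d z) + poly ?c z * cnj (poly ?c z) = of_real ?N" if z: "z \<in> circle" for z
    proof -
      have "z * cnj z = 1" using inverse_eq_cnj[OF z] circle_nonzero[OF z] by (metis right_inverse)
      moreover have "poly (C_poly (Suc m) 1 \<zeta>) z * cnj (poly (C_poly (Suc m) 1 \<zeta>) z)
          = z * cnj z * (poly ?c z * cnj (poly ?c z))"
        unfolding C poly_pCons add_0 complex_cnj_mult by (simp only: mult_ac)
      ultimately show ?thesis using CD_norm_circle[OF z, of "Suc m" 1 \<zeta>] by simp
    qed
  qed simp_all
  also have "\<dots> = of_real (1 / W_prod m 2 \<zeta>)"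
  proof -
    define A B where "A = N_prod m 2 \<zeta>" and "B = 1 + (cmod (\<zeta> 1))\<^sup>2"
    have AB: "?N = A * B" unfolding A_def B_def N_prod.simps by (simp add: numeral_2_eq_2)
    have pos: "A \<noteq> 0" "B \<noteq> 0" using N unfolding AB by auto
    have s: "Suc 1 = 2" by simp
    have "(?a * ?a) ^ m * det (gram_mat ?c ?d m)
        = of_real ((1 / (A * B)) ^ m * (B ^ m * (A ^ m / W_prod m 2 \<zeta>)))"
      unfolding inverse_sqrt_sq[OF N] det_gram_shift[of m 1 \<zeta>, unfolded s] det_gram_mat_eq_W
      unfolding AB A_def[symmetric] B_def[symmetric] by simp
    also have "(1 / (A * B)) ^ m * (B ^ m * (A ^ m / W_prod m 2 \<zeta>)) = 1 / W_prod m 2 \<zeta>"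
      using pos by (simp add: power_mult_distrib power_divide)
    finally show ?thesis .
  qed
  finally show ?thesis unfolding sigma1_sq_def half_conj_g_loop .
qed

section \<open>The coordinates as a diffeomorphism\<close>

lemma polys_shift_cong:
  assumes "\<And>i. i < m \<Longrightarrow> \<zeta> (k + i) = \<zeta>' (k' + i)"
  shows "C_poly m k \<zeta> = C_poly m k' \<zeta>'" "D_poly m k \<zeta> = D_poly m k' \<zeta>'"
    "N_prod m k \<zeta> = N_prod m k' \<zeta>'" "Y_poly m k \<zeta> = Y_poly m k' \<zeta>'"
proof -
  have "C_poly m k \<zeta> = C_poly m k' \<zeta>' \<and> D_poly m k \<zeta> = D_poly m k' \<zeta>' \<and>
      N_prod m k \<zeta> = N_prod m k' \<zeta>' \<and> Y_poly m k \<zeta> = Y_poly m k' \<zeta>'"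
    using assms
  proof (induction m arbitrary: k k')
    case (Suc m)
    have "\<zeta> (Suc k + i) = \<zeta>' (Suc k' + i)" if "i < m" for i
      using Suc.prems[of "Suc i"] that by simp
    note IH = Suc.IH[OF this]
    have "\<zeta> k = \<zeta>' k'" using Suc.prems[of 0] by simp
    then show ?case using IH by simp
  qed simp
  then show "C_poly m k \<zeta> = C_poly m k' \<zeta>'" "D_poly m k \<zeta> = D_poly m k' \<zeta>'"
    "N_prod m k \<zeta> = N_prod m k' \<zeta>'" "Y_poly m k \<zeta> = Y_poly m k' \<zeta>'" by auto
qed

lemma y_low_shift_cong:
  "(\<And>i. i < m \<Longrightarrow> \<zeta> (k + i) = \<zeta>' (k' + i)) \<Longrightarrow> y_low m k \<zeta> = y_low m k' \<zeta>'"
  unfolding y_low_def using polys_shift_cong(4)[of m \<zeta> k \<zeta>' k'] by simp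

lemma polys_zero:
  "(\<And>i. i < r \<Longrightarrow> \<zeta> (k + i) = 0) \<Longrightarrow>
    C_poly r k \<zeta> = 0 \<and> D_poly r k \<zeta> = 1 \<and> N_prod r k \<zeta> = 1 \<and> Y_poly r k \<zeta> = 0"
proof (induction r arbitrary: k)
  case (Suc r)
  have "\<zeta> (Suc k + i) = 0" if "i < r" for i using Suc.prems[of "Suc i"] that by simp
  note IH = Suc.IH[OF this]
  have "\<zeta> k = 0" using Suc.prems[of 0] by simp
  then show ?case using IH by simp
qed simp

lemma polys_zero_extend:
  assumes "\<And>i. i < r \<Longrightarrow> \<zeta> (k + m + i) = 0"
  shows "C_poly (m + r) k \<zeta> = C_poly m k \<zeta> \<and> D_poly (m + r) k \<zeta> = D_poly m k \<zeta> \<and>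
    N_prod (m + r) k \<zeta> = N_prod m k \<zeta> \<and> Y_poly (m + r) k \<zeta> = Y_poly m k \<zeta>"
  using assms
proof (induction m arbitrary: k)
  case 0
  then show ?case using polys_zero[of r \<zeta> k] by simp
next
  case (Suc m)
  have "\<zeta> (Suc k + m + i) = 0" if "i < r" for i using Suc.prems[of i] that by simp
  note IH = Suc.IH[OF this]
  \<comment> \<open>The recursion for Y now sums up to m + r, but Y has no coefficients from index m
    on.\<close>
  have high: "(\<Sum>i<m + r. coeff (Y_poly m (Suc k) \<zeta>) i * c i) = (\<Sum>i<m. coeff (Y_poly m (Suc k) \<zeta>) i * c i)" for c
    by (rule sum.mono_neutral_right) (auto simp: coeff_Y_poly_high)
  show ?case using IH by (simp add: high)
qed

lemma y_low_zero_extend: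
  "(\<And>i. i < r \<Longrightarrow> \<zeta> (k + m + i) = 0) \<Longrightarrow> y_low (m + r) k \<zeta> = y_low m k \<zeta>"
  unfolding y_low_def using polys_zero_extend[of r \<zeta> k m] by simp

definition y_rest :: "nat \<Rightarrow> nat \<Rightarrow> (nat \<Rightarrow> complex) \<Rightarrow> complex" where
  "y_rest m k \<zeta> = (\<Sum>i<m. coeff (Y_poly m k \<zeta>) i * coeff (D_poly m k \<zeta>) (Suc i))"

text \<open>The triangular shape: for given later parameters, x_k is affine in \<zeta>_k with
  positive real slope.\<close>

lemma y_low_Suc: "y_low (Suc m) k \<zeta> = of_real (N_prod m (Suc k) \<zeta>) * \<zeta> k - y_rest m (Suc k) \<zeta>"
  by (simp add: y_low_def y_rest_def)

text \<open>The recursions use only constants, sums, products and conjugates of the parameters. One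
  induction in this setting serves both smoothness and Borel measurability.\<close>

locale conj_algebra =
  fixes S :: "('p \<Rightarrow> complex) \<Rightarrow> bool"
  assumes const: "S (\<lambda>_. c)"
    and add: "S f \<Longrightarrow> S g \<Longrightarrow> S (\<lambda>p. f p + g p)"
    and mult: "S f \<Longrightarrow> S g \<Longrightarrow> S (\<lambda>p. f p * g p)"
    and cnj: "S f \<Longrightarrow> S (\<lambda>p. cnj (f p))"
begin

lemma minus: "S f \<Longrightarrow> S (\<lambda>p. - f p)"
  using mult[OF const[of "- 1"], of f] by simp

lemma diff: "S f \<Longrightarrow> S g \<Longrightarrow> S (\<lambda>p. f p - g p)"
  using add[OF _ minus, of f g] by simp

lemma sum: "finite A \<Longrightarrow> (\<And>a. a \<in> A \<Longrightarrow> S (F a)) \<Longrightarrow> S (\<lambda>p. \<Sum>a\<in>A. F a p)"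
  by (induction A rule: finite_induct) (auto intro: const add)

lemma polys:
  assumes "\<And>i. k \<le> i \<Longrightarrow> i < k + m \<Longrightarrow> S (\<lambda>p. Z p i)"
  shows "S (\<lambda>p. coeff (C_poly m k (Z p)) j) \<and> S (\<lambda>p. coeff (D_poly m k (Z p)) j) \<and>
    S (\<lambda>p. of_real (N_prod m k (Z p))) \<and> S (\<lambda>p. coeff (Y_poly m k (Z p)) j)"
  using assms
proof (induction m arbitrary: k j)
  case 0
  then show ?case by (auto intro: const)
next
  case (Suc m)
  have "S (\<lambda>p. Z p i)" if "Suc k \<le> i" "i < Suc k + m" for i using Suc.prems that by simp
  note IH = Suc.IH[of "Suc k", OF this]
  have C: "S (\<lambda>p. coeff (C_poly m (Suc k) (Z p)) i)" and D: "S (\<lambda>p. coeff (D_poly m (Suc k) (Z p)) i)"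
    and N: "S (\<lambda>p. of_real (N_prod m (Suc k) (Z p)))" and Y: "S (\<lambda>p. coeff (Y_poly m (Suc k) (Z p)) i)" for i
    using IH by blast+
  have z: "S (\<lambda>p. Z p k)" using Suc.prems by simp
  have "S (\<lambda>p. coeff (C_poly (Suc m) k (Z p)) j)"
    by (cases j) (simp_all add: const diff mult cnj C D z)
  moreover have "S (\<lambda>p. coeff (D_poly (Suc m) k (Z p)) j)"
    by (simp add: add mult C D z)
  moreover have "S (\<lambda>p. of_real (N_prod (Suc m) k (Z p)))"
    unfolding N_prod.simps of_real_mult of_real_one_plus_cmod_sq
    by (intro mult add const cnj N z)
  moreover have "S (\<lambda>p. coeff (Y_poly (Suc m) k (Z p)) j)"
  proof (cases j)
    case 0
    have "S (\<lambda>p. of_real (N_prod m (Suc k) (Z p)) * Z p k -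
      (\<Sum>i<m. coeff (Y_poly m (Suc k) (Z p)) i * coeff (D_poly m (Suc k) (Z p)) (Suc i)))"
      by (intro diff mult sum N z Y D) auto
    then show ?thesis using 0 by simp
  next
    case (Suc i)
    then show ?thesis using Y by simp
  qed
  ultimately show ?case by blast
qed

lemma y_low:
  assumes "\<And>i. k \<le> i \<Longrightarrow> i < k + m \<Longrightarrow> S (\<lambda>p. Z p i)"
  shows "S (\<lambda>p. y_low m k (Z p))"
  unfolding y_low_def using polys[of k m Z, OF assms] by blast

lemma N_prod:
  assumes "\<And>i. k \<le> i \<Longrightarrow> i < k + m \<Longrightarrow> S (\<lambda>p. Z p i)"
  shows "S (\<lambda>p. of_real (N_prod m k (Z p)))"
  using polys[of k m Z, OF assms] by blast

lemma y_rest: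
  assumes "\<And>i. k \<le> i \<Longrightarrow> i < k + m \<Longrightarrow> S (\<lambda>p. Z p i)"
  shows "S (\<lambda>p. y_rest m k (Z p))"
  unfolding y_rest_def using polys[of k m Z, OF assms] by (intro sum mult) auto

end

section \<open>Iterated partial derivatives on \<open>Cn\<close>\<close>

lemma Cn_fun_upd: "p \<in> Cn n \<Longrightarrow> k \<in> {1..n} \<Longrightarrow> p(k := w) \<in> Cn n"
  by (auto simp: Cn_def PiE_iff extensional_def)

lemma line_at_cong:
  assumes "\<And>p. p \<in> Cn n \<Longrightarrow> f p = g p" "p \<in> Cn n" "k \<in> {1..n}"
  shows "line_at f k v p = line_at g k v p"
  using assms Cn_fun_upd by (auto simp: line_at_def fun_eq_iff)

text \<open>Changing one coordinate does not leave \<open>Cn\<close>, so partial derivatives at its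
  points see only values on it. This matters for the inverse map, which is known on
  \<open>Cn\<close> only.\<close>

lemma Ck_fun_cong:
  assumes "\<And>p. p \<in> Cn n \<Longrightarrow> f p = g p"
  shows "Ck_fun n m f \<longleftrightarrow> Ck_fun n m g"
  using assms
proof (induction m arbitrary: f g)
  case 0
  then show ?case by (simp cong: continuous_on_cong)
next
  case (Suc m)
  have c: "continuous_on (Cn n) f \<longleftrightarrow> continuous_on (Cn n) g"
    using Suc.prems by (simp cong: continuous_on_cong)
  have l: "line_at f k v p = line_at g k v p" if "p \<in> Cn n" "k \<in> {1..n}" for k v p
    using line_at_cong[OF Suc.prems that] by simp
  have "Ck_fun n m (partial_deriv k v f) \<longleftrightarrow> Ck_fun n m (partial_deriv k v g)" if "k \<in> {1..n}" for k v
    by (rule Suc.IH) (simp only: partial_deriv_def l[OF _ that])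
  then show ?case using c l by simp
qed

lemma line_at_0 [simp]: "line_at f k v p 0 = f p"
  by (simp add: line_at_def)

lemma Ck_fun_continuous: "Ck_fun n m f \<Longrightarrow> continuous_on (Cn n) f"
  by (cases m) auto

text \<open>Permits a closed formula in place of \<open>partial_deriv\<close>, with which it agrees
  on \<open>Cn\<close>.\<close>

lemma Ck_fun_SucI:
  assumes "continuous_on (Cn n) f"
    and "\<And>k v p. k \<in> {1..n} \<Longrightarrow> v \<in> {1, \<i>} \<Longrightarrow> p \<in> Cn n \<Longrightarrow>
      (line_at f k v p has_vector_derivative f' k v p) (at 0)"
    and "\<And>k v. k \<in> {1..n} \<Longrightarrow> v \<in> {1, \<i>} \<Longrightarrow> Ck_fun n m (f' k v)"
  shows "Ck_fun n (Suc m) f"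
proof -
  have "Ck_fun n m (partial_deriv k v f)" if "k \<in> {1..n}" "v \<in> {1, \<i>}" for k v
    using Ck_fun_cong[of n "partial_deriv k v f" "f' k v" m] assms(2,3)[OF that]
    by (simp add: partial_deriv_def vector_derivative_at)
  moreover have "line_at f k v p differentiable (at 0)" if "k \<in> {1..n}" "v \<in> {1, \<i>}" "p \<in> Cn n" for k v p
    using assms(2)[OF that] by (rule differentiableI_vector)
  ultimately show ?thesis unfolding Ck_fun.simps using assms(1) by blast
qed

lemma Ck_fun_SucD:
  assumes "Ck_fun n (Suc m) f" "k \<in> {1..n}" "v \<in> {1, \<i>}"
  shows "p \<in> Cn n \<Longrightarrow> (line_at f k v p has_vector_derivative partial_deriv k v f p) (at 0)"
    "Ck_fun n m (partial_deriv k v f)"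
  using assms by (auto simp: partial_deriv_def vector_derivative_works[symmetric])

lemma Ck_fun_Suc_imp: "Ck_fun n (Suc m) f \<Longrightarrow> Ck_fun n m f"
proof (induction m arbitrary: f)
  case (Suc m)
  show ?case
    by (rule Ck_fun_SucI[where f' = "\<lambda>k v. partial_deriv k v f"])
       (rule Ck_fun_continuous[OF Suc.prems], rule Ck_fun_SucD(1)[OF Suc.prems], assumption+,
        rule Suc.IH, rule Ck_fun_SucD(2)[OF Suc.prems], assumption+)
qed simp

lemma Ck_fun_const: "Ck_fun n m (\<lambda>_. c)"
proof (induction m arbitrary: c)
  case (Suc m)
  show ?case
    by (rule Ck_fun_SucI[where f' = "\<lambda>_ _ _. 0"]) (use Suc in \<open>auto simp: line_at_def[abs_def]\<close>)
qed simp

lemma continuous_on_coordinate: "continuous_on A (\<lambda>p :: nat \<Rightarrow> complex. p j)"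
  using continuous_on_product_coordinates[of j] continuous_on_subset by blast

lemma Ck_fun_coordinate: "Ck_fun n m (\<lambda>p. p j)"
proof (cases m)
  case 0
  then show ?thesis by (simp add: continuous_on_coordinate)
next
  case (Suc m')
  have "Ck_fun n (Suc m') (\<lambda>p. p j)"
  proof (rule Ck_fun_SucI[where f' = "\<lambda>k v _. if k = j then v else 0"])
    fix k v p
    show "(line_at (\<lambda>p. p j) k v p has_vector_derivative (if k = j then v else 0)) (at 0)"
    proof (cases "k = j")
      case True
      have "((\<lambda>t::real. p j + of_real t * v) has_vector_derivative 0 + 1 * v) (at 0)"
        by (intro derivative_intros has_vector_derivative_mult_left)
           (simp add: has_vector_derivative_def scaleR_conv_of_real
             bounded_linear_imp_has_derivative[OF bounded_linear_of_real])
      then show ?thesis using True by (simp add: line_at_def[abs_def])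
    qed (simp add: line_at_def[abs_def])
  qed (simp_all add: Ck_fun_const continuous_on_coordinate)
  then show ?thesis using Suc by simp
qed

lemma Ck_fun_add: "Ck_fun n m f \<Longrightarrow> Ck_fun n m g \<Longrightarrow> Ck_fun n m (\<lambda>p. f p + g p)"
proof (induction m arbitrary: f g)
  case 0
  then show ?case by (auto intro: continuous_on_add)
next
  case (Suc m)
  show ?case
  proof (rule Ck_fun_SucI[where f' = "\<lambda>k v p. partial_deriv k v f p + partial_deriv k v g p"])
    show "continuous_on (Cn n) (\<lambda>p. f p + g p)"
      by (intro continuous_on_add Ck_fun_continuous[OF Suc.prems(1)] Ck_fun_continuous[OF Suc.prems(2)])
    fix k v assume kv: "k \<in> {1..n}" "v \<in> {1, \<i>}"
    show "Ck_fun n m (\<lambda>p. partial_deriv k v f p + partial_deriv k v g p)"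
      using Ck_fun_SucD(2)[OF Suc.prems(1) kv] Ck_fun_SucD(2)[OF Suc.prems(2) kv] by (rule Suc.IH)
    fix p assume p: "p \<in> Cn n"
    show "(line_at (\<lambda>p. f p + g p) k v p has_vector_derivative partial_deriv k v f p + partial_deriv k v g p) (at 0)"
      using has_vector_derivative_add[OF Ck_fun_SucD(1)[OF Suc.prems(1) kv p] Ck_fun_SucD(1)[OF Suc.prems(2) kv p]]
      by (simp add: line_at_def[abs_def])
  qed
qed

lemma Ck_fun_mult: "Ck_fun n m f \<Longrightarrow> Ck_fun n m g \<Longrightarrow> Ck_fun n m (\<lambda>p. f p * g p)"
proof (induction m arbitrary: f g)
  case 0
  then show ?case by (auto intro: continuous_on_mult)
next
  case (Suc m)
  show ?case
  proof (rule Ck_fun_SucI[where f' = "\<lambda>k v p. f p * partial_deriv k v g p + partial_deriv k v f p * g p"])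
    show "continuous_on (Cn n) (\<lambda>p. f p * g p)"
      by (intro continuous_on_mult Ck_fun_continuous[OF Suc.prems(1)] Ck_fun_continuous[OF Suc.prems(2)])
    fix k v assume kv: "k \<in> {1..n}" "v \<in> {1, \<i>}"
    show "Ck_fun n m (\<lambda>p. f p * partial_deriv k v g p + partial_deriv k v f p * g p)"
      by (intro Ck_fun_add Suc.IH Ck_fun_SucD(2)[OF Suc.prems(1) kv] Ck_fun_SucD(2)[OF Suc.prems(2) kv]
          Ck_fun_Suc_imp[OF Suc.prems(1)] Ck_fun_Suc_imp[OF Suc.prems(2)])
    fix p assume p: "p \<in> Cn n"
    show "(line_at (\<lambda>p. f p * g p) k v p has_vector_derivative f p * partial_deriv k v g p + partial_deriv k v f p * g p) (at 0)"
      using has_vector_derivative_mult[OF Ck_fun_SucD(1)[OF Suc.prems(1) kv p] Ck_fun_SucD(1)[OF Suc.prems(2) kv p]]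
      by (simp add: line_at_def[abs_def])
  qed
qed

lemma Ck_fun_cnj: "Ck_fun n m f \<Longrightarrow> Ck_fun n m (\<lambda>p. cnj (f p))"
proof (induction m arbitrary: f)
  case 0
  then show ?case by (auto intro: continuous_on_cnj)
next
  case (Suc m)
  show ?case
  proof (rule Ck_fun_SucI[where f' = "\<lambda>k v p. cnj (partial_deriv k v f p)"])
    show "continuous_on (Cn n) (\<lambda>p. cnj (f p))"
      by (intro continuous_on_cnj Ck_fun_continuous[OF Suc.prems])
    fix k v assume kv: "k \<in> {1..n}" "v \<in> {1, \<i>}"
    show "Ck_fun n m (\<lambda>p. cnj (partial_deriv k v f p))"
      by (intro Suc.IH Ck_fun_SucD(2)[OF Suc.prems kv])
    fix p assume p: "p \<in> Cn n"
    show "(line_at (\<lambda>p. cnj (f p)) k v p has_vector_derivative cnj (partial_deriv k v f p)) (at 0)"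
      using bounded_linear.has_vector_derivative[OF bounded_linear_cnj Ck_fun_SucD(1)[OF Suc.prems kv p]]
      by (simp add: line_at_def[abs_def])
  qed
qed

lemma Ck_fun_inverse:
  assumes nz: "\<And>p. p \<in> Cn n \<Longrightarrow> f p \<noteq> 0"
  shows "Ck_fun n m f \<Longrightarrow> Ck_fun n m (\<lambda>p. inverse (f p))"
proof (induction m)
  case 0
  then show ?case using nz by (auto intro: continuous_on_inverse)
next
  case (Suc m)
  note IH = Suc.IH[OF Ck_fun_Suc_imp[OF Suc.prems]]
  show ?case
  \<comment> \<open>The derivative is expressed through \<open>inverse (f p)\<close> itself, so the
    induction hypothesis applies to it.\<close>
  proof (rule Ck_fun_SucI[where f' = "\<lambda>k v p. partial_deriv k v f p * ((- 1) * (inverse (f p) * inverse (f p)))"])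
    show "continuous_on (Cn n) (\<lambda>p. inverse (f p))"
      using nz by (intro continuous_on_inverse Ck_fun_continuous[OF Suc.prems]) auto
    fix k v assume kv: "k \<in> {1..n}" "v \<in> {1, \<i>}"
    show "Ck_fun n m (\<lambda>p. partial_deriv k v f p * ((- 1) * (inverse (f p) * inverse (f p))))"
      by (intro Ck_fun_mult Ck_fun_SucD(2)[OF Suc.prems kv] IH Ck_fun_const)
    fix p assume p: "p \<in> Cn n"
    have "(inverse has_field_derivative - (inverse (f p) * inverse (f p))) (at (line_at f k v p 0))"
      using nz[OF p] DERIV_inverse[of "f p" UNIV] by (simp add: power2_eq_square power_Suc2)
    from field_vector_diff_chain_at[OF Ck_fun_SucD(1)[OF Suc.prems kv p] this]
    show "(line_at (\<lambda>p. inverse (f p)) k v p has_vector_derivative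
        partial_deriv k v f p * ((- 1) * (inverse (f p) * inverse (f p)))) (at 0)"
      by (simp add: line_at_def[abs_def] o_def)
  qed
qed

interpretation smooth: conj_algebra "\<lambda>f. \<forall>m. Ck_fun n m f" for n
  by unfold_locales (auto intro: Ck_fun_const Ck_fun_add Ck_fun_mult Ck_fun_cnj)

text \<open>Back substitution from the last coordinate down: step \<open>m\<close> solves the affine
  equation for \<zeta>_(n-m). The initial zeros are placeholders, since an equation involves only
  parameters found before.\<close>

primrec zeta_rec :: "nat \<Rightarrow> nat \<Rightarrow> (nat \<Rightarrow> complex) \<Rightarrow> nat \<Rightarrow> complex" where
  "zeta_rec n 0 x = (\<lambda>_. 0)"
| "zeta_rec n (Suc m) x = (zeta_rec n m x)(n - m :=
     (x (n - m) + y_rest m (Suc (n - m)) (zeta_rec n m x)) *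
       inverse (of_real (N_prod m (Suc (n - m)) (zeta_rec n m x))))"

lemma zeta_rec_stable:
  "m \<le> n \<Longrightarrow> m' \<le> m \<Longrightarrow> i > n - m' \<Longrightarrow> zeta_rec n m x i = zeta_rec n m' x i"
proof (induction m)
  case (Suc m)
  show ?case
  proof (cases "m' = Suc m")
    case False
    then have "m' \<le> m" using Suc.prems by simp
    then show ?thesis using Suc by auto
  qed simp
qed auto

lemma y_rest_N_prod_cong:
  assumes "\<And>i. i < m \<Longrightarrow> \<zeta> (k + i) = \<zeta>' (k + i)"
  shows "y_rest m k \<zeta> = y_rest m k \<zeta>'" "N_prod m k \<zeta> = N_prod m k \<zeta>'"
  using polys_shift_cong[of m \<zeta> k \<zeta>' k, OF assms] by (simp_all add: y_rest_def)

lemma of_real_N_prod_neq_0: "complex_of_real (N_prod m k \<zeta>) \<noteq> 0"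
  using N_prod_pos[of m k \<zeta>] by simp

lemma y_low_zeta_rec:
  assumes j: "j \<in> {1..n}"
  shows "y_low (Suc n - j) j (zeta_rec n n x) = x j"
proof -
  define m where "m = n - j"
  have nm: "n - m = j" "Suc n - j = Suc m" "m < n" using j by (auto simp: m_def)
  let ?z = "zeta_rec n n x" and ?w = "zeta_rec n m x"
  have eq: "?z (Suc j + i) = ?w (Suc j + i)" if "i < m" for i
    using nm by (intro zeta_rec_stable) auto
  have "?z j = zeta_rec n (Suc m) x j"
    using nm by (intro zeta_rec_stable) auto
  also have "\<dots> = (x j + y_rest m (Suc j) ?w) * inverse (of_real (N_prod m (Suc j) ?w))"
    by (simp add: nm)
  finally have zj: "?z j = (x j + y_rest m (Suc j) ?z) * inverse (of_real (N_prod m (Suc j) ?z))"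
    using y_rest_N_prod_cong[of m ?z "Suc j" ?w, OF eq] by simp
  show ?thesis unfolding nm(2) y_low_Suc zj using of_real_N_prod_neq_0[of m "Suc j" ?z] by (simp add: field_simps)
qed

lemma zeta_rec_y_low:
  assumes x: "\<And>j. j \<in> {1..n} \<Longrightarrow> x j = y_low (Suc n - j) j \<zeta>"
  shows "m \<le> n \<Longrightarrow> i > n - m \<Longrightarrow> i \<le> n \<Longrightarrow> zeta_rec n m x i = \<zeta> i"
proof (induction m arbitrary: i)
  case (Suc m)
  define j where "j = n - m"
  have j: "j \<in> {1..n}" "Suc n - j = Suc m" using Suc.prems by (auto simp: j_def)
  show ?case
  proof (cases "i = j")
    case False
    then show ?thesis using Suc by (auto simp: j_def)
  next
    case True
    have "zeta_rec n m x (Suc j + i) = \<zeta> (Suc j + i)" if "i < m" for i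
      using that Suc.prems by (intro Suc.IH) (auto simp: j_def)
    note cong = y_rest_N_prod_cong[of m "zeta_rec n m x" "Suc j" \<zeta>, OF this]
    have "zeta_rec n (Suc m) x i = (x j + y_rest m (Suc j) \<zeta>) * inverse (of_real (N_prod m (Suc j) \<zeta>))"
      using True cong by (simp add: j_def)
    also have "\<dots> = \<zeta> j"
      unfolding x[OF j(1)] j(2) y_low_Suc using of_real_N_prod_neq_0[of m "Suc j" \<zeta>] by simp
    finally show ?thesis using True by simp
  qed
qed auto

lemma smooth_zeta_rec: "m \<le> n \<Longrightarrow> \<forall>l. Ck_fun n l (\<lambda>x. zeta_rec n m x i)"
proof (induction m arbitrary: i)
  case 0
  then show ?case by (simp add: Ck_fun_const)
next
  case (Suc m)
  have IH: "\<forall>l. Ck_fun n l (\<lambda>x. zeta_rec n m x i)" for i using Suc by simp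
  show ?case
  proof (cases "i = n - m")
    case False
    then show ?thesis using IH[of i] by simp
  next
    case True
    have "\<forall>l. Ck_fun n l (\<lambda>x. x i + y_rest m (Suc i) (zeta_rec n m x))"
      by (intro smooth.add smooth.y_rest IH) (simp add: Ck_fun_coordinate)
    moreover have "\<forall>l. Ck_fun n l (\<lambda>x. of_real (N_prod m (Suc i) (zeta_rec n m x)))"
      by (intro smooth.N_prod IH)
    then have "\<forall>l. Ck_fun n l (\<lambda>x. inverse (of_real (N_prod m (Suc i) (zeta_rec n m x))))"
      using of_real_N_prod_neq_0 by (intro allI Ck_fun_inverse) auto
    ultimately have "\<forall>l. Ck_fun n l (\<lambda>x. (x i + y_rest m (Suc i) (zeta_rec n m x)) *
        inverse (of_real (N_prod m (Suc i) (zeta_rec n m x))))"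
      by (rule smooth.mult)
    then show ?thesis using True by simp
  qed
qed

section \<open>The coordinate map and its inverse\<close>

lemma x_coords_nth: "j \<in> {1..n} \<Longrightarrow> x_coords n \<zeta> j = y_low (Suc n - j) j \<zeta>"
  by (simp add: x_coords_eq x_explicit_def)

lemma x_coords_in_Cn: "x_coords n \<zeta> \<in> Cn n"
  by (simp add: x_coords_eq x_explicit_def Cn_def)

lemma x_coords_zeta_rec:
  assumes "x \<in> Cn n"
  shows "x_coords n (restrict (zeta_rec n n x) {1..n}) = x"
proof -
  have "x_coords n (restrict (zeta_rec n n x) {1..n}) j = x j" if j: "j \<in> {1..n}" for j
  proof -
    have "y_low (Suc n - j) j (restrict (zeta_rec n n x) {1..n}) = y_low (Suc n - j) j (zeta_rec n n x)"
      by (rule y_low_shift_cong) (use j in auto)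
    then show ?thesis unfolding x_coords_nth[OF j] y_low_zeta_rec[OF j] .
  qed
  then show ?thesis using assms x_coords_in_Cn[of n] unfolding Cn_def by (intro PiE_ext) auto
qed

lemma zeta_rec_x_coords:
  assumes "\<zeta> \<in> Cn n"
  shows "restrict (zeta_rec n n (x_coords n \<zeta>)) {1..n} = \<zeta>"
proof -
  have "zeta_rec n n (x_coords n \<zeta>) i = \<zeta> i" if "i \<in> {1..n}" for i
    by (rule zeta_rec_y_low[of n]) (use that x_coords_nth in auto)
  then show ?thesis using assms unfolding Cn_def by (intro PiE_ext) auto
qed

lemma bij_betw_x_coords: "bij_betw (x_coords n) (Cn n) (Cn n)"
proof (rule bij_betw_byWitness[where f' = "\<lambda>x. restrict (zeta_rec n n x) {1..n}"])
  show "\<forall>\<zeta>\<in>Cn n. restrict (zeta_rec n n (x_coords n \<zeta>)) {1..n} = \<zeta>"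
    using zeta_rec_x_coords by blast
  show "\<forall>x\<in>Cn n. x_coords n (restrict (zeta_rec n n x) {1..n}) = x"
    using x_coords_zeta_rec by blast
  show "x_coords n ` Cn n \<subseteq> Cn n" using x_coords_in_Cn by blast
  show "(\<lambda>x. restrict (zeta_rec n n x) {1..n}) ` Cn n \<subseteq> Cn n"
    unfolding Cn_def by (intro image_subsetI restrict_PiE_iff[THEN iffD2]) simp
qed

lemma diffeomorphism_x_coords: "diffeomorphism n (x_coords n)"
  unfolding diffeomorphism_def
proof (intro conjI bij_betw_x_coords)
  show "smooth_map n (x_coords n)"
    unfolding smooth_map_def
  proof
    fix j assume j: "j \<in> {1..n}"
    have "\<forall>m. Ck_fun n m (\<lambda>p. y_low (Suc n - j) j p)"
      by (rule smooth.y_low[of _ _ _ "\<lambda>p. p"]) (simp add: Ck_fun_coordinate)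
    then show "\<forall>m. Ck_fun n m (\<lambda>p. x_coords n p j)"
      by (simp add: x_coords_nth[OF j])
  qed
  have inv: "the_inv_into (Cn n) (x_coords n) x = restrict (zeta_rec n n x) {1..n}" if "x \<in> Cn n" for x
  proof (rule the_inv_into_f_eq)
    show "inj_on (x_coords n) (Cn n)" using bij_betw_x_coords by (rule bij_betw_imp_inj_on)
    show "x_coords n (restrict (zeta_rec n n x) {1..n}) = x" by (rule x_coords_zeta_rec[OF that])
    show "restrict (zeta_rec n n x) {1..n} \<in> Cn n"
      unfolding Cn_def by (intro restrict_PiE_iff[THEN iffD2]) simp
  qed
  show "smooth_map n (the_inv_into (Cn n) (x_coords n))"
    unfolding smooth_map_def
  proof (intro ballI allI)
    fix j m assume j: "j \<in> {1..n}"
    have "Ck_fun n m (\<lambda>p. the_inv_into (Cn n) (x_coords n) p j) \<longleftrightarrow> Ck_fun n m (\<lambda>p. zeta_rec n n p j)"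
      by (rule Ck_fun_cong) (simp only: inv restrict_apply'[OF j])
    then show "Ck_fun n m (\<lambda>p. the_inv_into (Cn n) (x_coords n) p j)"
      using smooth_zeta_rec[of n n j] by simp
  qed
qed

section \<open>The Jacobian\<close>

abbreviation lborel_Cn :: "nat \<Rightarrow> (nat \<Rightarrow> complex) measure" where
  "lborel_Cn n \<equiv> \<Pi>\<^sub>M j\<in>{1..n}. (lborel :: complex measure)"

text \<open>The square comes from the real dimension 2 of the plane.\<close>

lemma nn_integral_complex_affine:
  fixes h :: "complex \<Rightarrow> ennreal"
  assumes [measurable]: "h \<in> borel_measurable borel" and c: "(c::real) > 0"
  shows "(\<integral>\<^sup>+y. h (of_real c * y + d) * ennreal (c\<^sup>2) \<partial>lborel) = (\<integral>\<^sup>+y. h y \<partial>lborel)"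
proof -
  have "(\<integral>\<^sup>+y. h y \<partial>lborel)
      = (\<integral>\<^sup>+y. h y \<partial>density (distr lborel borel (\<lambda>x. d + c *\<^sub>R x)) (\<lambda>_. ennreal (\<bar>c\<bar> ^ DIM(complex))))"
    using lborel_affine[of c d] c by simp
  also have "\<dots> = (\<integral>\<^sup>+y. ennreal (c\<^sup>2) * h (d + c *\<^sub>R y) \<partial>lborel)"
    using c by (subst nn_integral_density) (auto simp: nn_integral_distr)
  finally show ?thesis by (simp add: scaleR_conv_of_real mult.commute add.commute)
qed

text \<open>Fubini isolates coordinate \<open>k\<close>; as \<open>c\<close> and \<open>d\<close>
  ignore it, the inner integral is an affine substitution in one complex variable.\<close>

lemma nn_integral_affine_coordinate:
  fixes c :: "(nat \<Rightarrow> complex) \<Rightarrow> real" and d :: "(nat \<Rightarrow> complex) \<Rightarrow> complex"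
  assumes k: "k \<in> {1..n}" and f: "f \<in> borel_measurable (lborel_Cn n)"
    and c: "c \<in> borel_measurable (lborel_Cn n)" "\<And>y. c y > 0" "\<And>y t. c (y(k := t)) = c y"
    and d: "d \<in> borel_measurable (lborel_Cn n)" "\<And>y t. d (y(k := t)) = d y"
    and P: "(\<lambda>y. y(k := of_real (c y) * y k + d y)) \<in> lborel_Cn n \<rightarrow>\<^sub>M lborel_Cn n"
  shows "(\<integral>\<^sup>+y. f (y(k := of_real (c y) * y k + d y)) * ennreal ((c y)\<^sup>2) \<partial>lborel_Cn n) = (\<integral>\<^sup>+y. f y \<partial>lborel_Cn n)"
proof -
  interpret product_sigma_finite "\<lambda>_::nat. lborel :: complex measure" by standard
  define J where "J = {1..n} - {k}"
  have I: "{1..n} = insert k J" "k \<notin> J" "finite J" using k by (auto simp: J_def)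
  have g: "(\<lambda>y. f (y(k := of_real (c y) * y k + d y)) * ennreal ((c y)\<^sup>2)) \<in> borel_measurable (lborel_Cn n)"
    using measurable_compose[OF P f] c(1) by measurable
  have "(\<integral>\<^sup>+y. f (y(k := of_real (c y) * y k + d y)) * ennreal ((c y)\<^sup>2) \<partial>lborel_Cn n)
    = (\<integral>\<^sup>+x. (\<integral>\<^sup>+t. f (x(k := of_real (c x) * t + d x)) * ennreal ((c x)\<^sup>2) \<partial>lborel) \<partial>(\<Pi>\<^sub>M j\<in>J. lborel))"
    using g unfolding I(1) by (subst product_nn_integral_insert[OF I(3,2)]) (simp_all add: c(3) d(2))
  also have "\<dots> = (\<integral>\<^sup>+x. (\<integral>\<^sup>+t. f (x(k := t)) \<partial>lborel) \<partial>(\<Pi>\<^sub>M j\<in>J. lborel))"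
  proof (rule nn_integral_cong)
    fix x assume x: "x \<in> space (\<Pi>\<^sub>M j\<in>J. lborel :: complex measure)"
    have "(\<lambda>t. x(k := t)) \<in> lborel \<rightarrow>\<^sub>M lborel_Cn n"
    proof (rule measurable_fun_upd[where J = J])
      show "{1..n} = J \<union> {k}" using I by auto
      show "(\<lambda>t. x) \<in> lborel \<rightarrow>\<^sub>M (\<Pi>\<^sub>M j\<in>J. lborel)" using x by simp
    qed simp
    from measurable_compose[OF this f]
    have h: "(\<lambda>t. f (x(k := t))) \<in> borel_measurable borel" by simp
    show "(\<integral>\<^sup>+t. f (x(k := of_real (c x) * t + d x)) * ennreal ((c x)\<^sup>2) \<partial>lborel) = (\<integral>\<^sup>+t. f (x(k := t)) \<partial>lborel)"
      by (rule nn_integral_complex_affine[OF h c(2)])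
  qed
  also have "\<dots> = (\<integral>\<^sup>+y. f y \<partial>lborel_Cn n)"
    using f unfolding I(1) by (subst product_nn_integral_insert[OF I(3,2)]) simp_all
  finally show ?thesis .
qed

section \<open>Measurability of the recursions\<close>

interpretation borel: conj_algebra "\<lambda>f. f \<in> borel_measurable (M :: 'a measure)" for M
proof unfold_locales
  fix f :: "'a \<Rightarrow> complex" assume "f \<in> borel_measurable M"
  moreover have "cnj \<in> borel_measurable borel"
    by (intro borel_measurable_continuous_onI continuous_intros)
  ultimately show "(\<lambda>p. cnj (f p)) \<in> borel_measurable M"
    by (rule measurable_compose)
qed auto

lemma measurable_coordinate:
  "j \<in> {1..n} \<Longrightarrow> (\<lambda>p. p j) \<in> borel_measurable (lborel_Cn n)"
  using measurable_component_singleton[of j "{1..n}" "\<lambda>_. lborel :: complex measure"] by simp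

lemma measurable_N_prod:
  assumes "k + m \<le> Suc n" "k \<ge> 1"
  shows "N_prod m k \<in> borel_measurable (lborel_Cn n)"
proof -
  have "(\<lambda>p. complex_of_real (N_prod m k p)) \<in> borel_measurable (lborel_Cn n)"
    by (rule borel.N_prod[of k m "\<lambda>p. p"]) (use assms in \<open>intro measurable_coordinate, simp\<close>)
  moreover have "Re \<in> borel_measurable borel"
    by (intro borel_measurable_continuous_onI continuous_intros)
  ultimately have "(\<lambda>p. Re (complex_of_real (N_prod m k p))) \<in> borel_measurable (lborel_Cn n)"
    by (rule measurable_compose)
  then show ?thesis by simp
qed

lemma measurable_y_rest:
  assumes "k + m \<le> Suc n" "k \<ge> 1"
  shows "y_rest m k \<in> borel_measurable (lborel_Cn n)"
  using borel.y_rest[of k m "\<lambda>p. p" "lborel_Cn n"] assms measurable_coordinate by simp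

lemma measurable_y_low:
  assumes "k + m \<le> Suc n" "k \<ge> 1"
  shows "y_low m k \<in> borel_measurable (lborel_Cn n)"
  using borel.y_low[of k m "\<lambda>p. p" "lborel_Cn n"] assms measurable_coordinate by simp

text \<open>The order matters: x_j involves \<zeta>_j and later parameters only, so replacing from 1
  upwards keeps available what the next step needs.\<close>

definition x_partial :: "nat \<Rightarrow> nat \<Rightarrow> (nat \<Rightarrow> complex) \<Rightarrow> nat \<Rightarrow> complex" where
  "x_partial n m \<zeta> = (\<lambda>j\<in>{1..n}. if j \<le> m then y_low (Suc n - j) j \<zeta> else \<zeta> j)"

lemma measurable_x_partial: "x_partial n m \<in> lborel_Cn n \<rightarrow>\<^sub>M lborel_Cn n"
  unfolding x_partial_def
proof (rule measurable_restrict)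
  fix j assume j: "j \<in> {1..n}"
  have "(\<lambda>\<zeta>. y_low (Suc n - j) j \<zeta>) \<in> borel_measurable (lborel_Cn n)"
    using measurable_y_low[of j "Suc n - j" n] j by simp
  then show "(\<lambda>\<zeta>. if j \<le> m then y_low (Suc n - j) j \<zeta> else \<zeta> j) \<in> lborel_Cn n \<rightarrow>\<^sub>M lborel"
    using measurable_coordinate[OF j] by (cases "j \<le> m") simp_all
qed

text \<open>The coordinates are replaced one at a time: given \<open>\<zeta>\<^sub>m\<^sub>+\<^sub>1, \<dots>, \<zeta>\<^sub>n\<close>, the map from \<open>\<zeta>\<^sub>m\<close> to \<open>x\<^sub>m\<close>
  is affine.\<close>

lemma nn_integral_x_partial:
  assumes "m \<le> n" "f \<in> borel_measurable (lborel_Cn n)"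
  shows "(\<integral>\<^sup>+\<zeta>. f (x_partial n m \<zeta>) * ennreal (\<Prod>j=1..m. (N_prod (n - j) (Suc j) \<zeta>)\<^sup>2) \<partial>lborel_Cn n)
    = (\<integral>\<^sup>+\<zeta>. f \<zeta> \<partial>lborel_Cn n)"
  using assms
proof (induction m arbitrary: f)
  case 0
  have "x_partial n 0 \<zeta> = \<zeta>" if "\<zeta> \<in> space (lborel_Cn n)" for \<zeta>
    using that by (auto simp: x_partial_def space_PiM PiE_iff extensional_def restrict_def fun_eq_iff)
  then show ?case by (auto intro!: nn_integral_cong)
next
  case (Suc m)
  define k where "k = Suc m"
  have k: "k \<in> {1..n}" using Suc.prems by (simp add: k_def)
  define c where "c = N_prod (n - k) (Suc k)"
  define d where "d = (\<lambda>\<zeta>. - y_rest (n - k) (Suc k) \<zeta>)"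
  define P where "P = (\<lambda>y :: nat \<Rightarrow> complex. y(k := of_real (c y) * y k + d y))"
  have cm: "c \<in> borel_measurable (lborel_Cn n)"
    unfolding c_def by (rule measurable_N_prod) (use k in auto)
  have dm: "d \<in> borel_measurable (lborel_Cn n)"
    unfolding d_def using measurable_y_rest[of "Suc k" "n - k" n] k by simp
  have cd_cong: "c y = c y' \<and> d y = d y'" if "\<And>i. i > k \<Longrightarrow> i \<le> n \<Longrightarrow> y i = y' i" for y y'
    unfolding c_def d_def using y_rest_N_prod_cong[of "n - k" y "Suc k" y'] that by simp
  have Pm: "P \<in> lborel_Cn n \<rightarrow>\<^sub>M lborel_Cn n"
    unfolding P_def
  proof (rule measurable_fun_upd[where J = "{1..n}"])
    show "{1..n} = {1..n} \<union> {k}" using k by auto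
    have "(\<lambda>y. complex_of_real (c y) * y k + d y) \<in> borel_measurable (lborel_Cn n)"
      using cm dm measurable_coordinate[OF k] by measurable
    then show "(\<lambda>y. complex_of_real (c y) * y k + d y) \<in> lborel_Cn n \<rightarrow>\<^sub>M lborel" by simp
  qed simp
  have F: "(\<lambda>y. f (P y) * ennreal ((c y)\<^sup>2)) \<in> borel_measurable (lborel_Cn n)"
    using measurable_compose[OF Pm Suc.prems(2)] cm by measurable
  have "(\<integral>\<^sup>+\<zeta>. f (x_partial n (Suc m) \<zeta>) * ennreal (\<Prod>j=1..Suc m. (N_prod (n - j) (Suc j) \<zeta>)\<^sup>2) \<partial>lborel_Cn n)
    = (\<integral>\<^sup>+\<zeta>. (f (P (x_partial n m \<zeta>)) * ennreal ((c (x_partial n m \<zeta>))\<^sup>2)) *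
        ennreal (\<Prod>j=1..m. (N_prod (n - j) (Suc j) \<zeta>)\<^sup>2) \<partial>lborel_Cn n)"
  proof (rule nn_integral_cong)
    fix \<zeta> assume "\<zeta> \<in> space (lborel_Cn n)"
    \<comment> \<open>\<open>c\<close> and \<open>d\<close> look only at coordinates beyond
      \<open>k\<close>, none of which has been replaced yet.\<close>
    have cd: "c (x_partial n m \<zeta>) = c \<zeta> \<and> d (x_partial n m \<zeta>) = d \<zeta>"
      by (rule cd_cong) (auto simp: x_partial_def k_def)
    have yk: "y_low (Suc n - k) k \<zeta> = of_real (c \<zeta>) * \<zeta> k + d \<zeta>"
      using y_low_Suc[of "n - k" k \<zeta>] k by (simp add: c_def d_def Suc_diff_le)
    have "x_partial n (Suc m) \<zeta> = P (x_partial n m \<zeta>)"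
    proof
      fix j
      show "x_partial n (Suc m) \<zeta> j = P (x_partial n m \<zeta>) j"
      proof (cases "j = k")
        case True
        have "x_partial n m \<zeta> k = \<zeta> k" using k by (simp add: x_partial_def k_def)
        moreover have "x_partial n (Suc m) \<zeta> k = y_low (Suc n - k) k \<zeta>"
          using k by (simp add: x_partial_def k_def)
        ultimately show ?thesis unfolding P_def using True cd yk by simp
      next
        case False
        then show ?thesis by (auto simp: P_def x_partial_def k_def)
      qed
    qed
    moreover have "(\<Prod>j=1..Suc m. (N_prod (n - j) (Suc j) \<zeta>)\<^sup>2)
        = (c \<zeta>)\<^sup>2 * (\<Prod>j=1..m. (N_prod (n - j) (Suc j) \<zeta>)\<^sup>2)"
      by (simp add: c_def k_def mult.commute)
    ultimately show "f (x_partial n (Suc m) \<zeta>) * ennreal (\<Prod>j=1..Suc m. (N_prod (n - j) (Suc j) \<zeta>)\<^sup>2)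
      = (f (P (x_partial n m \<zeta>)) * ennreal ((c (x_partial n m \<zeta>))\<^sup>2)) *
        ennreal (\<Prod>j=1..m. (N_prod (n - j) (Suc j) \<zeta>)\<^sup>2)"
      using cd by (simp only: ennreal_mult'[OF zero_le_power2] mult.assoc)
  qed
  also have "\<dots> = (\<integral>\<^sup>+y. f (P y) * ennreal ((c y)\<^sup>2) \<partial>lborel_Cn n)"
    by (rule Suc.IH[OF _ F]) (use Suc.prems in simp)
  also have "\<dots> = (\<integral>\<^sup>+y. f y \<partial>lborel_Cn n)"
    unfolding P_def
  proof (rule nn_integral_affine_coordinate[OF k Suc.prems(2) cm _ _ dm])
    show "c y > 0" for y unfolding c_def by (rule N_prod_pos)
    show "c (y(k := t)) = c y" "d (y(k := t)) = d y" for y t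
      using cd_cong[of "y(k := t)" y] by auto
    show "(\<lambda>y. y(k := of_real (c y) * y k + d y)) \<in> lborel_Cn n \<rightarrow>\<^sub>M lborel_Cn n"
      using Pm unfolding P_def .
  qed
  finally show ?case .
qed

text \<open>\<zeta>_j occurs in the slopes of the j - 1 earlier coordinates, and each slope enters
  squared.\<close>

lemma prod_N_prod:
  "(\<Prod>j=1..n. (N_prod (n - j) (Suc j) \<zeta>)\<^sup>2) = (\<Prod>j=1..n. (1 + (cmod (\<zeta> j))\<^sup>2) ^ (2 * (j - 1)))"
proof (induction n)
  case (Suc n)
  have "N_prod (Suc n - j) (Suc j) \<zeta> = N_prod (n - j) (Suc j) \<zeta> * (1 + (cmod (\<zeta> (Suc n)))\<^sup>2)"
    if "j \<in> {1..n}" for j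
    using that by (simp add: N_prod_eq Suc_diff_le)
  then have "(\<Prod>j=1..Suc n. (N_prod (Suc n - j) (Suc j) \<zeta>)\<^sup>2)
      = (\<Prod>j=1..n. (N_prod (n - j) (Suc j) \<zeta>)\<^sup>2 * (1 + (cmod (\<zeta> (Suc n)))\<^sup>2)\<^sup>2)"
    by (simp add: power_mult_distrib)
  also have "\<dots> = (\<Prod>j=1..n. (N_prod (n - j) (Suc j) \<zeta>)\<^sup>2) * (1 + (cmod (\<zeta> (Suc n)))\<^sup>2) ^ (2 * n)"
    by (simp add: prod.distrib power_mult)
  finally show ?case unfolding Suc by simp
qed simp

lemma distr_density_x_coords:
  "distr (density (lborel_Cn n) (\<lambda>\<zeta>. ennreal (\<Prod>j=1..n. (1 + (cmod (\<zeta> j))\<^sup>2) ^ (2 * (j - 1)))))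
     (lborel_Cn n) (x_coords n) = lborel_Cn n"
proof (rule measure_eqI)
  let ?\<rho> = "\<lambda>\<zeta>. ennreal (\<Prod>j=1..n. (1 + (cmod (\<zeta> j))\<^sup>2) ^ (2 * (j - 1)))"
  let ?D = "density (lborel_Cn n) ?\<rho>"
  have x: "x_coords n = x_partial n n"
    by (auto simp: x_coords_eq x_explicit_def x_partial_def fun_eq_iff)
  have xm: "x_coords n \<in> lborel_Cn n \<rightarrow>\<^sub>M lborel_Cn n" unfolding x by (rule measurable_x_partial)
  have \<rho>: "?\<rho> \<in> borel_measurable (lborel_Cn n)"
  proof -
    have "(\<lambda>\<zeta>. (1 + (cmod (\<zeta> j))\<^sup>2) ^ (2 * (j - 1))) \<in> borel_measurable (lborel_Cn n)" if "j \<in> {1..n}" for j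
      using measurable_coordinate[OF that] by measurable
    then show ?thesis by (intro measurable_compose[OF _ measurable_ennreal] borel_measurable_prod)
  qed
  fix A assume "A \<in> sets (distr ?D (lborel_Cn n) (x_coords n))"
  then have A: "A \<in> sets (lborel_Cn n)" by simp
  have "emeasure (distr ?D (lborel_Cn n) (x_coords n)) A
      = (\<integral>\<^sup>+y. indicator A y \<partial>distr ?D (lborel_Cn n) (x_coords n))"
    using A by simp
  also have "\<dots> = (\<integral>\<^sup>+\<zeta>. indicator A (x_coords n \<zeta>) \<partial>?D)"
    by (rule nn_integral_distr) (use xm A in auto)
  also have "\<dots> = (\<integral>\<^sup>+\<zeta>. ?\<rho> \<zeta> * indicator A (x_coords n \<zeta>) \<partial>lborel_Cn n)"
    by (rule nn_integral_density[OF \<rho>])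
       (rule measurable_compose[OF xm borel_measurable_indicator[OF A]])
  also have "\<dots> = (\<integral>\<^sup>+\<zeta>. indicator A (x_partial n n \<zeta>) *
      ennreal (\<Prod>j=1..n. (N_prod (n - j) (Suc j) \<zeta>)\<^sup>2) \<partial>lborel_Cn n)"
    unfolding x prod_N_prod by (simp only: mult.commute)
  also have "\<dots> = (\<integral>\<^sup>+y. indicator A y \<partial>lborel_Cn n)"
    by (rule nn_integral_x_partial) (use A in auto)
  also have "\<dots> = emeasure (lborel_Cn n) A" using A by simp
  finally show "emeasure (distr ?D (lborel_Cn n) (x_coords n)) A = emeasure (lborel_Cn n) A" .
qed simp

section \<open>From the recursions to the stated formulas\<close>

lemma det_one_plus_BB_cong:
  assumes "\<And>j. 1 \<le> j \<Longrightarrow> j \<le> m \<Longrightarrow> y j = y' j"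
  shows "det_one_plus_BB m y = det_one_plus_BB m y'"
proof -
  have "B_mat m y = B_mat m y'"
    by (rule eq_matI) (auto simp: B_mat_def intro!: assms)
  then show ?thesis by (simp add: det_one_plus_BB_def)
qed

lemma W_prod_eq: "W_prod m (Suc l) \<zeta> = (\<Prod>j=1..m. (1 + (cmod (\<zeta> (j + l)))\<^sup>2) ^ j)"
  unfolding W_prod_def by (simp add: prod.atLeast1_atMost_eq add.commute)

text \<open>The coordinates from l + 1 on are those of the parameters from \<zeta>_(l+1) on, so (d)
  is the determinant formula for a tail.\<close>

lemma det_one_plus_BB_x_coords:
  assumes "l \<le> n"
  shows "det_one_plus_BB (n - l) (\<lambda>j. x_coords n \<zeta> (j + l)) = of_real (W_prod (n - l) (Suc l) \<zeta>)"
proof -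
  have "x_coords n \<zeta> (j + l) = coeff (Y_poly (n - l) (Suc l) \<zeta>) (j - 1)" if j: "1 \<le> j" "j \<le> n - l" for j
  proof -
    have e: "j - 1 < n - l" "n - l - (j - 1) = Suc n - (j + l)" "Suc l + (j - 1) = j + l"
      using j by auto
    have "j + l \<in> {1..n}" using j assms by auto
    then show ?thesis unfolding coeff_Y_poly[OF e(1)] e(2,3) by (rule x_coords_nth)
  qed
  then have "det_one_plus_BB (n - l) (\<lambda>j. x_coords n \<zeta> (j + l))
      = det_one_plus_BB (n - l) (\<lambda>j. coeff (Y_poly (n - l) (Suc l) \<zeta>) (j - 1))"
    by (rule det_one_plus_BB_cong)
  then show ?thesis unfolding det_one_plus_BB_eq_W .
qed

text \<open>Covers both identities in (b): stability under appended zeros is \<open>k = j\<close>,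
  the shift to the first coordinate is \<open>k = 1\<close>.\<close>

lemma x_coords_shift_extend:
  assumes j: "j \<in> {1..n}" and M: "M \<ge> n - j + k" "k \<ge> 1"
    and \<zeta>': "\<And>i. i < Suc n - j \<Longrightarrow> \<zeta>' (k + i) = \<zeta> (j + i)" "\<And>i. n - j + k < i \<Longrightarrow> i \<le> M \<Longrightarrow> \<zeta>' i = 0"
  shows "x_coords n \<zeta> j = x_coords M \<zeta>' k"
proof -
  have kM: "k \<in> {1..M}" using M by auto
  define m where "m = Suc n - j"
  define r where "r = M - (n - j + k)"
  have e: "Suc M - k = m + r" using j M by (simp add: m_def r_def)
  have "x_coords M \<zeta>' k = y_low (m + r) k \<zeta>'" unfolding x_coords_nth[OF kM] e ..
  also have "\<dots> = y_low m k \<zeta>'"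
    by (rule y_low_zero_extend) (use j M in \<open>intro \<zeta>'(2), auto simp: m_def r_def\<close>)
  also have "\<dots> = y_low m j \<zeta>"
    by (rule y_low_shift_cong) (simp add: \<zeta>'(1) m_def)
  finally show ?thesis unfolding x_coords_nth[OF j] m_def by simp
qed

lemma prod_inverse_sqrt:
  "(\<Prod>j\<in>A. 1 / sqrt (f j)) = 1 / sqrt (\<Prod>j\<in>A. f j)"
  by (induction A rule: infinite_finite_induct) (simp_all add: real_sqrt_mult)

lemma abs_sigma_quotient:
  assumes "n > 0"
  shows "abs_sigma0 (g_loop n \<zeta>) / abs_sigma1 (g_loop n \<zeta>) = (\<Prod>j=1..n. 1 / sqrt (1 + (cmod (\<zeta> j))\<^sup>2))"
proof -
  obtain m where n: "n = Suc m" using assms by (cases n) auto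
  define V where "V = W_prod m 2 \<zeta>"
  have V: "V > 0" unfolding V_def by (rule W_prod_pos)
  have W: "W_prod (Suc m) 1 \<zeta> = N_prod (Suc m) 1 \<zeta> * V"
    unfolding V_def using W_prod_Suc[of m 1 \<zeta>] by (simp only: Suc_1)
  have "abs_sigma0 (g_loop n \<zeta>) / abs_sigma1 (g_loop n \<zeta>)
      = sqrt (1 / (N_prod (Suc m) 1 \<zeta> * V)) / sqrt (1 / V)"
    unfolding abs_sigma0_def abs_sigma1_def n sigma0_sq_g_loop sigma1_sq_g_loop Re_complex_of_real W
    unfolding V_def ..
  also have "\<dots> = 1 / sqrt (N_prod (Suc m) 1 \<zeta>)"
    using V by (simp add: real_sqrt_mult real_sqrt_divide del: N_prod.simps)
  also have "N_prod (Suc m) 1 \<zeta> = (\<Prod>j=1..n. 1 + (cmod (\<zeta> j))\<^sup>2)"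
    unfolding N_prod_eq n by (simp add: prod.atLeast1_atMost_eq)
  finally show ?thesis unfolding prod_inverse_sqrt .
qed

lemma prod_inverse_eq_W_prod:
  "complex_of_real (\<Prod>j=1..n. 1 / (1 + (cmod (\<zeta> (j + l)))\<^sup>2) ^ j) = 1 / of_real (W_prod n (Suc l) \<zeta>)"
  unfolding W_prod_eq by (simp add: prod_dividef)

lemma sigma_sq_det:
  assumes "n > 0"
  shows "sigma0_sq (g_loop n \<zeta>) = 1 / det_one_plus_BB n (x_coords n \<zeta>)" (is ?S0)
    "1 / det_one_plus_BB n (x_coords n \<zeta>) = complex_of_real (\<Prod>j=1..n. 1 / (1 + (cmod (\<zeta> j))\<^sup>2) ^ j)" (is ?D0)
    "sigma1_sq (g_loop n \<zeta>) = 1 / det_one_plus_BB (n - 1) (\<lambda>j. x_coords n \<zeta> (j + 1))" (is ?S1)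
    "1 / det_one_plus_BB (n - 1) (\<lambda>j. x_coords n \<zeta> (j + 1))
      = complex_of_real (\<Prod>j=1..n-1. 1 / (1 + (cmod (\<zeta> (j + 1)))\<^sup>2) ^ j)" (is ?D1)
proof -
  have B0: "det_one_plus_BB n (x_coords n \<zeta>) = of_real (W_prod n 1 \<zeta>)"
    using det_one_plus_BB_x_coords[of 0 n \<zeta>] by simp
  have B1: "det_one_plus_BB (n - 1) (\<lambda>j. x_coords n \<zeta> (j + 1)) = of_real (W_prod (n - 1) 2 \<zeta>)"
    using det_one_plus_BB_x_coords[of 1 n \<zeta>] assms by (simp add: numeral_2_eq_2)
  have s1: "sigma1_sq (g_loop n \<zeta>) = 1 / of_real (W_prod (n - 1) 2 \<zeta>)"
    using sigma1_sq_g_loop[of "n - 1" \<zeta>] assms by simp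
  show ?S0 unfolding B0 sigma0_sq_g_loop by simp
  show ?D0 unfolding B0 using prod_inverse_eq_W_prod[where l = 0] by simp
  show ?S1 unfolding B1 s1 ..
  show ?D1 unfolding B1 using prod_inverse_eq_W_prod[where l = 1] by (simp add: numeral_2_eq_2)
qed

theorem theorem5:
  fixes n :: nat
  assumes "n > 0"
  shows
    \<comment> \<open>(a)\<close>
    "N_minus \<inter> conj_loops (w_loop n) N_plus = {upper_loop n x | x. x \<in> Cn n} \<and>
    \<comment> \<open>(b)\<close>
    (\<forall>\<zeta>\<in>Cn n. \<exists>l a u. l \<in> N_minus \<inter> conj_loops (w_loop n) N_plus \<and>
       triangular_factorization (g_loop n \<zeta>) l a u \<and> l = upper_loop n (x_coords n \<zeta>)) \<and>
    diffeomorphism n (x_coords n) \<and>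
    (\<forall>N>n. \<forall>\<zeta>\<in>Cn n. \<forall>j\<in>{1..n}.
       x_coords n \<zeta> j = x_coords N (\<lambda>i\<in>{1..N}. if i \<le> n then \<zeta> i else 0) j) \<and>
    (\<forall>\<zeta>\<in>Cn n. \<forall>j\<in>{1..n}. \<forall>M\<ge>n - j + 1.
       x_coords n \<zeta> j
         = x_coords M (\<lambda>i\<in>{1..M}. if i \<le> n - j + 1 then \<zeta> (j + i - 1) else 0) 1) \<and>
    \<comment> \<open>(c)\<close>
    (\<forall>\<zeta>\<in>Cn n.
       sigma0_sq (g_loop n \<zeta>) = 1 / det_one_plus_BB n (x_coords n \<zeta>) \<and>
       1 / det_one_plus_BB n (x_coords n \<zeta>)
         = complex_of_real (\<Prod>j=1..n. 1 / (1 + (cmod (\<zeta> j))\<^sup>2) ^ j) \<and>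
       sigma1_sq (g_loop n \<zeta>)
         = 1 / det_one_plus_BB (n - 1) (\<lambda>j. x_coords n \<zeta> (j + 1)) \<and>
       1 / det_one_plus_BB (n - 1) (\<lambda>j. x_coords n \<zeta> (j + 1))
         = complex_of_real (\<Prod>j=1..n-1. 1 / (1 + (cmod (\<zeta> (j + 1)))\<^sup>2) ^ j) \<and>
       abs_sigma0 (g_loop n \<zeta>) / abs_sigma1 (g_loop n \<zeta>)
         = (\<Prod>j=1..n. 1 / sqrt (1 + (cmod (\<zeta> j))\<^sup>2))) \<and>
    \<comment> \<open>(d)\<close>
    (\<forall>\<zeta>\<in>Cn n. \<forall>l<n.
       det_one_plus_BB (n - l) (\<lambda>j. x_coords n \<zeta> (j + l))
         = complex_of_real (\<Prod>j=1..n-l. (1 + (cmod (\<zeta> (j + l)))\<^sup>2) ^ j)) \<and>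
    \<comment> \<open>(e)\<close>
    distr
      (density (\<Pi>\<^sub>M j\<in>{1..n}. (lborel :: complex measure))
         (\<lambda>\<zeta>. ennreal (\<Prod>j=1..n. (1 + (cmod (\<zeta> j))\<^sup>2) ^ (2 * (j - 1)))))
      (\<Pi>\<^sub>M j\<in>{1..n}. (lborel :: complex measure)) (x_coords n)
    = (\<Pi>\<^sub>M j\<in>{1..n}. (lborel :: complex measure))"
  apply (intro conjI)
  subgoal by (rule N_minus_inter_conj_w_loop[OF assms])
  subgoal using triangular_factorization_g_loop[of n] upper_loop_in_N_minus upper_loop_in_conj[OF assms]
    unfolding x_coords_eq by blast
  subgoal by (rule diffeomorphism_x_coords)
  subgoal by (intro allI impI ballI x_coords_shift_extend) auto
  subgoal by (intro allI impI ballI x_coords_shift_extend) auto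
  subgoal using sigma_sq_det[OF assms] abs_sigma_quotient[OF assms] by blast
  subgoal using det_one_plus_BB_x_coords unfolding W_prod_eq by simp
  subgoal by (rule distr_density_x_coords)
  done

end
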